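(* Let $g:X\to\mathbb{R}^d$ be measurable. Suppose that: (i) each $\Pi_k$ ($k=1,\dots,K$) is a Gibbs kernel with respect to $(h_k,\pi)$ for some measurable $h_k:X\to\mathbb{R}^{m_k}$, $m_k\ge1$; (ii) there is a probability measure $\psi$ on $(X,\mathscr{X})$ such that for each $k=1,\dots,K$, each $A\in\mathscr{X}$ with $\psi(A)>0$ and each $x\in X$ there is a positive integer $t$ with $P_k^{Kt}(x,A)>0$; (iii) for $k=1,\dots,K$ there are sets $D_k\in\mathscr{X}$ that are small with respect to $P_k^K$, constants $\lambda_k<1$ and $b_k<\infty$, and measurable functions $W_k:X\to[1,\infty)$ with $P_k^KW_k(x)\le \lambda_kW_k(x)+b_kI_{D_k}(x)$ for all $x\in X$; (iv) $\int\pi(dx)W_k^2(x)<\infty$ for each $k$; (v) $|a^Tg(x)|\le W_k(x)$ for all $x\in X$, all $k$ and all $a\in\mathbb{R}^d$ with $\|a\|_2\le 1$; (vi) $\int\pi(dx)g(x)=0$. Let $\Sigma_0$ and $\Sigma_1$ be the asymptotic variances, along the deterministic sweep chain $\{X_t\}$ with arbitrary initial law, of the empirical sums $\sum_{t=0}^{M-1}g(X_t)$ and of the Rao-Blackwellized sums $\sum_{t=0}^{M-1}\Pi_{\sigma^t(1)}g(X_t)$, respectively. Then $$\Sigma_0=K^{-1}\sum_{k=1}^K\Big[\int\pi(dx)gg^T+\sum_{t=1}^\infty\int\pi(dx)\{g(P_k^tg)^T+(P_k^tg)g^T\}\Big]$$ and $$\Sigma_1=\Sigma_0-\int\pi(dx)gg^T-K^{-1}\sum_{k=1}^K\int\pi(dx)(\Pi_kg)(\Pi_kg)^T\le\Sigma_0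 .$$
   Context: $X$ is a complete separable metric space with Borel $\sigma$-algebra $\mathscr{X}$, $\pi$ is a probability measure on $(X,\mathscr{X})$, $K\ge1$ is an integer and $\Pi_1,\dots,\Pi_K:X\times\mathscr{X}\to[0,1]$ are probability kernels. A kernel $\Pi$ is a Gibbs kernel with respect to $(h,\pi)$ if it is a regular conditional distribution given $\sigma(h)$ under $\pi$: for each $A\in\mathscr{X}$, $\Pi(\cdot,A)=E_\pi\{I_A\mid\sigma(h)\}$ $\pi$-a.e. For a function $u$, $\Pi u(x)=\int\Pi(x,dy)u(y)$ (elementwise for vector valued $u$; for real-valued $\pi$-integrable $u$ the integral converges absolutely for $\pi$-a.e. $x$, and we set $\Pi u(x)=0$ where it does not). $I_A$ is the indicator function of $A$. $\sigma:\{1,\dots,K\}\to\{1,\dots,K\}$ is the cyclic permutation $\sigma(k)=k+1$ for $k<K$, $\sigma(K)=1$; $\sigma^t$ is its $t$-fold iterate. $P_k^0u=u$, $P_k^tu=\Pi_{\sigma^0(k)}\Pi_{\sigma^1(k)}\cdots\Pi_{\sigma^{t-1}(k)}u$ for $t\ge1$, and $P_k^t(x,A)=P_k^tI_A(x)$. A set $D\in\mathscr{X}$ is small with respect to a probability kernel $P$ if there are an integer $m>0$ and a non-trivial measure $\nu_m$ on $(X,\mathscr{X})$ with $P^m(x,B)\ge\nu_m(B)$ for all $x\in D$, $B\in\mathscr{X}$. The deterministic sweep chain with initial law $\nu$ is the Markov chain with $X_0\sim\nu$ and, given $X_0,\dots,X_t$, $X_{t+1}\sim\Pi_{\sigma^t(1)}(X_t,\cdot)$.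 The asymptotic variance of sums $S_M$ is the $d\times d$ positive semidefinite matrix $\Sigma$ such that $M^{-1/2}S_M$ converges in distribution, as $M\to\infty$, to a random vector with characteristic function $t\mapsto\exp\{-t^T\Sigma t/2\}$. For symmetric matrices, $A\le B$ means $B-A$ is positive semidefinite.
   Formalization: In (iii), P_k^K W_k(x) is the [0,∞]-valued integral of W_k against P_k^K(x,·), so the drift inequality requires it to be finite at every x; the convention of setting divergent integrals to 0 is not applied there, since with it the claim fails. *)

theory Defs
  imports "HOL-Probability.Probability"
begin

definition prob_kernel :: "('a::topological_space \<Rightarrow> 'a measure) \<Rightarrow> bool" where
  "prob_kernel P \<longleftrightarrow> P \<in> borel \<rightarrow>\<^sub>M prob_algebra borel"

text \<open>
  The range of \<^term>\<open>h\<close> is \<open>\<real>\<^sup>m\<close>, represented as a finite product of Borel spaces over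
  the index set \<open>{..<m}\<close>, because \<open>m\<close> varies with the kernel.
\<close>

definition gibbs_kernel ::
  "('a::topological_space \<Rightarrow> 'a measure) \<Rightarrow> nat \<Rightarrow> ('a \<Rightarrow> nat \<Rightarrow> real) \<Rightarrow> 'a measure \<Rightarrow> bool" where
  "gibbs_kernel P m h \<pi> \<longleftrightarrow>
     prob_kernel P \<and>
     (\<forall>A\<in>sets borel. AE x in \<pi>. measure (P x) A =
        real_cond_exp \<pi> (vimage_algebra (space \<pi>) h (PiM {..<m} (\<lambda>_. borel))) (indicator A) x)"

text \<open>
  Coordinatewise, so that a coordinate of \<^term>\<open>u\<close> that is not integrable is sent to 0
  without affecting the others.
\<close>

definition kernel_op ::
  "('a \<Rightarrow> 'a measure) \<Rightarrow> ('a \<Rightarrow> real ^ 'd) \<Rightarrow> 'a \<Rightarrow> real ^ 'd" where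
  "kernel_op P u x = (\<chi> i. LINT y|P x. u y $ i)"

definition cyc :: "nat \<Rightarrow> nat \<Rightarrow> nat" where
  "cyc K k = (if k < K then k + 1 else 1)"

text \<open>
  \<^term>\<open>sweep_op P K t k u\<close> is \<open>P\<^sub>k\<^sup>t u\<close>, using \<open>P\<^sub>k\<^sup>t\<^sup>+\<^sup>1 = \<Pi>\<^sub>k P\<^sup>t\<close> with the inner factor started
  at the successor of \<open>k\<close>; \<^term>\<open>sweep_kernel P K t k x\<close> is the measure \<open>P\<^sub>k\<^sup>t(x, \<cdot>)\<close>,
  built by kernel composition (see \<open>sweep_op_indicator\<close> for their agreement).
\<close>

primrec sweep_op ::
  "(nat \<Rightarrow> 'a \<Rightarrow> 'a measure) \<Rightarrow> nat \<Rightarrow> nat \<Rightarrow> nat \<Rightarrow> ('a \<Rightarrow> real ^ 'd) \<Rightarrow> 'a \<Rightarrow> real ^ 'd" where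
  "sweep_op P K 0 k u = u"
| "sweep_op P K (Suc t) k u = kernel_op (P k) (sweep_op P K t (cyc K k) u)"

primrec sweep_kernel ::
  "(nat \<Rightarrow> 'a::topological_space \<Rightarrow> 'a measure) \<Rightarrow> nat \<Rightarrow> nat \<Rightarrow> nat \<Rightarrow> 'a \<Rightarrow> 'a measure" where
  "sweep_kernel P K 0 k = return borel"
| "sweep_kernel P K (Suc t) k = (\<lambda>x. bind (P k x) (sweep_kernel P K t (cyc K k)))"

primrec kernel_power :: "('a::topological_space \<Rightarrow> 'a measure) \<Rightarrow> nat \<Rightarrow> 'a \<Rightarrow> 'a measure" where
  "kernel_power P 0 = return borel"
| "kernel_power P (Suc n) = (\<lambda>x. bind (P x) (kernel_power P n))"

definition small_set :: "('a::topological_space \<Rightarrow> 'a measure) \<Rightarrow> 'a set \<Rightarrow> bool" where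
  "small_set P D \<longleftrightarrow>
     D \<in> sets borel \<and>
     (\<exists>m>0. \<exists>\<nu>. sets \<nu> = sets borel \<and> emeasure \<nu> (space \<nu>) \<noteq> 0 \<and>
        (\<forall>x\<in>D. \<forall>B\<in>sets borel. emeasure \<nu> B \<le> emeasure (kernel_power P m x) B))"

lemma cyc_in_range: "k \<in> {1..K} \<Longrightarrow> cyc K k \<in> {1..K}"
  by (auto simp: cyc_def)

lemma sweep_kernel_measurable:
  assumes "\<And>k. k \<in> {1..K} \<Longrightarrow> prob_kernel (P k)" and "k \<in> {1..K}"
  shows "prob_kernel (sweep_kernel P K t k)"
  using assms(2)
proof (induction t arbitrary: k)
  case 0
  show ?case by (simp add: prob_kernel_def)
next
  case (Suc t)
  have "P k \<in> borel \<rightarrow>\<^sub>M prob_algebra borel"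
    "sweep_kernel P K t (cyc K k) \<in> borel \<rightarrow>\<^sub>M prob_algebra borel"
    using assms(1)[OF Suc.prems] Suc.IH[OF cyc_in_range[OF Suc.prems]]
    by (simp_all add: prob_kernel_def)
  then show ?case
    by (simp add: prob_kernel_def measurable_bind_prob_space)
qed

lemma sweep_op_indicator:
  assumes ker: "\<And>k. k \<in> {1..K} \<Longrightarrow> prob_kernel (P k)" and "k \<in> {1..K}" and A: "A \<in> sets borel"
  shows "sweep_op P K t k (\<lambda>y. \<chi> i. indicator A y) x =
           (\<chi> i. measure (sweep_kernel P K t k x) A)"
  using assms(2)
proof (induction t arbitrary: k x)
  case 0
  show ?case using A by (simp add: measure_return)
next
  case (Suc t)
  let ?Q = "sweep_kernel P K t (cyc K k)"
  have Q: "?Q \<in> borel \<rightarrow>\<^sub>M prob_algebra borel"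
    using sweep_kernel_measurable[OF ker cyc_in_range[OF Suc.prems]] by (simp add: prob_kernel_def)
  have Pk: "P k x \<in> space (prob_algebra borel)"
    using ker[OF Suc.prems] by (auto simp: prob_kernel_def dest: measurable_space)
  then have s: "sets (P k x) = sets borel" and p: "prob_space (P k x)"
    by (auto simp: space_prob_algebra)
  interpret prob_space "P k x" by fact
  have "?Q \<in> P k x \<rightarrow>\<^sub>M subprob_algebra borel"
    using measurable_prob_algebraD[OF Q] measurable_cong_sets[OF s refl] by blast
  then have "measure (bind (P k x) ?Q) A = (LINT y|P k x. measure (?Q y) A)"
    using A by (rule measure_bind)
  then show ?case
    by (simp add: kernel_op_def Suc.IH[OF cyc_in_range[OF Suc.prems]])
qed

definition sweep_chain ::
  "(nat \<Rightarrow> 'a::topological_space \<Rightarrow> 'a measure) \<Rightarrow> nat \<Rightarrow> 'a measure \<Rightarrow>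
   'w measure \<Rightarrow> (nat \<Rightarrow> 'w \<Rightarrow> 'a) \<Rightarrow> bool" where
  "sweep_chain P K \<nu> M X \<longleftrightarrow>
     prob_space M \<and>
     (\<forall>t. X t \<in> M \<rightarrow>\<^sub>M borel) \<and>
     distr M borel (X 0) = \<nu> \<and>
     (\<forall>t. \<forall>A\<in>sets borel. AE \<omega> in M.
        real_cond_exp M
          (vimage_algebra (space M) (\<lambda>\<omega>. \<lambda>i\<in>{..t}. X i \<omega>) (PiM {..t} (\<lambda>_. borel)))
          (\<lambda>\<omega>. indicator A (X (Suc t) \<omega>)) \<omega>
        = measure (P ((cyc K ^^ t) 1) (X t \<omega>)) A)"

definition outer_prod :: "real ^ 'd \<Rightarrow> real ^ 'd \<Rightarrow> real ^ 'd ^ 'd" where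
  "outer_prod u v = (\<chi> i j. u $ i * v $ j)"

definition psd :: "real ^ 'd ^ 'd \<Rightarrow> bool" where
  "psd A \<longleftrightarrow> transpose A = A \<and> (\<forall>v. 0 \<le> v \<bullet> (A *v v))"

text \<open>The order \<open>\<le>\<close> that the library provides on matrices is the entrywise one.\<close>

definition loewner_le :: "real ^ 'd ^ 'd \<Rightarrow> real ^ 'd ^ 'd \<Rightarrow> bool" where
  "loewner_le A B \<longleftrightarrow> psd (B - A)"

definition conv_in_distr ::
  "'w measure \<Rightarrow> (nat \<Rightarrow> 'w \<Rightarrow> 'b::topological_space) \<Rightarrow> 'b measure \<Rightarrow> bool" where
  "conv_in_distr M Y N \<longleftrightarrow>
     (\<forall>f :: 'b \<Rightarrow> real. continuous_on UNIV f \<and> bounded (range f) \<longrightarrow>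
        (\<lambda>n. LINT \<omega>|M. f (Y n \<omega>)) \<longlonglongrightarrow> (LINT y|N. f y))"

definition asymptotic_variance ::
  "'w measure \<Rightarrow> (nat \<Rightarrow> 'w \<Rightarrow> real ^ 'd) \<Rightarrow> real ^ 'd ^ 'd \<Rightarrow> bool" where
  "asymptotic_variance M S \<Sigma> \<longleftrightarrow>
     psd \<Sigma> \<and>
     (\<exists>N. prob_space N \<and> sets N = sets borel \<and>
        (\<forall>t. (CLINT y|N. iexp (t \<bullet> y)) = complex_of_real (exp (- (t \<bullet> (\<Sigma> *v t)) / 2))) \<and>
        conv_in_distr M (\<lambda>n \<omega>. (1 / sqrt (real n)) *\<^sub>R S n \<omega>) N)"

lemma asymptotic_variance_cos:
  fixes S :: "nat \<Rightarrow> 'w \<Rightarrow> real ^ 'd"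
  assumes "asymptotic_variance M S \<Sigma>"
  shows "(\<lambda>n. LINT \<omega>|M. cos (t \<bullet> ((1 / sqrt (real n)) *\<^sub>R S n \<omega>)))
           \<longlonglongrightarrow> exp (- (t \<bullet> (\<Sigma> *v t)) / 2)"
proof -
  obtain N where N: "prob_space N" "sets N = sets borel"
    and cf: "(CLINT y|N. iexp (t \<bullet> y)) = complex_of_real (exp (- (t \<bullet> (\<Sigma> *v t)) / 2))"
    and conv: "conv_in_distr M (\<lambda>n \<omega>. (1 / sqrt (real n)) *\<^sub>R S n \<omega>) N"
    using assms unfolding asymptotic_variance_def by blast
  interpret prob_space N by fact
  have "(\<lambda>y::real ^ 'd. iexp (t \<bullet> y)) \<in> borel_measurable borel"
    by (intro borel_measurable_continuous_onI continuous_intros)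
  then have "(\<lambda>y. iexp (t \<bullet> y)) \<in> borel_measurable N"
    using measurable_cong_sets[OF N(2) refl] by blast
  then have "integrable N (\<lambda>y. iexp (t \<bullet> y))"
    by (intro integrable_const_bound[of _ 1]) auto
  then have "Re (CLINT y|N. iexp (t \<bullet> y)) = (LINT y|N. Re (iexp (t \<bullet> y)))"
    by (rule integral_Re[symmetric])
  then have int: "(LINT y|N. cos (t \<bullet> y)) = exp (- (t \<bullet> (\<Sigma> *v t)) / 2)"
    unfolding cf by (simp add: Re_exp)
  have cont: "continuous_on UNIV (\<lambda>y::real ^ 'd. cos (t \<bullet> y))"
    by (intro continuous_intros)
  have bdd: "bounded (range (\<lambda>y::real ^ 'd. cos (t \<bullet> y)))"
    by (rule boundedI[of _ 1]) auto
  show ?thesis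
    using conv[unfolded conv_in_distr_def, rule_format, OF conjI, OF cont bdd] int by simp
qed

lemma asymptotic_variance_unique:
  fixes S :: "nat \<Rightarrow> 'w \<Rightarrow> real ^ 'd"
  assumes A: "asymptotic_variance M S A" and B: "asymptotic_variance M S B"
  shows "A = B"
proof -
  have q: "t \<bullet> (A *v t) = t \<bullet> (B *v t)" for t
    using LIMSEQ_unique[OF asymptotic_variance_cos[OF A, of t] asymptotic_variance_cos[OF B, of t]]
    by simp
  have sym: "transpose A = A" "transpose B = B"
    using A B by (auto simp: asymptotic_variance_def psd_def)
  have sym': "u \<bullet> (C *v v) = v \<bullet> (C *v u)" if "transpose C = C"
    for u v :: "real ^ 'd" and C :: "real ^ 'd ^ 'd"
    using dot_lmul_matrix[of u C v] that transpose_matrix_vector[of C u] by (simp add: inner_commute)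
  have p: "u \<bullet> (A *v v) = u \<bullet> (B *v v)" for u v
    using q[of "u + v"] q[of u] q[of v] sym'[OF sym(1), of u v] sym'[OF sym(2), of u v]
    by (simp add: matrix_vector_right_distrib inner_add_left inner_add_right)
  have "A *v v = B *v v" for v
    using vector_eq_ldot[of "A *v v" "B *v v"] p[of _ v] by blast
  then show ?thesis
    by (simp add: matrix_eq)
qed

end

(*
  Idea.  A Gibbs kernel acts on L2(pi) as an orthogonal projection.  The drift condition makes the
  K-step kernel T of every phase k a contraction, in a W-weighted oscillation seminorm, after
  averaging finitely many of its powers (Hairer and Mattingly's form of Harris' theorem; the averaging
  replaces aperiodicity).  Hence u - T u = f is solvable for every mean-zero f bounded by a multiple
  of W, which is square integrable, and summing over one cycle gives V with V_k - Pi_k V_{k+1} = g.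
  Since norm(u - T u)^2 <= K (norm(u)^2 - norm(T u)^2) for a product T of K projections, the iterates
  P_k^t V tend to 0, and V_k is the sum of the series of the P_k^t g.

  The central limit theorem is obtained without a martingale: the conditional characteristic functions
  satisfy F_{n+1,k} = exp(i eps g) Pi_k F_{n,k+1}, and exp(-s2 eps^2 n / 2) exp(i eps V_k) (1 - eps^2 w_k / 2)
  solves this recursion up to o(eps^2) in L1(pi), where w corrects the conditional variances to their
  mean s2.  Uniform ergodic averages transfer the limit from L1(pi) to every starting point.  For the
  Rao-Blackwellized sums, V_k is replaced by V_k - g.
*)

theory Submission
  imports Defs "HOL-Real_Asymp.Real_Asymp"
begin

section \<open>Probability kernels\<close>

text \<open>The drift and smallness conditions alone do not exclude periodicity, so convergence of
  the powers of T cannot be read off from them. Averages of powers contract, which suffices for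
  solvability because u - Q u is itself of the form r - T r. Convergence of T^n f has to come from
  elsewhere: from the geometry of projections in L2(pi), applied to a right-hand side that is itself
  of the form v - T v. This is why each Poisson equation for g is solved twice, the first solution,
  again mean-zero and bounded by a multiple of W, serving as the new right-hand side.

  The limit theorem must hold from every starting point, although V_k and Pi_k g are controlled only
  pi-almost everywhere. Characteristic functions are bounded by 1, so they can be integrated even
  from points x where Pi_k(x, .) does not integrate g, and the errors of M steps simply add up in
  L1(pi), where each kernel is a contraction. The conditional variances are merely integrable, not
  bounded by W; hence the corrector w exists only approximately, after truncation.\<close>

lemma prob_kernelD:
  assumes "prob_kernel P"
  shows "prob_space (P x)" "sets (P x) = sets borel" "space (P x) = UNIV"
    "P \<in> borel \<rightarrow>\<^sub>M subprob_algebra borel"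
proof -
  have "P x \<in> space (prob_algebra borel)"
    using assms by (auto simp: prob_kernel_def dest: measurable_space)
  then show "prob_space (P x)" "sets (P x) = sets borel"
    by (auto simp: space_prob_algebra)
  then show "space (P x) = UNIV"
    using sets_eq_imp_space_eq by fastforce
  show "P \<in> borel \<rightarrow>\<^sub>M subprob_algebra borel"
    using assms by (simp add: prob_kernel_def measurable_prob_algebraD)
qed

lemma prob_kernel_subprob:
  "prob_kernel P \<Longrightarrow> sets M = sets borel \<Longrightarrow> P \<in> M \<rightarrow>\<^sub>M subprob_algebra borel"
  using prob_kernelD(4) measurable_cong_sets by blast

lemma borel_measurable_kernel:
  fixes u :: "'a::topological_space \<Rightarrow> 'b::topological_space"
  assumes "prob_kernel P" "u \<in> borel_measurable borel"
  shows "u \<in> borel_measurable (P x)"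
  using assms measurable_cong_sets[OF prob_kernelD(2)[OF assms(1)] refl] by blast

lemma measurable_kernel_integral [measurable (raw)]:
  fixes u :: "'a::topological_space \<Rightarrow> 'b::{banach,second_countable_topology}"
  assumes "prob_kernel P" "u \<in> borel_measurable borel"
  shows "(\<lambda>x. LINT y|P x. u y) \<in> borel_measurable borel"
  using measurable_compose[OF prob_kernelD(4)[OF assms(1)] integral_measurable_subprob_algebra[OF assms(2)]] .

lemma measurable_kernel_nn_integral [measurable (raw)]:
  assumes "prob_kernel P" "u \<in> borel_measurable borel"
  shows "(\<lambda>x. \<integral>\<^sup>+y. u y \<partial>P x) \<in> borel_measurable borel"
  using measurable_compose[OF prob_kernelD(4)[OF assms(1)] nn_integral_measurable_subprob_algebra[OF assms(2)]] .

lemma sets_space_borel: "sets M = sets borel \<Longrightarrow> space M = UNIV"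
  using sets_eq_imp_space_eq by fastforce

lemma sets_bind_kernel:
  "prob_kernel P \<Longrightarrow> sets M = sets borel \<Longrightarrow> sets (M \<bind> P) = sets borel"
  by (rule sets_bind) (auto simp: prob_kernelD(2) sets_space_borel)

lemma nn_integral_bind_kernel:
  assumes "prob_kernel P" "sets M = sets borel" "u \<in> borel_measurable borel"
  shows "(\<integral>\<^sup>+x. u x \<partial>(M \<bind> P)) = (\<integral>\<^sup>+x. \<integral>\<^sup>+y. u y \<partial>P x \<partial>M)"
  by (rule nn_integral_bind[OF assms(3) prob_kernel_subprob[OF assms(1,2)]])

text \<open>Fubini for the composition of a measure with a kernel. The iterated nonnegative integral
  is finite in total, so the inner one is finite almost everywhere, and only there is the inner
  Bochner integral meaningful; elsewhere it has the default value 0, which \<open>enn2real\<close>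
  reproduces.\<close>

lemma integrable_bind_kernel_nonneg:
  fixes u :: "'a::topological_space \<Rightarrow> real"
  assumes P: "prob_kernel P" and M: "sets M = sets borel" and u: "integrable (M \<bind> P) u"
    and pos: "\<And>x. 0 \<le> u x"
  shows "AE x in M. integrable (P x) u"
    and "integrable M (\<lambda>x. LINT y|P x. u y)"
    and "(LINT x|M. LINT y|P x. u y) = (LINT x|(M \<bind> P). u x)"
proof -
  have um: "u \<in> borel_measurable borel"
    using borel_measurable_integrable[OF u] measurable_cong_sets[OF sets_bind_kernel[OF P M] refl] by blast
  have uP: "u \<in> borel_measurable (P x)" for x
    by (rule borel_measurable_kernel[OF P um])
  define p where "p x = (\<integral>\<^sup>+y. ennreal (u y) \<partial>P x)" for x
  have pm: "p \<in> borel_measurable M"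
    unfolding p_def using measurable_kernel_nn_integral[OF P, of "\<lambda>y. ennreal (u y)"] um
      measurable_cong_sets[OF M refl] by (metis measurable_compose_rev measurable_ennreal)
  have tot: "(\<integral>\<^sup>+x. p x \<partial>M) = ennreal (LINT x|(M \<bind> P). u x)"
    unfolding p_def using nn_integral_eq_integral[OF u] pos um
    by (subst nn_integral_bind_kernel[OF P M, symmetric]) auto
  then have fin: "AE x in M. p x \<noteq> \<infinity>"
    using pm by (intro nn_integral_PInf_AE) auto
  then show "AE x in M. integrable (P x) u"
    by eventually_elim (use uP pos in \<open>auto simp: p_def less_top intro!: integrableI_nonneg\<close>)
  have eq: "(LINT y|P x. u y) = enn2real (p x)" for x
    unfolding p_def using uP pos by (intro integral_eq_nn_integral) auto
  have e: "(\<integral>\<^sup>+x. ennreal (enn2real (p x)) \<partial>M) = ennreal (LINT x|(M \<bind> P). u x)"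
    unfolding tot[symmetric]
    by (intro nn_integral_cong_AE) (use fin in eventually_elim, simp add: less_top)
  have hi: "has_bochner_integral M (\<lambda>x. enn2real (p x)) (LINT x|(M \<bind> P). u x)"
    using pm e pos by (intro has_bochner_integral_nn_integral) (auto intro!: integral_nonneg_AE)
  show "integrable M (\<lambda>x. LINT y|P x. u y)"
    "(LINT x|M. LINT y|P x. u y) = (LINT x|(M \<bind> P). u x)"
    unfolding eq using hi by (auto simp: has_bochner_integral_iff)
qed

text \<open>Splitting into positive and negative parts. Linearity of the inner integral holds only
  where both parts are integrable, hence the detour through almost-everywhere equality.\<close>

lemma integrable_bind_kernel:
  fixes u :: "'a::topological_space \<Rightarrow> real"
  assumes P: "prob_kernel P" and M: "sets M = sets borel" and u: "integrable (M \<bind> P) u"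
  shows "AE x in M. integrable (P x) u"
    and "integrable M (\<lambda>x. LINT y|P x. u y)"
    and "(LINT x|M. LINT y|P x. u y) = (LINT x|(M \<bind> P). u x)"
proof -
  let ?p = "\<lambda>x. max (u x) 0" and ?n = "\<lambda>x. max (- u x) 0"
  have ip: "integrable (M \<bind> P) ?p" and in': "integrable (M \<bind> P) ?n"
    using u by auto
  note p = integrable_bind_kernel_nonneg[OF P M ip, simplified]
  note n = integrable_bind_kernel_nonneg[OF P M in', simplified]
  have un: "u = (\<lambda>x. ?p x - ?n x)" by (auto simp: max_def)
  show ae: "AE x in M. integrable (P x) u"
    using p(1) n(1) by eventually_elim (subst un, auto)
  have um: "u \<in> borel_measurable borel"
    using borel_measurable_integrable[OF u] measurable_cong_sets[OF sets_bind_kernel[OF P M] refl] by blast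
  have m: "(\<lambda>x. LINT y|P x. u y) \<in> borel_measurable M"
    using measurable_kernel_integral[OF P um] measurable_cong_sets[OF M refl] by blast
  have e: "AE x in M. (LINT y|P x. u y) = (LINT y|P x. ?p y) - (LINT y|P x. ?n y)"
    using p(1) n(1) by eventually_elim (subst un, auto)
  show "integrable M (\<lambda>x. LINT y|P x. u y)"
    by (rule integrable_cong_AE_imp[OF Bochner_Integration.integrable_diff[OF p(2) n(2)] m])
       (use e in eventually_elim, simp)
  have "(LINT x|M. LINT y|P x. u y) = (LINT x|M. (LINT y|P x. ?p y) - (LINT y|P x. ?n y))"
    using e p(2) n(2) m by (intro integral_cong_AE) auto
  also have "\<dots> = (LINT x|(M \<bind> P). ?p x) - (LINT x|(M \<bind> P). ?n x)"
    using p n by simp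
  also have "\<dots> = (LINT x|(M \<bind> P). u x)"
    using ip in' by (subst (3) un) simp
  finally show "(LINT x|M. LINT y|P x. u y) = (LINT x|(M \<bind> P). u x)" .
qed

lemma prob_kernel_bind:
  "prob_kernel P \<Longrightarrow> prob_kernel Q \<Longrightarrow> prob_kernel (\<lambda>x. P x \<bind> Q)"
  by (simp add: prob_kernel_def measurable_bind_prob_space)

lemma prob_kernel_power: "prob_kernel P \<Longrightarrow> prob_kernel (kernel_power P n)"
  by (induction n) (simp_all add: prob_kernel_bind, simp add: prob_kernel_def)

lemma kernel_power_add:
  assumes P: "prob_kernel P"
  shows "kernel_power P (m + n) x = kernel_power P m x \<bind> kernel_power P n"
proof (induction m arbitrary: x)
  case 0
  show ?case
    using prob_kernelD(4)[OF prob_kernel_power[OF P]] by (simp add: bind_return[where N=borel])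
next
  case (Suc m)
  have "kernel_power P (m + n) = (\<lambda>x. kernel_power P m x \<bind> kernel_power P n)"
    using Suc by auto
  then show ?case
    using prob_kernel_subprob[OF prob_kernel_power[OF P] prob_kernelD(2)[OF P]]
      prob_kernelD(4)[OF prob_kernel_power[OF P]]
    by (simp add: bind_assoc[where N=borel and R=borel])
qed

section \<open>Harris' theorem in a weighted norm\<close>

text \<open>Strict positivity of \<open>lam\<close> and \<open>b\<close> is harmless, since
  enlarging either preserves the inequality, and it lets \<open>b\<close> and \<open>beta\<close>
  stand in denominators. Writing the drift with a nonnegative integral makes integrability of
  \<open>W\<close> a conclusion, because the right-hand side is finite.\<close>

locale drift_kernel =
  fixes T :: "'a::topological_space \<Rightarrow> 'a measure" and W :: "'a \<Rightarrow> real" and D :: "'a set" and lam b :: real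
  assumes ker: "prob_kernel T" and W_meas [measurable]: "W \<in> borel_measurable borel"
    and W_ge: "\<And>x. 1 \<le> W x" and lam: "0 < lam" "lam < 1" and b: "0 < b"
    and D_meas [measurable]: "D \<in> sets borel"
    and drift: "\<And>x. (\<integral>\<^sup>+y. ennreal (W y) \<partial>T x) \<le> ennreal (lam * W x + b * indicator D x)"
begin

text \<open>The space of functions of finite W-weighted supremum norm. On it every power of T acts
  by integrals that converge at every point, so the algebra below needs no null sets.\<close>

definition dominated :: "('a \<Rightarrow> real) set" where
  "dominated = {u \<in> borel_measurable borel. \<exists>c. \<forall>x. \<bar>u x\<bar> \<le> c * W x}"

definition E :: "nat \<Rightarrow> ('a \<Rightarrow> real) \<Rightarrow> 'a \<Rightarrow> real" where
  "E n u x = (LINT y|kernel_power T n x. u y)"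

text \<open>The fixed point of r -> lam * r + b, hence a bound, uniform in n, for what the additive
  term of the drift accumulates over n steps.\<close>

definition beta where "beta = b / (1 - lam)"

lemma beta_pos: "0 < beta" using lam b by (simp add: beta_def)

lemma W_pos: "0 < W x" using W_ge[of x] by linarith

lemma dominatedI: "u \<in> borel_measurable borel \<Longrightarrow> (\<And>x. \<bar>u x\<bar> \<le> c * W x) \<Longrightarrow> u \<in> dominated"
  by (auto simp: dominated_def)

lemma dominated_meas: "u \<in> dominated \<Longrightarrow> u \<in> borel_measurable borel" by (simp add: dominated_def)

lemma dominatedE:
  assumes "u \<in> dominated" obtains c where "0 \<le> c" "\<And>x. \<bar>u x\<bar> \<le> c * W x"
proof -
  obtain c where c: "\<And>x. \<bar>u x\<bar> \<le> c * W x" using assms by (auto simp: dominated_def)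
  have "0 \<le> c * W x" for x using c[of x] abs_ge_zero[of "u x"] by linarith
  then have "0 \<le> c" using W_pos by (simp add: zero_le_mult_iff) (meson less_le_not_le)
  with c that show thesis by blast
qed

lemma dominated_bounded:
  assumes "u \<in> borel_measurable borel" "\<And>x. \<bar>u x\<bar> \<le> c" shows "u \<in> dominated"
proof (rule dominatedI[OF assms(1)])
  fix x
  have "0 \<le> c" using assms(2)[of x] abs_ge_zero[of "u x"] by linarith
  then have "c * 1 \<le> c * W x" using W_ge[of x] by (intro mult_left_mono) auto
  then show "\<bar>u x\<bar> \<le> c * W x" using assms(2)[of x] by linarith
qed

lemma dominated_const: "(\<lambda>_. c) \<in> dominated" by (rule dominated_bounded[of _ "\<bar>c\<bar>"]) auto

lemma dominated_W: "W \<in> dominated" using W_pos by (intro dominatedI[of _ 1]) (auto simp: less_imp_le)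

lemma dominated_add:
  assumes u: "u \<in> dominated" and v: "v \<in> dominated" shows "(\<lambda>x. u x + v x) \<in> dominated"
proof -
  obtain c where c: "\<And>x. \<bar>u x\<bar> \<le> c * W x" using u by (metis dominatedE)
  obtain d where d: "\<And>x. \<bar>v x\<bar> \<le> d * W x" using v by (metis dominatedE)
  have "\<bar>u x + v x\<bar> \<le> (c + d) * W x" for x
    unfolding distrib_right using abs_triangle_ineq[of "u x" "v x"] c[of x] d[of x] by linarith
  then show ?thesis using dominated_meas[OF u] dominated_meas[OF v] by (intro dominatedI) auto
qed

lemma dominated_cmult: "u \<in> dominated \<Longrightarrow> (\<lambda>x. a * u x) \<in> dominated"
proof -
  assume u: "u \<in> dominated"
  obtain c where c: "\<And>x. \<bar>u x\<bar> \<le> c * W x" using u by (metis dominatedE)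
  then have "\<bar>a * u x\<bar> \<le> (\<bar>a\<bar> * c) * W x" for x
    using mult_left_mono[OF c, of "\<bar>a\<bar>"] by (simp add: abs_mult mult.assoc)
  then show ?thesis using dominated_meas[OF u] by (intro dominatedI) auto
qed

lemma dominated_diff: "u \<in> dominated \<Longrightarrow> v \<in> dominated \<Longrightarrow> (\<lambda>x. u x - v x) \<in> dominated"
  using dominated_add[of u "\<lambda>x. (-1) * v x"] dominated_cmult[of v "-1"] by simp

lemma dominated_divide: "u \<in> dominated \<Longrightarrow> (\<lambda>x. u x / a) \<in> dominated"
  using dominated_cmult[of u "1 / a"] by simp

lemma dominated_sum: "(\<And>i. i \<in> I \<Longrightarrow> u i \<in> dominated) \<Longrightarrow> (\<lambda>x. \<Sum>i\<in>I. u i x) \<in> dominated"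
  by (induction I rule: infinite_finite_induct) (auto intro: dominated_const dominated_add)

lemmas dominated_intros = dominated_const dominated_W dominated_add dominated_cmult dominated_diff dominated_divide dominated_sum

lemma power_kernel: "prob_kernel (kernel_power T n)"
  by (rule prob_kernel_power[OF ker])


lemma kernel_power_1: "kernel_power T (Suc 0) = T"
proof
  fix x
  \<comment> \<open>\<open>bind_return'\<close> wants \<open>return\<close> on the sigma-algebra of
    \<open>T x\<close> itself, which has the same sets as \<open>borel\<close>.\<close>
  have "T x \<bind> return borel = T x \<bind> return (T x)"
    by (intro bind_cong refl return_cong) (simp add: prob_kernelD(2)[OF ker])
  then show "kernel_power T (Suc 0) x = T x" by (simp add: bind_return')
qed

lemma kernel_power_Suc_right: "kernel_power T (Suc n) x = kernel_power T n x \<bind> T"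
  using kernel_power_add[OF ker, of n "Suc 0" x]
  by (simp only: kernel_power_1 add_Suc_right add_0_right)

text \<open>The induction peels off the last step, not the first one as the definition of
  \<open>kernel_power\<close> does, so that the drift bound is integrated against the law after n
  steps. It closes because lam * beta + b = beta.\<close>

lemma nn_integral_W_power:
  "(\<integral>\<^sup>+y. ennreal (W y) \<partial>kernel_power T n x) \<le> ennreal (lam ^ n * W x + beta)"
proof (induction n)
  case 0
  have "ennreal (W x) \<le> ennreal (W x + beta)" using beta_pos by (intro ennreal_leI) auto
  then show ?case by (subst kernel_power.simps, subst nn_integral_return) auto
next
  case (Suc n)
  let ?M = "kernel_power T n x"
  interpret M: prob_space ?M by (rule prob_kernelD(1)[OF power_kernel])
  have WM: "W \<in> borel_measurable ?M" by (rule borel_measurable_kernel[OF power_kernel W_meas])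
  have "(\<integral>\<^sup>+y. ennreal (W y) \<partial>kernel_power T (Suc n) x)
      = (\<integral>\<^sup>+z. \<integral>\<^sup>+y. ennreal (W y) \<partial>T z \<partial>?M)"
    unfolding kernel_power_Suc_right
    by (simp add: nn_integral_bind_kernel[OF ker prob_kernelD(2)[OF power_kernel]])
  also have "\<dots> \<le> (\<integral>\<^sup>+z. ennreal lam * ennreal (W z) + ennreal b \<partial>?M)"
  proof (rule nn_integral_mono)
    fix z
    have "lam * W z + b * indicator D z \<le> lam * W z + b"
      using b by (auto simp: indicator_def)
    then have "ennreal (lam * W z + b * indicator D z) \<le> ennreal (lam * W z + b)"
      by (rule ennreal_leI)
    also have "\<dots> = ennreal lam * ennreal (W z) + ennreal b"
      using lam b W_pos[of z] by (subst ennreal_plus) (auto simp: ennreal_mult')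
    finally show "(\<integral>\<^sup>+y. ennreal (W y) \<partial>T z) \<le> ennreal lam * ennreal (W z) + ennreal b"
      using drift[of z] by (rule order_trans[rotated])
  qed
  also have "\<dots> = ennreal lam * (\<integral>\<^sup>+z. ennreal (W z) \<partial>?M) + ennreal b"
    using WM by (subst nn_integral_add) (auto simp: nn_integral_cmult M.emeasure_space_1)
  also have "\<dots> \<le> ennreal lam * ennreal (lam ^ n * W x + beta) + ennreal b"
    by (intro add_right_mono mult_left_mono Suc) auto
  also have "\<dots> = ennreal (lam * (lam ^ n * W x + beta) + b)"
    using lam beta_pos b W_pos[of x] by (subst ennreal_plus) (auto simp: ennreal_mult' less_imp_le)
  also have "lam * (lam ^ n * W x + beta) + b = lam ^ Suc n * W x + beta"
    using lam by (simp add: beta_def field_simps)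
  finally show ?case .
qed

lemma dominated_integrable: assumes "u \<in> dominated" shows "integrable (kernel_power T n x) u"
proof -
  obtain c where c: "0 \<le> c" "\<And>x. \<bar>u x\<bar> \<le> c * W x" using assms by (metis dominatedE)
  have "(\<integral>\<^sup>+y. ennreal (W y) \<partial>kernel_power T n x) < \<infinity>"
    using nn_integral_W_power[of n x] by (rule le_less_trans) auto
  then have "integrable (kernel_power T n x) W"
    using borel_measurable_kernel[OF power_kernel W_meas] W_pos
    by (intro integrableI_nonneg) (auto simp: less_imp_le)
  then have "integrable (kernel_power T n x) (\<lambda>y. c * W y)" by simp
  then show ?thesis
    by (rule Bochner_Integration.integrable_bound)
      (use borel_measurable_kernel[OF power_kernel dominated_meas[OF assms]] c in
        \<open>auto simp: abs_mult abs_of_pos[OF W_pos]\<close>)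
qed

lemma E_lin: "u \<in> dominated \<Longrightarrow> v \<in> dominated \<Longrightarrow> E n (\<lambda>x. u x + v x) x = E n u x + E n v x"
  "u \<in> dominated \<Longrightarrow> v \<in> dominated \<Longrightarrow> E n (\<lambda>x. u x - v x) x = E n u x - E n v x"
  "E n (\<lambda>x. a * u x) x = a * E n u x" "E n (\<lambda>x. u x / a) x = E n u x / a"
  "E n (\<lambda>_. a) x = a"
  using prob_space.prob_space[OF prob_kernelD(1)[OF power_kernel]]
  by (simp_all add: E_def dominated_integrable)

lemma E_sum: "(\<And>i. i \<in> I \<Longrightarrow> w i \<in> dominated) \<Longrightarrow> E n (\<lambda>x. \<Sum>i\<in>I. w i x) x = (\<Sum>i\<in>I. E n (w i) x)"
  by (simp add: E_def dominated_integrable)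

lemma E_mono: "u \<in> dominated \<Longrightarrow> v \<in> dominated \<Longrightarrow> (\<And>y. u y \<le> v y) \<Longrightarrow> E n u x \<le> E n v x"
  unfolding E_def by (intro integral_mono dominated_integrable) auto

lemma E_abs_le:
  assumes "u \<in> dominated" "v \<in> dominated" "\<And>y. \<bar>u y\<bar> \<le> v y" shows "\<bar>E n u x\<bar> \<le> E n v x"
proof -
  have "E n u x \<le> E n v x"
    by (intro E_mono assms abs_le_D1)
  moreover have "E n (\<lambda>x. (-1) * u x) x \<le> E n v x"
    using abs_le_D2[OF assms(3)] by (intro E_mono assms dominated_intros) simp
  then have "- E n u x \<le> E n v x"
    by (simp only: E_lin)
  ultimately show ?thesis by (rule abs_leI)
qed

lemma E_W_le: "E n W x \<le> lam ^ n * W x + beta"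
proof -
  have "ennreal (E n W x) = (\<integral>\<^sup>+y. ennreal (W y) \<partial>kernel_power T n x)"
    unfolding E_def using W_pos
    by (intro nn_integral_eq_integral[symmetric] dominated_integrable dominated_W) (auto simp: less_imp_le)
  then have "ennreal (E n W x) \<le> ennreal (lam ^ n * W x + beta)"
    using nn_integral_W_power by simp
  then show ?thesis
    using lam W_pos[of x] beta_pos by (subst (asm) ennreal_le_iff) auto
qed

lemma E_W_ge: "1 \<le> E n W x"
  using E_mono[OF dominated_const[of 1] dominated_W, of n x] W_ge by (simp add: E_lin)

lemma E_bound:
  assumes "u \<in> dominated" "0 \<le> c" "\<And>x. \<bar>u x\<bar> \<le> c * W x"
  shows "\<bar>E n u x\<bar> \<le> c * (1 + beta) * W x"
proof -
  have "\<bar>E n u x\<bar> \<le> E n (\<lambda>x. c * W x) x"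
    by (intro E_abs_le assms dominated_intros)
  also have "\<dots> \<le> c * (lam ^ n * W x + beta)"
    using E_W_le assms(2) by (simp add: E_lin mult_left_mono)
  also have "\<dots> \<le> c * (1 * W x + beta * W x)"
    using assms(2) lam beta_pos W_ge[of x] by (intro mult_left_mono add_mono mult_right_mono)
      (auto simp: power_le_one)
  finally show ?thesis by (simp add: algebra_simps)
qed

lemma E_dom: assumes "u \<in> dominated" shows "E n u \<in> dominated"
proof -
  obtain c where c: "0 \<le> c" "\<And>x. \<bar>u x\<bar> \<le> c * W x" using assms by (metis dominatedE)
  have "E n u \<in> borel_measurable borel"
    unfolding E_def using measurable_kernel_integral[OF power_kernel dominated_meas[OF assms]] by simp
  then show ?thesis using E_bound[OF assms c] by (rule dominatedI)
qed

lemma E_0: "u \<in> dominated \<Longrightarrow> E 0 u x = u x"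
  unfolding E_def by (simp add: integral_return dominated_meas)

lemma E_add: assumes "u \<in> dominated" shows "E (m + n) u x = E m (E n u) x"
  unfolding E_def
  using integrable_bind_kernel(3)[OF power_kernel prob_kernelD(2)[OF power_kernel], of m x n u]
    dominated_integrable[OF assms, of "m + n" x]
  by (simp add: kernel_power_add[OF ker])

section \<open>Visits to the small set and averages of powers\<close>

lemma ind_dom: "indicat_real D \<in> dominated"
  by (rule dominated_bounded[of _ 1]) (auto simp: indicator_def)

lemma E1_W_le: "E 1 W x \<le> lam * W x + b * indicator D x"
proof -
  have k: "kernel_power T 1 = T" using kernel_power_1 by (simp only: One_nat_def)
  have "ennreal (E 1 W x) = (\<integral>\<^sup>+y. ennreal (W y) \<partial>T x)"
    unfolding E_def k using W_pos dominated_integrable[OF dominated_W, of 1 x, unfolded k]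
    by (intro nn_integral_eq_integral[symmetric]) (auto simp: less_imp_le)
  then have "ennreal (E 1 W x) \<le> ennreal (lam * W x + b * indicator D x)"
    using drift by simp
  then show ?thesis
    using lam W_pos[of x] b by (subst (asm) ennreal_le_iff) auto
qed

text \<open>The indicator of D is kept instead of being bounded by 1: the sum is the expected number
  of visits to D before time n, which must be bounded below before the smallness of D can be
  used.\<close>

lemma E_W_visits: "E n W x \<le> lam ^ n * W x + b * (\<Sum>j<n. E j (indicator D) x)"
proof (induction n)
  case 0
  then show ?case by (simp add: E_0 dominated_W)
next
  case (Suc n)
  have nn: "0 \<le> E j (indicator D) x" for j
    using E_mono[OF dominated_const[of 0] ind_dom, of j x] by (simp add: E_lin)
  have "E (Suc n) W x = E n (E 1 W) x" using E_add[OF dominated_W, of n 1 x] by simp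
  also have "\<dots> \<le> E n (\<lambda>y. lam * W y + b * indicator D y) x"
    by (intro E_mono E_dom dominated_intros ind_dom E1_W_le)
  also have "\<dots> = lam * E n W x + b * E n (indicator D) x"
    by (simp add: E_lin dominated_intros ind_dom)
  also have "\<dots> \<le> lam * (lam ^ n * W x + b * (\<Sum>j<n. E j (indicator D) x)) + b * E n (indicator D) x"
    using lam b by (intro add_mono mult_left_mono Suc) auto
  \<comment> \<open>Earlier visits carry a further factor \<open>lam\<close>; this damping is given
    away by \<open>lam < 1\<close>.\<close>
  also have "\<dots> \<le> lam ^ Suc n * W x + (1 * (b * (\<Sum>j<n. E j (indicator D) x)) + b * E n (indicator D) x)"
  proof -
    have "0 \<le> b * (\<Sum>j<n. E j (indicator D) x)"
      using b nn by (intro mult_nonneg_nonneg sum_nonneg) auto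
    from mult_right_mono[OF less_imp_le[OF lam(2)] this] show ?thesis
      by (simp only: distrib_left power_Suc mult.assoc)
  qed
  finally show ?case by (simp add: distrib_left)
qed

text \<open>Average of the N consecutive powers T^m, ..., T^(m + N - 1). The shift m is the number
  of steps in the minorization on D; averaging over N times makes it enough that D is visited at
  some unspecified time, whatever the period of T.\<close>

definition Q :: "nat \<Rightarrow> nat \<Rightarrow> ('a \<Rightarrow> real) \<Rightarrow> 'a \<Rightarrow> real" where
  "Q m N u x = (\<Sum>j<N. E (m + j) u x) / real N"

lemma Q_dom: "u \<in> dominated \<Longrightarrow> Q m N u \<in> dominated"
  unfolding Q_def by (intro dominated_intros E_dom)

lemma Q_lin: "u \<in> dominated \<Longrightarrow> v \<in> dominated \<Longrightarrow> Q m N (\<lambda>x. u x + v x) x = Q m N u x + Q m N v x"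
  "u \<in> dominated \<Longrightarrow> v \<in> dominated \<Longrightarrow> Q m N (\<lambda>x. u x - v x) x = Q m N u x - Q m N v x"
  "Q m N (\<lambda>x. a * u x) x = a * Q m N u x"
  "0 < N \<Longrightarrow> Q m N (\<lambda>_. a) x = a"
  by (simp_all add: Q_def E_lin sum.distrib sum_subtractf add_divide_distrib diff_divide_distrib
        sum_distrib_left[symmetric])

lemma Q_mono: "u \<in> dominated \<Longrightarrow> v \<in> dominated \<Longrightarrow> (\<And>y. u y \<le> v y) \<Longrightarrow> Q m N u x \<le> Q m N v x"
  unfolding Q_def by (intro divide_right_mono sum_mono E_mono) auto

lemma Q_abs_le:
  assumes "u \<in> dominated" "v \<in> dominated" "\<And>y. \<bar>u y\<bar> \<le> v y" shows "\<bar>Q m N u x\<bar> \<le> Q m N v x"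
proof -
  have "Q m N u x \<le> Q m N v x"
    by (intro Q_mono assms abs_le_D1)
  moreover have "Q m N (\<lambda>x. (-1) * u x) x \<le> Q m N v x"
    using abs_le_D2[OF assms(3)] by (intro Q_mono assms dominated_intros) simp
  then have "- Q m N u x \<le> Q m N v x"
    by (simp only: Q_lin)
  ultimately show ?thesis by (rule abs_leI)
qed

text \<open>The condition 0 < m keeps every exponent positive, so that each power of
  \<open>lam\<close> is at most \<open>lam\<close> itself.\<close>

lemma Q_W_le: assumes "0 < m" "0 < N" shows "Q m N W x \<le> lam * W x + beta"
proof -
  have "(\<Sum>j<N. E (m + j) W x) \<le> (\<Sum>j<N. lam * W x + beta)"
  proof (rule sum_mono)
    fix j
    have "lam ^ (m + j) \<le> lam ^ 1" using lam assms by (intro power_decreasing) auto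
    then have "lam ^ (m + j) * W x \<le> lam * W x" using W_pos[of x] by (intro mult_right_mono) auto
    then show "E (m + j) W x \<le> lam * W x + beta" using E_W_le[of "m + j" x] by linarith
  qed
  then show ?thesis using assms by (simp add: Q_def field_simps)
qed



text \<open>With D empty the drift would force T^n W to 0, against W >= 1. A point of D is wanted
  below, where the kernel at that point dominates the minorizing measure.\<close>

lemma D_nonempty: "D \<noteq> {}"
proof
  assume D: "D = {}"
  have z: "E j (indicat_real D) x = 0" for j x
  proof -
    have "indicat_real D = (\<lambda>_. 0)" unfolding D by auto
    then show ?thesis by (rule ssubst) (rule E_lin(5))
  qed
  have le: "E n W x \<le> lam ^ n * W x" for n x
    using E_W_visits[of n x] unfolding z by simp
  obtain n where n: "lam ^ n < 1 / W undefined"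
    using real_arch_pow_inv[of "1 / W undefined" lam] lam W_pos[of undefined] by auto
  then have "lam ^ n * W undefined < 1"
    using W_pos[of undefined] by (simp add: pos_less_divide_eq)
  then show False
    using le[of n undefined] E_W_ge[of n undefined] by linarith
qed
text \<open>
  Iterating the drift inequality, \<open>1 \<le> T\<^sup>N W x \<le> lam\<^sup>N W x + b (\<Sum>j<N. T\<^sup>j(x, D))\<close>, so on \<open>W \<le> R\<close> the
  expected number of visits to \<open>D\<close> before time \<open>N\<close> is at least \<open>1 / (2 b)\<close>.
\<close>

lemma small_minorization:
  assumes "small_set T D"
  obtains m N :: nat and F :: "('a \<Rightarrow> real) \<Rightarrow> real" and \<alpha> :: real
  where "0 < m" "0 < N" "0 < \<alpha>"
    "\<And>u v. u \<in> dominated \<Longrightarrow> v \<in> dominated \<Longrightarrow> F (\<lambda>x. u x - v x) = F u - F v"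
    "\<And>u v. u \<in> dominated \<Longrightarrow> v \<in> dominated \<Longrightarrow> F (\<lambda>x. u x + v x) = F u + F v"
    "\<And>u c. F (\<lambda>x. c * u x) = c * F u"
    "\<And>u. u \<in> dominated \<Longrightarrow> (\<And>x. 1 \<le> u x) \<Longrightarrow> \<alpha> \<le> F u"
    "\<And>u x. u \<in> dominated \<Longrightarrow> (\<And>x. 0 \<le> u x) \<Longrightarrow> W x \<le> R \<Longrightarrow> F u \<le> Q m N u x"
proof -
  obtain m \<nu> where m: "0 < m" and \<nu>: "sets \<nu> = sets borel" "emeasure \<nu> (space \<nu>) \<noteq> 0"
    and min: "\<And>x B. x \<in> D \<Longrightarrow> B \<in> sets borel \<Longrightarrow> emeasure \<nu> B \<le> emeasure (kernel_power T m x) B"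
    using assms unfolding small_set_def by blast
  obtain y0 where y0: "y0 \<in> D" using D_nonempty by blast
  have le: "\<nu> \<le> kernel_power T m y" if "y \<in> D" for y
    using min[OF that] \<nu>(1) prob_kernelD(2)[OF power_kernel]
    by (auto simp: le_measure_iff le_fun_def sets_space_borel prob_kernelD(3)[OF power_kernel])
      (metis emeasure_notin_sets zero_le min[OF that])
  have nn: "(\<integral>\<^sup>+x. f x \<partial>\<nu>) \<le> (\<integral>\<^sup>+x. f x \<partial>kernel_power T m y)" if "y \<in> D" for f y
    using \<nu>(1) prob_kernelD(2)[OF power_kernel] by (intro nn_integral_mono_measure le that) auto
  interpret k0: prob_space "kernel_power T m y0" by (rule prob_kernelD(1)[OF power_kernel])
  \<comment> \<open>A minorizing measure lies below a probability measure at any point of D, hence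
    is finite.\<close>
  have "emeasure \<nu> (space \<nu>) \<le> 1"
    using min[OF y0, of UNIV] k0.emeasure_space_1 sets_space_borel[OF \<nu>(1)]
      prob_kernelD(3)[OF power_kernel] by simp
  then interpret \<nu>: finite_measure \<nu>
    by (intro finite_measureI) (auto simp: top_unique)
  have m\<nu>: "u \<in> borel_measurable \<nu>" if "u \<in> dominated" for u
    using dominated_meas[OF that] measurable_cong_sets[OF \<nu>(1) refl] by blast
  have int\<nu>: "integrable \<nu> u" if "u \<in> dominated" for u
  proof -
    have "(\<integral>\<^sup>+x. ennreal (norm (u x)) \<partial>\<nu>) \<le> (\<integral>\<^sup>+x. ennreal (norm (u x)) \<partial>kernel_power T m y0)"
      by (rule nn[OF y0])
    also have "\<dots> < \<infinity>" using dominated_integrable[OF that] by (simp add: integrable_iff_bounded)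
    finally show ?thesis using m\<nu>[OF that] by (simp add: integrable_iff_bounded)
  qed
  have \<nu>_le: "(LINT x|\<nu>. u x) \<le> E m u y" if u: "u \<in> dominated" "\<And>x. 0 \<le> u x" and y: "y \<in> D" for u y
  proof -
    have "ennreal (LINT x|\<nu>. u x) = (\<integral>\<^sup>+x. u x \<partial>\<nu>)"
      using u int\<nu> by (intro nn_integral_eq_integral[symmetric]) auto
    also have "\<dots> \<le> (\<integral>\<^sup>+x. u x \<partial>kernel_power T m y)" by (rule nn[OF y])
    also have "\<dots> = ennreal (E m u y)"
      unfolding E_def using u dominated_integrable by (intro nn_integral_eq_integral) auto
    finally show ?thesis
      unfolding E_def by (subst (asm) ennreal_le_iff) (auto intro!: integral_nonneg_AE simp: u)
  qed
  \<comment> \<open>Makes lam^N W at most 1/2 where W <= R, so that at least half of T^N W >= 1 must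
    come from visits to D. The maximum with 1 keeps the denominator positive for every R and forces
    N > 0.\<close>
  obtain N where N: "lam ^ N < 1 / (2 * max R 1)"
    using real_arch_pow_inv[of "1 / (2 * max R 1)" lam] lam by auto
  have N0: "0 < N"
  proof (rule ccontr)
    assume "\<not> 0 < N"
    then have "2 * max R 1 < 1" using N by (simp add: field_simps)
    then show False by simp
  qed
  \<comment> \<open>The factor 1 / (2 * b) is the lower bound for the expected number of visits to
    D, and 1 / N comes from the averaging in \<open>Q\<close>.\<close>
  define \<kappa> where "\<kappa> = 1 / (2 * b * real N)"
  have \<kappa>: "0 < \<kappa>" using b N0 by (simp add: \<kappa>_def)
  define F where "F u = \<kappa> * (LINT x|\<nu>. u x)" for u
  define \<alpha> where "\<alpha> = \<kappa> * measure \<nu> (space \<nu>)"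
  have meas_pos: "0 < measure \<nu> (space \<nu>)"
    using \<nu>(2) by (simp add: \<nu>.emeasure_eq_measure zero_less_measure_iff)
  show thesis
  proof (rule that[of m N \<alpha> F])
    show "0 < m" "0 < N" "0 < \<alpha>" using m N0 \<kappa> meas_pos by (auto simp: \<alpha>_def)
    show "F (\<lambda>x. u x - v x) = F u - F v" "F (\<lambda>x. u x + v x) = F u + F v"
      if "u \<in> dominated" "v \<in> dominated" for u v
      using int\<nu> that by (simp_all add: F_def algebra_simps)
    show "F (\<lambda>x. c * u x) = c * F u" for u c by (simp add: F_def)
    show "\<alpha> \<le> F u" if u: "u \<in> dominated" "\<And>x. 1 \<le> u x" for u
    proof -
      have "(LINT x|\<nu>. 1) \<le> (LINT x|\<nu>. u x)" by (intro integral_mono int\<nu> u dominated_const)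
      then show ?thesis using \<kappa> by (simp add: F_def \<alpha>_def)
    qed
    show "F u \<le> Q m N u x" if u: "u \<in> dominated" "\<And>x. 0 \<le> u x" and R: "W x \<le> R" for u x
    proof -
      define I where "I = (LINT x|\<nu>. u x)"
      have I0: "0 \<le> I" unfolding I_def using u by (intro integral_nonneg_AE) auto
      have "lam ^ N * W x \<le> 1 / (2 * max R 1) * max R 1"
        using N R W_pos[of x] lam by (intro mult_mono) auto
      then have "lam ^ N * W x \<le> 1 / 2" by simp
      then have v: "1 / 2 \<le> b * (\<Sum>j<N. E j (indicator D) x)"
        using E_W_visits[of N x] E_W_ge[of N x] by linarith
      \<comment> \<open>A visit to D at time j is followed by the m-step minorization, which bounds
        T^m u from below by I on D.\<close>
      have "I * E j (indicator D) x \<le> E (m + j) u x" for j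
      proof -
        have "I * E j (indicator D) x = E j (\<lambda>y. I * indicator D y) x" by (simp add: E_lin)
        also have "\<dots> \<le> E j (E m u) x"
        proof (intro E_mono dominated_intros ind_dom E_dom u)
          fix y
          have "0 \<le> E m u y" using E_mono[OF dominated_const[of 0] u(1), of m y] u(2) by (simp add: E_lin)
          then show "I * indicator D y \<le> E m u y"
            using \<nu>_le[OF u, of y] by (auto simp: indicator_def I_def)
        qed
        finally show ?thesis using E_add[OF u(1), of j m x] by (simp add: add.commute)
      qed
      then have "I * (\<Sum>j<N. E j (indicator D) x) \<le> (\<Sum>j<N. E (m + j) u x)"
        by (simp add: sum_distrib_left sum_mono)
      moreover have "I * (1 / (2 * b)) \<le> I * (\<Sum>j<N. E j (indicator D) x)"
        using v b I0 by (intro mult_left_mono) (auto simp: field_simps)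
      ultimately have "I * (1 / (2 * b)) \<le> (\<Sum>j<N. E (m + j) u x)" by linarith
      then have "I * (1 / (2 * b)) / real N \<le> Q m N u x"
        unfolding Q_def by (intro divide_right_mono) auto
      then show ?thesis by (simp add: F_def I_def \<kappa>_def mult_ac)
    qed
  qed
qed

text \<open>The contraction is in the seminorm of oscillations relative to \<open>Wd \<eta>\<close>.\<close>

definition Wd :: "real \<Rightarrow> 'a \<Rightarrow> 'a \<Rightarrow> real" where
  "Wd \<eta> x y = 2 + \<eta> * (W x + W y)"

text \<open>Drift contracts for pairs far out, minorization for pairs with W x + W y <= R. The
  weight combines a constant, on which minorization acts, with a multiple \<eta> of W, on which
  drift acts; \<eta> must be so small that the additive constant of the drift does not use up the
  mass gained from the minorization.\<close>

lemma Q_contraction: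
  assumes "small_set T D"
  obtains m N :: nat and \<eta> \<rho> :: real
  where "0 < m" "0 < N" "0 < \<eta>" "0 \<le> \<rho>" "\<rho> < 1"
    "\<And>u c x y. u \<in> dominated \<Longrightarrow> 0 \<le> c \<Longrightarrow> (\<And>x y. \<bar>u x - u y\<bar> \<le> c * Wd \<eta> x y) \<Longrightarrow>
       \<bar>Q m N u x - Q m N u y\<bar> \<le> \<rho> * c * Wd \<eta> x y"
proof (rule small_minorization[OF assms, of "4 * beta / (1 - lam)"])
  \<comment> \<open>With \<delta> = (1 - lam) / 2 this gives 2 * beta = \<delta> * R: beyond R the
    additive constant of the drift costs at most half of the gain 1 - lam.\<close>
  define R where "R = 4 * beta / (1 - lam)"
  have R: "0 < R" using beta_pos lam by (simp add: R_def)
  fix m N :: nat and F :: "('a \<Rightarrow> real) \<Rightarrow> real" and \<alpha> :: real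
  assume mN: "0 < m" "0 < N" and \<alpha>: "0 < \<alpha>"
    and F_diff: "\<And>u v. u \<in> dominated \<Longrightarrow> v \<in> dominated \<Longrightarrow> F (\<lambda>x. u x - v x) = F u - F v"
    and F_add: "\<And>u v. u \<in> dominated \<Longrightarrow> v \<in> dominated \<Longrightarrow> F (\<lambda>x. u x + v x) = F u + F v"
    and F_cmult: "\<And>u c. F (\<lambda>x. c * u x) = c * F u"
    and F_ge: "\<And>u. u \<in> dominated \<Longrightarrow> (\<And>x. 1 \<le> u x) \<Longrightarrow> \<alpha> \<le> F u"
    and F_le: "\<And>u x. u \<in> dominated \<Longrightarrow> (\<And>x. 0 \<le> u x) \<Longrightarrow> W x \<le> 4 * beta / (1 - lam) \<Longrightarrow> F u \<le> Q m N u x"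
  note F_le = F_le[folded R_def]
  \<comment> \<open>Gives \<eta> * (2 * beta) = \<alpha>, half of the mass 2 * \<alpha> that the
    minorization removes for a near pair.\<close>
  define \<eta> where "\<eta> = \<alpha> / (2 * beta)"
  have \<eta>: "0 < \<eta>" using \<alpha> beta_pos by (simp add: \<eta>_def)
  define \<delta> where "\<delta> = (1 - lam) / 2"
  have \<delta>: "0 < \<delta>" "\<delta> < 1" using lam by (auto simp: \<delta>_def)
  \<comment> \<open>Chosen so that the inequality \<kappa> * (2 + \<eta> * s) <= \<delta> * \<eta> *
    s is an equality at s = R; it persists for larger s because \<kappa> <= \<delta>.\<close>
  define \<kappa> where "\<kappa> = \<eta> * R * \<delta> / (2 + \<eta> * R)"
  have \<eta>R: "0 < \<eta> * R" using \<eta> R by simp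
  have \<kappa>: "0 < \<kappa>" "\<kappa> * (2 + \<eta> * R) = \<eta> * R * \<delta>"
    using \<eta>R \<delta> by (auto simp: \<kappa>_def)
  have "\<kappa> * (\<eta> * R) \<le> \<kappa> * (2 + \<eta> * R)" using \<kappa> by (intro mult_left_mono) auto
  then have "\<kappa> * (\<eta> * R) \<le> \<delta> * (\<eta> * R)" using \<kappa>(2) by (simp add: mult_ac)
  then have \<kappa>\<delta>: "\<kappa> \<le> \<delta>" using \<eta>R by (rule mult_right_le_imp_le)
  define \<rho> where "\<rho> = max (1 - \<kappa>) (max (1 - \<alpha> / 2) lam)"
  have \<rho>: "0 \<le> \<rho>" "\<rho> < 1" "1 - \<kappa> \<le> \<rho>" "1 - \<alpha> / 2 \<le> \<rho>" "lam \<le> \<rho>"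
    using \<kappa> \<alpha> lam by (auto simp: \<rho>_def)
  define G where "G x = 1 + \<eta> * W x" for x
  have G: "G \<in> dominated" unfolding G_def by (intro dominated_intros)
  have QG: "Q m N G x \<le> 1 + \<eta> * (lam * W x + beta)" for x
    using Q_W_le[OF mN, of x] \<eta> mN unfolding G_def
    by (simp add: Q_lin dominated_intros)
  have key: "\<bar>Q m N u x - Q m N u y\<bar> \<le> \<rho> * c * Wd \<eta> x y"
    if u: "u \<in> dominated" and c: "0 \<le> c" and lip: "\<And>x y. \<bar>u x - u y\<bar> \<le> c * Wd \<eta> x y" for u c x y
  proof -
    \<comment> \<open>An oscillation bound relative to \<open>Wd \<eta>\<close> is a weighted
      supremum bound after subtraction of a suitable constant: all the values u x - c * G x lie
      below all the values u y + c * G y, and \<open>a\<close> separates them.\<close>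
    define a where "a = (SUP x. u x - c * G x)"
    have le: "u x - c * G x \<le> u y + c * G y" for x y
      using lip[of x y] by (simp add: Wd_def G_def algebra_simps abs_le_iff)
    have "bdd_above (range (\<lambda>x. u x - c * G x))"
      using le[of _ undefined] by (intro bdd_aboveI[of _ "u undefined + c * G undefined"]) auto
    then have a1: "u x - c * G x \<le> a" for x unfolding a_def by (intro cSUP_upper) auto
    have a2: "a \<le> u y + c * G y" for y unfolding a_def by (intro cSUP_least le) auto
    define u' where "u' x = u x - a" for x
    have u': "u' \<in> dominated" unfolding u'_def by (intro dominated_intros u)
    have u'_le: "\<bar>u' x\<bar> \<le> c * G x" for x
      using a1[of x] a2[of x] by (auto simp: u'_def abs_le_iff)
    have Qu': "Q m N u' x = Q m N u x - a" for x
      unfolding u'_def using mN by (simp add: Q_lin u dominated_const)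
    let ?s = "W x + W y"
    have s: "0 < ?s" using W_pos by (simp add: add_pos_pos)
    have cG: "(\<lambda>x. c * G x) \<in> dominated" by (intro dominated_intros G)
    consider "R \<le> ?s" | "?s \<le> R" by linarith
    then show ?thesis
    proof cases
      case 1
      have "\<bar>Q m N u' z\<bar> \<le> c * (1 + \<eta> * (lam * W z + beta))" for z
        using Q_abs_le[OF u' cG u'_le, of m N z] mult_left_mono[OF QG[of z] c] by (simp add: Q_lin)
      from this[of x] this[of y] have "\<bar>Q m N u x - Q m N u y\<bar>
          \<le> c * (1 + \<eta> * (lam * W x + beta)) + c * (1 + \<eta> * (lam * W y + beta))"
        unfolding Qu' by linarith
      also have "\<dots> = c * (2 + \<eta> * lam * ?s + \<eta> * (2 * beta))" by (simp add: algebra_simps)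
      also have "\<dots> \<le> c * (\<rho> * (2 + \<eta> * ?s))"
      proof (intro mult_left_mono c)
        have "2 * beta = \<delta> * R" using lam by (simp add: R_def \<delta>_def)
        have "\<delta> * (\<eta> * R) \<le> \<delta> * (\<eta> * ?s)" using 1 \<delta> \<eta> by (intro mult_left_mono) auto
        have "lam = 1 - 2 * \<delta>" by (simp add: \<delta>_def field_simps)
        have "(\<delta> - \<kappa>) * (\<eta> * R) \<le> (\<delta> - \<kappa>) * (\<eta> * ?s)" using 1 \<kappa>\<delta> \<eta> by (intro mult_left_mono) auto
        then have k2: "2 * \<kappa> \<le> (\<delta> - \<kappa>) * (\<eta> * ?s)" using \<kappa>(2) by (simp add: algebra_simps)
        have "2 + \<eta> * lam * ?s + \<eta> * (2 * beta) \<le> 2 + \<eta> * lam * ?s + \<delta> * (\<eta> * ?s)"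
          using \<open>\<delta> * (\<eta> * R) \<le> \<delta> * (\<eta> * ?s)\<close> \<open>2 * beta = \<delta> * R\<close> by (simp add: mult_ac)
        also have "\<dots> = 2 + \<eta> * ?s - \<delta> * (\<eta> * ?s)"
          unfolding \<open>lam = 1 - 2 * \<delta>\<close> by (simp add: algebra_simps)
        also have "\<dots> \<le> (1 - \<kappa>) * (2 + \<eta> * ?s)" using k2 by (simp add: algebra_simps)
        also have "\<dots> \<le> \<rho> * (2 + \<eta> * ?s)" using \<rho> \<eta> s by (intro mult_right_mono) auto
        finally show "2 + \<eta> * lam * ?s + \<eta> * (2 * beta) \<le> \<rho> * (2 + \<eta> * ?s)" .
      qed
      finally show ?thesis by (simp add: Wd_def mult_ac)
    next
      case 2
      \<comment> \<open>Minorization applied to the nonnegative functions c * G - u' and c * G + u'.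
        The reference value F u' is the same at x and y, so it cancels in the difference, while c *
        \<alpha> is gained at each of the two points.\<close>
      have near: "\<bar>Q m N u' z - F u'\<bar> \<le> c * (1 + \<eta> * (lam * W z + beta)) - c * \<alpha>" if "W z \<le> R" for z
      proof -
        have p: "0 \<le> c * G x - u' x" and n: "0 \<le> c * G x + u' x" for x
          using u'_le[of x] by (auto simp: abs_le_iff)
        have "F (\<lambda>x. c * G x) - F u' \<le> Q m N (\<lambda>x. c * G x) z - Q m N u' z"
          using F_le[OF dominated_diff[OF cG u'] p that] by (simp add: F_diff Q_lin cG u')
        moreover have "F (\<lambda>x. c * G x) + F u' \<le> Q m N (\<lambda>x. c * G x) z + Q m N u' z"
          using F_le[OF dominated_add[OF cG u'] n that] by (simp add: F_add Q_lin cG u')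
        moreover have "c * \<alpha> \<le> F (\<lambda>x. c * G x)"
          unfolding F_cmult using \<eta> W_pos
          by (intro mult_left_mono F_ge[OF G] c) (auto simp: G_def less_imp_le)
        moreover have "Q m N (\<lambda>x. c * G x) z \<le> c * (1 + \<eta> * (lam * W z + beta))"
          using mult_left_mono[OF QG[of z] c] by (simp add: Q_lin)
        ultimately show ?thesis by (simp add: abs_le_iff)
      qed
      have "W x \<le> R" "W y \<le> R" using 2 W_pos[of x] W_pos[of y] by linarith+
      note near[OF this(1)] near[OF this(2)]
      then have "\<bar>Q m N u x - Q m N u y\<bar>
          \<le> c * (1 + \<eta> * (lam * W x + beta)) - c * \<alpha> + (c * (1 + \<eta> * (lam * W y + beta)) - c * \<alpha>)"
        unfolding Qu' by linarith
      also have "\<dots> = c * (2 - 2 * \<alpha> + \<eta> * (2 * beta) + lam * (\<eta> * ?s))" by (simp add: algebra_simps)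
      also have "\<dots> \<le> c * (\<rho> * (2 + \<eta> * ?s))"
      proof (intro mult_left_mono c)
        have "\<eta> * (2 * beta) = \<alpha>" using beta_pos by (simp add: \<eta>_def)
        moreover have "2 - \<alpha> \<le> \<rho> * 2" using \<rho>(4) by simp
        moreover have "lam * (\<eta> * ?s) \<le> \<rho> * (\<eta> * ?s)" using \<rho> \<eta> s by (intro mult_right_mono) auto
        ultimately show "2 - 2 * \<alpha> + \<eta> * (2 * beta) + lam * (\<eta> * ?s) \<le> \<rho> * (2 + \<eta> * ?s)"
          by (simp add: distrib_left)
      qed
      finally show ?thesis by (simp add: Wd_def mult_ac)
    qed
  qed
  from mN \<eta> \<rho>(1,2) key show thesis by (rule that)
qed


lemma Q_iter_dom: "u \<in> dominated \<Longrightarrow> (Q m N ^^ n) u \<in> dominated"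
  by (induction n) (auto intro: Q_dom)

text \<open>\<open>C\<close> does not depend on \<open>f\<close>, which \<open>ergodic_average\<close> needs.\<close>

theorem poisson_equation:
  assumes small: "small_set T D" and pi: "prob_space \<pi>" "sets \<pi> = sets borel"
    and inv: "\<pi> \<bind> T = \<pi>" and Wint: "integrable \<pi> W"
  obtains C where "0 \<le> C"
    "\<And>f c. f \<in> borel_measurable borel \<Longrightarrow> 0 \<le> c \<Longrightarrow> (\<And>x. \<bar>f x\<bar> \<le> c * W x) \<Longrightarrow> (LINT x|\<pi>. f x) = 0 \<Longrightarrow>
      \<exists>v\<in>dominated. (\<forall>x. \<bar>v x\<bar> \<le> C * c * W x) \<and> (LINT x|\<pi>. v x) = 0 \<and> (\<forall>x. v x - E 1 v x = f x)"
proof (rule Q_contraction[OF small])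
  interpret pi: prob_space \<pi> by fact
  fix m N :: nat and \<eta> \<rho> :: real
  assume mN: "0 < m" "0 < N" and \<eta>: "0 < \<eta>" and \<rho>: "0 \<le> \<rho>" "\<rho> < 1"
    and contr: "\<And>u c x y. u \<in> dominated \<Longrightarrow> 0 \<le> c \<Longrightarrow> (\<And>x y. \<bar>u x - u y\<bar> \<le> c * Wd \<eta> x y) \<Longrightarrow>
       \<bar>Q m N u x - Q m N u y\<bar> \<le> \<rho> * c * Wd \<eta> x y"
  let ?Q = "Q m N"
  have dint: "integrable \<pi> u" if udom: "u \<in> dominated" for u
  proof -
    obtain c where c: "0 \<le> c" "\<And>x. \<bar>u x\<bar> \<le> c * W x" using udom by (metis dominatedE)
    have "integrable \<pi> (\<lambda>x. c * W x)" using Wint by simp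
    moreover have "u \<in> borel_measurable \<pi>"
      using dominated_meas[OF udom] measurable_cong_sets[OF pi(2) refl] by blast
    ultimately show ?thesis
      by (rule Bochner_Integration.integrable_bound) (use c in \<open>auto simp: abs_mult abs_of_pos[OF W_pos]\<close>)
  qed
  have E1: "E 1 u x = (LINT y|T x. u y)" for u x
    unfolding E_def One_nat_def kernel_power_1 by simp
  have int_E1: "(LINT x|\<pi>. E 1 u x) = (LINT x|\<pi>. u x)" if "u \<in> dominated" for u
    using integrable_bind_kernel(3)[OF ker pi(2), of u] dint[OF that] unfolding E1 by (simp add: inv)
  have int_E: "(LINT x|\<pi>. E n u x) = (LINT x|\<pi>. u x)" if "u \<in> dominated" for u n
  proof (induction n)
    case 0
    then show ?case using that by (simp add: E_0)
  next
    case (Suc n)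
    have "E (Suc n) u = E 1 (E n u)" using E_add[OF that, of 1 n] by (simp add: fun_eq_iff)
    then show ?case using int_E1[OF E_dom[OF that, of n]] Suc by simp
  qed
  have int_Q: "(LINT x|\<pi>. ?Q u x) = (LINT x|\<pi>. u x)" if "u \<in> dominated" for u
    unfolding Q_def using mN by (simp add: int_E[OF that] dint[OF E_dom[OF that]])
  define A where "A = 2 + \<eta> + \<eta> * (LINT x|\<pi>. W x)"
  have piW: "1 \<le> (LINT x|\<pi>. W x)"
    using integral_mono[OF pi.integrable_const Wint, of 1] W_ge by (simp add: pi.prob_space)
  have A: "0 < A" using \<eta> piW by (simp add: A_def add_pos_pos)
  \<comment> \<open>Averaging the oscillation bound over y with respect to pi turns it into a
    weighted supremum bound; for mean-zero u the subtracted constant disappears.\<close>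
  have osc: "\<bar>u x - (LINT y|\<pi>. u y)\<bar> \<le> c * A * W x"
    if u: "u \<in> dominated" and c: "0 \<le> c" and lip: "\<And>x y. \<bar>u x - u y\<bar> \<le> c * Wd \<eta> x y" for u c x
  proof -
    have "u x - (LINT y|\<pi>. u y) = (LINT y|\<pi>. u x - u y)"
      using dint[OF u] by (simp add: pi.prob_space)
    then have "\<bar>u x - (LINT y|\<pi>. u y)\<bar> \<le> (LINT y|\<pi>. \<bar>u x - u y\<bar>)"
      using integral_abs_bound[of \<pi> "\<lambda>y. u x - u y"] by simp
    also have "\<dots> \<le> (LINT y|\<pi>. c * Wd \<eta> x y)"
      using dint[OF u] Wint by (intro integral_mono lip) (auto simp: Wd_def)
    also have "\<dots> = c * (2 + \<eta> * (W x + (LINT y|\<pi>. W y)))"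
      using Wint by (simp add: Wd_def pi.prob_space)
    also have "\<dots> \<le> c * (A * W x)"
    proof (intro mult_left_mono c)
      have "2 * 1 \<le> 2 * W x" "\<eta> * (LINT y|\<pi>. W y) * 1 \<le> \<eta> * (LINT y|\<pi>. W y) * W x"
        using W_ge[of x] \<eta> piW by (intro mult_left_mono; simp)+
      then show "2 + \<eta> * (W x + (LINT y|\<pi>. W y)) \<le> A * W x"
        by (simp add: A_def algebra_simps)
    qed
    finally show ?thesis by (simp add: mult.assoc)
  qed
  \<comment> \<open>The factor 1 / \<eta> bounds the oscillation of f by its weighted norm, A leads
    back to the norm, and 1 / (1 - \<rho>) sums the geometric series.\<close>
  define B where "B = A / \<eta> / (1 - \<rho>)"
  have B: "0 \<le> B" using A \<eta> \<rho> by (simp add: B_def)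
  define C1 where "C1 = real (m + N) * (1 + beta) * B"
  have C1: "0 \<le> C1" using B beta_pos by (simp add: C1_def)
  define C where "C = C1 + C1 * (LINT x|\<pi>. W x)"
  have C: "0 \<le> C" using C1 piW by (simp add: C_def)
  show thesis
  proof (rule that[OF C])
    fix f c
    assume fm: "f \<in> borel_measurable borel" and c: "0 \<le> c" and fb: "\<And>x. \<bar>f x\<bar> \<le> c * W x"
      and f0: "(LINT x|\<pi>. f x) = 0"
    have f: "f \<in> dominated" using fm fb by (rule dominatedI)
    define q where "q n = (?Q ^^ n) f" for n
    have q: "q n \<in> dominated" for n unfolding q_def by (rule Q_iter_dom[OF f])
    have q0: "(LINT x|\<pi>. q n x) = 0" for n
      by (induction n) (simp_all add: q_def f0 int_Q[OF Q_iter_dom[OF f]])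
    have lip: "\<bar>q n x - q n y\<bar> \<le> \<rho> ^ n * (c / \<eta>) * Wd \<eta> x y" for n x y
    proof (induction n arbitrary: x y)
      case 0
      have "\<bar>f x - f y\<bar> \<le> c * W x + c * W y" using fb[of x] fb[of y] by linarith
      also have "\<dots> \<le> c / \<eta> * Wd \<eta> x y" using c \<eta> by (simp add: Wd_def field_simps)
      finally show ?case by (simp add: q_def)
    next
      case (Suc n)
      have "\<bar>?Q (q n) x - ?Q (q n) y\<bar> \<le> \<rho> * (\<rho> ^ n * (c / \<eta>)) * Wd \<eta> x y"
        using c \<eta> \<rho> by (intro contr q Suc) auto
      then show ?case by (simp add: q_def mult.assoc)
    qed
    have qb: "\<bar>q n x\<bar> \<le> \<rho> ^ n * (c / \<eta> * A * W x)" for n x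
      using osc[OF q _ lip, of n x] c \<eta> \<rho> by (simp add: q0 mult.assoc)
    have geo: "summable (\<lambda>n. \<rho> ^ n * (c / \<eta> * A * W x))" for x
      using \<rho> by (intro summable_mult2 summable_geometric) auto
    have sq: "summable (\<lambda>n. q n x)" for x
      by (rule summable_comparison_test'[OF geo[of x], of 0]) (use qb in auto)
    \<comment> \<open>The Neumann series for u - Q u = f.\<close>
    define u where "u x = (\<Sum>n. q n x)" for x
    have um: "u \<in> borel_measurable borel"
      unfolding u_def using dominated_meas[OF q] by (intro borel_measurable_suminf)
    have tail: "\<bar>u x - (\<Sum>n<k. q n x)\<bar> \<le> \<rho> ^ k * (B * c) * W x" for k x
    proof -
      have "u x - (\<Sum>n<k. q n x) = (\<Sum>n. q (n + k) x)"
        unfolding u_def using suminf_split_initial_segment[OF sq, of x k] by simp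
      also have "\<bar>\<dots>\<bar> \<le> (\<Sum>n. \<rho> ^ (n + k) * (c / \<eta> * A * W x))"
      proof -
        have s: "summable (\<lambda>n. \<rho> ^ (n + k) * (c / \<eta> * A * W x))"
          using geo[of x] summable_iff_shift[of "\<lambda>n. \<rho> ^ n * (c / \<eta> * A * W x)" k] by blast
        have "norm (\<Sum>n. q (n + k) x) \<le> (\<Sum>n. \<rho> ^ (n + k) * (c / \<eta> * A * W x))"
          by (rule norm_suminf_le[OF _ s]) (use qb in auto)
        then show ?thesis by simp
      qed
      also have "\<dots> = (\<Sum>n. \<rho> ^ n * (\<rho> ^ k * (c / \<eta> * A * W x)))"
        by (simp add: power_add mult.assoc)
      also have "\<dots> = 1 / (1 - \<rho>) * (\<rho> ^ k * (c / \<eta> * A * W x))"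
        using \<rho> by (subst suminf_mult2[symmetric]) (auto simp: suminf_geometric)
      finally show ?thesis by (simp add: B_def mult_ac)
    qed
    have ub: "\<bar>u x\<bar> \<le> B * c * W x" for x using tail[of x 0] by simp
    have u: "u \<in> dominated" using um ub by (rule dominatedI)
    have Qu: "?Q u x = u x - f x" for x
    proof -
      have part: "(\<lambda>x. \<Sum>n<k. q n x) \<in> dominated" for k by (intro dominated_sum q)
      have Qpart: "?Q (\<lambda>x. \<Sum>n<k. q n x) x = (\<Sum>n<Suc k. q n x) - f x" for k
      proof (induction k)
        case 0
        then show ?case using mN by (simp add: Q_lin q_def)
      next
        case (Suc k)
        have "?Q (\<lambda>x. (\<Sum>n<k. q n x) + q k x) x = ?Q (\<lambda>x. \<Sum>n<k. q n x) x + ?Q (q k) x"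
          by (rule Q_lin(1)[OF part q])
        moreover have "?Q (q k) = q (Suc k)" by (simp add: q_def)
        ultimately show ?case using Suc by simp
      qed
      \<comment> \<open>Q is passed through the infinite sum by estimating Q of the tail, whose
        weighted norm decays like \<rho>^k.\<close>
      have bd: "\<bar>?Q u x - ((\<Sum>n<Suc k. q n x) - f x)\<bar> \<le> \<rho> ^ k * (B * c * ?Q W x)" for k
      proof -
        have "\<bar>?Q (\<lambda>x. u x - (\<Sum>n<k. q n x)) x\<bar> \<le> ?Q (\<lambda>x. \<rho> ^ k * (B * c) * W x) x"
          by (intro Q_abs_le dominated_diff part u dominated_intros tail)
        then show ?thesis by (simp only: Q_lin(2)[OF u part] Q_lin(3) Qpart mult.assoc)
      qed
      have "(\<lambda>k. \<rho> ^ k * (B * c * ?Q W x)) \<longlonglongrightarrow> 0"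
        using \<rho> by (intro tendsto_mult_left_zero LIMSEQ_power_zero) auto
      then have "(\<lambda>k. ?Q u x - ((\<Sum>n<Suc k. q n x) - f x)) \<longlonglongrightarrow> 0"
        by (rule Lim_null_comparison[rotated]) (use bd in auto)
      moreover have "(\<lambda>k. ?Q u x - ((\<Sum>n<Suc k. q n x) - f x)) \<longlonglongrightarrow> ?Q u x - (u x - f x)"
        unfolding u_def using summable_LIMSEQ[OF sq, of x]
        by (intro tendsto_intros LIMSEQ_Suc)
      ultimately show ?thesis using LIMSEQ_unique by fastforce
    qed
    \<comment> \<open>From Q back to T: u - T^(m + j) u is (1 - T) applied to the sum of T^i u over
      i < m + j, and averaging over j turns u - Q u into r - T r.\<close>
    define r where "r x = (\<Sum>j<N. \<Sum>i<m + j. E i u x) / real N" for x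
    have r: "r \<in> dominated" unfolding r_def by (intro dominated_intros E_dom u)
    have rE: "r x - E 1 r x = f x" for x
    proof -
      have E1E: "E 1 (E i u) x = E (Suc i) u x" for i using E_add[OF u, of 1 i x] by simp
      have "E 1 r x = (\<Sum>j<N. \<Sum>i<m + j. E (Suc i) u x) / real N"
        unfolding r_def by (simp add: E_lin E_sum dominated_sum E_dom u E1E del: One_nat_def)
      then have "r x - E 1 r x = (\<Sum>j<N. \<Sum>i<m + j. E i u x - E (Suc i) u x) / real N"
        by (simp add: r_def sum_subtractf diff_divide_distrib)
      also have "\<dots> = (\<Sum>j<N. u x - E (m + j) u x) / real N"
        by (simp only: sum_lessThan_telescope'[of "\<lambda>i. E i u x" for x] E_0[OF u])
      also have "\<dots> = u x - ?Q u x"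
        using mN by (simp add: Q_def sum_subtractf diff_divide_distrib)
      finally show ?thesis by (simp add: Qu)
    qed
    have rb: "\<bar>r x\<bar> \<le> C1 * c * W x" for x
    proof -
      have e: "\<bar>E i u x\<bar> \<le> (B * c) * (1 + beta) * W x" for i
        using E_bound[OF u _ ub, of i x] B c by simp
      have "\<bar>\<Sum>j<N. \<Sum>i<m + j. E i u x\<bar> \<le> (\<Sum>j<N. \<Sum>i<m + j. \<bar>E i u x\<bar>)"
        by (intro order_trans[OF sum_abs] sum_mono sum_abs)
      also have "\<dots> \<le> (\<Sum>j<N. \<Sum>i<m + j. (B * c) * (1 + beta) * W x)"
        by (intro sum_mono e)
      also have "\<dots> \<le> (\<Sum>j<N. real (m + N) * ((B * c) * (1 + beta) * W x))"
        using B c beta_pos W_pos[of x] by (intro sum_mono) (simp add: mult_right_mono)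
      finally have "\<bar>\<Sum>j<N. \<Sum>i<m + j. E i u x\<bar> \<le> real N * (C1 * c * W x)"
        by (simp add: C1_def mult_ac)
      then show ?thesis using mN by (simp add: r_def field_simps)
    qed
    define p where "p = (LINT x|\<pi>. r x)"
    have pb: "\<bar>p\<bar> \<le> C1 * c * (LINT x|\<pi>. W x)"
    proof -
      have "\<bar>p\<bar> \<le> (LINT x|\<pi>. \<bar>r x\<bar>)" unfolding p_def by (rule integral_abs_bound)
      also have "\<dots> \<le> (LINT x|\<pi>. C1 * c * W x)"
        using dint[OF r] Wint by (intro integral_mono rb) auto
      finally show ?thesis by simp
    qed
    \<comment> \<open>Centering is free, since T fixes constants.\<close>
    define v where "v x = r x - p" for x
    have v: "v \<in> dominated" unfolding v_def by (intro dominated_intros r)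
    have "\<bar>v x\<bar> \<le> C * c * W x" for x
    proof -
      have "C1 * c * (LINT x|\<pi>. W x) * 1 \<le> C1 * c * (LINT x|\<pi>. W x) * W x"
        using C1 c piW W_ge[of x] by (intro mult_left_mono) auto
      then have "\<bar>p\<bar> \<le> C1 * c * (LINT x|\<pi>. W x) * W x" using pb by simp
      then show ?thesis using rb[of x] unfolding v_def C_def by (simp add: algebra_simps abs_le_iff)
    qed
    moreover have "(LINT x|\<pi>. v x) = 0"
      unfolding v_def using dint[OF r] by (simp add: p_def pi.prob_space)
    moreover have "v x - E 1 v x = f x" for x
      using rE[of x] unfolding v_def E_lin(2)[OF r dominated_const] E_lin(5) by simp
    ultimately show "\<exists>v\<in>dominated. (\<forall>x. \<bar>v x\<bar> \<le> C * c * W x) \<and> (LINT x|\<pi>. v x) = 0 \<and> (\<forall>x. v x - E 1 v x = f x)"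
      using v by blast
  qed
qed


text \<open>For v with v - T v = f - pi(f) the sum telescopes to v - T^n v, which is bounded by a
  multiple of c * W x. The bound has to be uniform over all f with the same c, because in
  \<open>pointwise_clt\<close> the averaged function changes with M.\<close>

lemma ergodic_average:
  assumes small: "small_set T D" and pi: "prob_space \<pi>" "sets \<pi> = sets borel"
    and inv: "\<pi> \<bind> T = \<pi>" and Wint: "integrable \<pi> W"
  obtains C where "\<And>f c x n. f \<in> borel_measurable borel \<Longrightarrow> 0 \<le> c \<Longrightarrow> (\<And>x. \<bar>f x\<bar> \<le> c) \<Longrightarrow> 0 < n \<Longrightarrow>
      \<bar>(\<Sum>j<n. LINT y|kernel_power T j x. f y) / real n - (LINT x|\<pi>. f x)\<bar> \<le> C * c * W x / real n"
proof (rule poisson_equation[OF assms])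
  interpret pi: prob_space \<pi> by fact
  fix C assume C: "0 \<le> C"
    and ps: "\<And>f c. f \<in> borel_measurable borel \<Longrightarrow> 0 \<le> c \<Longrightarrow> (\<And>x. \<bar>f x\<bar> \<le> c * W x) \<Longrightarrow> (LINT x|\<pi>. f x) = 0 \<Longrightarrow>
      \<exists>v\<in>dominated. (\<forall>x. \<bar>v x\<bar> \<le> C * c * W x) \<and> (LINT x|\<pi>. v x) = 0 \<and> (\<forall>x. v x - E 1 v x = f x)"
  show thesis
  proof (rule that[of "2 * C + 2 * C * (1 + beta)"])
    fix f :: "'a \<Rightarrow> real" and c :: real and x and n :: nat
    assume f: "f \<in> borel_measurable borel" and c: "0 \<le> c" and fc: "\<And>x. \<bar>f x\<bar> \<le> c" and n: "0 < n"
    have fpi: "f \<in> borel_measurable \<pi>" using f measurable_cong_sets[OF pi(2) refl] by blast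
    have fint: "integrable \<pi> f"
      by (rule pi.integrable_const_bound[of _ c]) (use fc fpi in auto)
    define p where "p = (LINT x|\<pi>. f x)"
    have "\<bar>p\<bar> \<le> (LINT x|\<pi>. \<bar>f x\<bar>)" unfolding p_def by (rule integral_abs_bound)
    also have "\<dots> \<le> (LINT x|\<pi>. c)" using fint fc by (intro integral_mono) auto
    finally have p: "\<bar>p\<bar> \<le> c" by (simp add: pi.prob_space)
    have fW: "\<bar>f z - p\<bar> \<le> 2 * c * W z" for z
    proof -
      have "\<bar>f z - p\<bar> \<le> 2 * c * 1" using fc[of z] p by linarith
      also have "\<dots> \<le> 2 * c * W z" using c W_ge[of z] by (intro mult_left_mono) auto
      finally show ?thesis .
    qed
    have "(LINT x|\<pi>. f x - p) = 0" using fint by (simp add: p_def pi.prob_space)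
    then obtain v where v: "v \<in> dominated" and vb: "\<And>x. \<bar>v x\<bar> \<le> C * (2 * c) * W x"
      and vf: "\<And>x. v x - E 1 v x = f x - p"
      using ps[of "\<lambda>x. f x - p" "2 * c"] f c fW by auto
    have fd: "f \<in> dominated" using f fc by (rule dominated_bounded)
    have "E j f x - p = E j v x - E (Suc j) v x" for j
    proof -
      have "f = (\<lambda>z. v z - E 1 v z + p)" using vf by (auto simp: fun_eq_iff algebra_simps)
      then have "E j f x = E j (\<lambda>z. v z - E 1 v z + p) x" by simp
      also have "\<dots> = E j v x - E j (E 1 v) x + p"
        by (simp only: E_lin(1)[OF dominated_diff[OF v E_dom[OF v]] dominated_const] E_lin(2)[OF v E_dom[OF v]] E_lin(5))
      finally show ?thesis using E_add[OF v, of j 1 x] by simp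
    qed
    then have "(\<Sum>j<n. E j f x - p) = v x - E n v x"
      using sum_lessThan_telescope'[of "\<lambda>j. E j v x" n] by (simp add: E_0[OF v])
    then have "(\<Sum>j<n. E j f x) / real n - p = (v x - E n v x) / real n"
      using n by (simp add: sum_subtractf field_simps)
    moreover have "\<bar>v x - E n v x\<bar> \<le> C * (2 * c) * W x + C * (2 * c) * (1 + beta) * W x"
      using vb[of x] E_bound[OF v _ vb, of n x] C c by (auto simp: abs_le_iff)
    ultimately show "\<bar>(\<Sum>j<n. LINT y|kernel_power T j x. f y) / real n - (LINT x|\<pi>. f x)\<bar>
        \<le> (2 * C + 2 * C * (1 + beta)) * c * W x / real n"
      by (simp add: E_def[symmetric] p_def[symmetric] abs_divide divide_right_mono algebra_simps)
  qed
qed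

end

section \<open>Gibbs kernels as projections\<close>

text \<open>Functions rather than classes: kernels are applied pointwise, so representatives have to
  be Borel measurable even though most identities below hold only almost everywhere.\<close>

definition L2 :: "'a::topological_space measure \<Rightarrow> ('a \<Rightarrow> real) \<Rightarrow> bool" where
  "L2 \<pi> u \<longleftrightarrow> u \<in> borel_measurable borel \<and> integrable \<pi> (\<lambda>x. (u x)\<^sup>2)"

definition sq_norm :: "'a measure \<Rightarrow> ('a \<Rightarrow> real) \<Rightarrow> real" where
  "sq_norm \<pi> u = (LINT x|\<pi>. (u x)\<^sup>2)"

definition kernel_int :: "('a \<Rightarrow> 'a measure) \<Rightarrow> ('a \<Rightarrow> real) \<Rightarrow> 'a \<Rightarrow> real" where
  "kernel_int P u x = (LINT y|P x. u y)"

locale borel_prob = prob_space \<pi> for \<pi> :: "'a::topological_space measure" +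
  assumes sets_pi: "sets \<pi> = sets borel"
begin

lemma meas_pi: "u \<in> borel_measurable borel \<Longrightarrow> u \<in> borel_measurable \<pi>"
  using measurable_cong_sets[OF sets_pi refl] by blast

lemma L2_meas: "L2 \<pi> u \<Longrightarrow> u \<in> borel_measurable borel"
  by (simp add: L2_def)

lemma L2_mult:
  assumes "L2 \<pi> u" "L2 \<pi> v" shows "integrable \<pi> (\<lambda>x. u x * v x)"
proof (rule Bochner_Integration.integrable_bound)
  show "integrable \<pi> (\<lambda>x. (u x)\<^sup>2 + (v x)\<^sup>2)" using assms by (auto simp: L2_def)
  show "(\<lambda>x. u x * v x) \<in> borel_measurable \<pi>"
    using assms[THEN L2_meas, THEN meas_pi] by simp
  have "\<bar>u x * v x\<bar> \<le> (u x)\<^sup>2 + (v x)\<^sup>2" for x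
  proof -
    have "2 * (\<bar>u x\<bar> * \<bar>v x\<bar>) \<le> (u x)\<^sup>2 + (v x)\<^sup>2"
      using sum_squares_bound[of "\<bar>u x\<bar>" "\<bar>v x\<bar>"] by (simp add: mult.assoc)
    moreover have "0 \<le> \<bar>u x\<bar> * \<bar>v x\<bar>" by simp
    ultimately show ?thesis unfolding abs_mult by linarith
  qed
  then show "AE x in \<pi>. norm (u x * v x) \<le> norm ((u x)\<^sup>2 + (v x)\<^sup>2)" by auto
qed

lemma L2_const: "L2 \<pi> (\<lambda>_. c)" by (simp add: L2_def)

lemma L2_integrable: "L2 \<pi> u \<Longrightarrow> integrable \<pi> u"
  using L2_mult[of u "\<lambda>_. 1"] by (simp add: L2_const)

lemma L2_add: assumes "L2 \<pi> u" "L2 \<pi> v" shows "L2 \<pi> (\<lambda>x. u x + v x)"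
  using assms L2_mult[OF assms] by (auto simp: L2_def power2_sum mult.assoc)

lemma L2_cmult: "L2 \<pi> u \<Longrightarrow> L2 \<pi> (\<lambda>x. c * u x)"
  by (auto simp: L2_def power_mult_distrib)

lemma L2_diff: "L2 \<pi> u \<Longrightarrow> L2 \<pi> v \<Longrightarrow> L2 \<pi> (\<lambda>x. u x - v x)"
  using L2_add[of u "\<lambda>x. (-1) * v x"] L2_cmult[of v "-1"] by simp

lemma L2_sum: "(\<And>i. i \<in> I \<Longrightarrow> L2 \<pi> (u i)) \<Longrightarrow> L2 \<pi> (\<lambda>x. \<Sum>i\<in>I. u i x)"
  by (induction I rule: infinite_finite_induct) (auto intro: L2_const L2_add)

lemma L2_bound:
  assumes "u \<in> borel_measurable borel" "L2 \<pi> v" "\<And>x. \<bar>u x\<bar> \<le> \<bar>v x\<bar>" shows "L2 \<pi> u"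
proof -
  have "integrable \<pi> (\<lambda>x. (u x)\<^sup>2)"
  proof (rule Bochner_Integration.integrable_bound)
    show "integrable \<pi> (\<lambda>x. (v x)\<^sup>2)" using assms by (simp add: L2_def)
    show "(\<lambda>x. (u x)\<^sup>2) \<in> borel_measurable \<pi>" using meas_pi[OF assms(1)] by simp
    show "AE x in \<pi>. norm ((u x)\<^sup>2) \<le> norm ((v x)\<^sup>2)"
      using assms(3) by (auto simp: abs_le_square_iff)
  qed
  then show ?thesis using assms by (simp add: L2_def)
qed

lemma sq_norm_nonneg: "0 \<le> sq_norm \<pi> u" by (simp add: sq_norm_def)

lemma sq_norm_cong_AE:
  assumes "u \<in> borel_measurable borel" "v \<in> borel_measurable borel" "AE x in \<pi>. u x = v x"
  shows "sq_norm \<pi> u = sq_norm \<pi> v"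
  unfolding sq_norm_def using meas_pi[OF assms(1)] meas_pi[OF assms(2)] assms(3)
  by (intro integral_cong_AE) auto

text \<open>Young's inequality with a free weight. Taking t to be the number of steps already
  treated produces the constant t + 1 in \<open>sweep_iter_defect\<close>.\<close>

lemma sq_norm_add_le:
  assumes u: "L2 \<pi> u" and v: "L2 \<pi> v" and t: "0 < t"
  shows "sq_norm \<pi> (\<lambda>x. u x + v x) \<le> (1 + t) * sq_norm \<pi> u + (1 + 1 / t) * sq_norm \<pi> v"
proof -
  have le: "(u x + v x)\<^sup>2 \<le> (1 + t) * (u x)\<^sup>2 + (1 + 1 / t) * (v x)\<^sup>2" for x
  proof -
    have "0 \<le> (t * u x - v x)\<^sup>2 / t" using t by simp
    also have "(t * u x - v x)\<^sup>2 / t = t * (u x)\<^sup>2 - 2 * u x * v x + (v x)\<^sup>2 / t"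
      using t by (simp add: field_simps power2_eq_square)
    finally show ?thesis by (simp add: power2_sum algebra_simps)
  qed
  have "sq_norm \<pi> (\<lambda>x. u x + v x) \<le> (LINT x|\<pi>. (1 + t) * (u x)\<^sup>2 + (1 + 1 / t) * (v x)\<^sup>2)"
    unfolding sq_norm_def using L2_add[OF u v] u v by (intro integral_mono le) (auto simp: L2_def)
  also have "\<dots> = (1 + t) * sq_norm \<pi> u + (1 + 1 / t) * sq_norm \<pi> v"
    using u v by (simp add: L2_def sq_norm_def)
  finally show ?thesis .
qed

lemma Cauchy_Schwarz:
  assumes u: "L2 \<pi> u" and v: "L2 \<pi> v"
  shows "(LINT x|\<pi>. u x * v x)\<^sup>2 \<le> sq_norm \<pi> u * sq_norm \<pi> v"
proof -
  define a b c where "a = sq_norm \<pi> u" and "b = (LINT x|\<pi>. u x * v x)" and "c = sq_norm \<pi> v"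
  have q: "0 \<le> s\<^sup>2 * a + 2 * s * r * b + r\<^sup>2 * c" for s r
  proof -
    have "0 \<le> sq_norm \<pi> (\<lambda>x. s * u x + r * v x)" by (rule sq_norm_nonneg)
    also have "\<dots> = (LINT x|\<pi>. s\<^sup>2 * (u x)\<^sup>2 + 2 * s * r * (u x * v x) + r\<^sup>2 * (v x)\<^sup>2)"
      unfolding sq_norm_def by (intro Bochner_Integration.integral_cong) (auto simp: power2_eq_square algebra_simps)
    also have "\<dots> = s\<^sup>2 * a + 2 * s * r * b + r\<^sup>2 * c"
      using u v L2_mult[OF u v] by (simp add: L2_def a_def b_def c_def sq_norm_def)
    finally show ?thesis .
  qed
  have ac: "0 \<le> a" "0 \<le> c" by (auto simp: a_def c_def sq_norm_nonneg)
  have "b\<^sup>2 \<le> a * c"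
  proof (cases "a = 0")
    case True
    have "b = 0"
    proof (rule ccontr)
      assume "b \<noteq> 0"
      \<comment> \<open>With a = 0 the form is affine in s; this s makes its value -1.\<close>
      then have "2 * (- (c + 1) / (2 * b)) * b = - (c + 1)" by (simp add: field_simps)
      then show False using q[of "- (c + 1) / (2 * b)" 1] True by simp
    qed
    then show ?thesis using ac by simp
  next
    case False
    have "0 \<le> b\<^sup>2 * a + 2 * b * (- a) * b + (- a)\<^sup>2 * c" by (rule q)
    then have "0 \<le> a * (a * c - b\<^sup>2)" by (simp add: power2_eq_square algebra_simps)
    then show ?thesis using ac False by (simp add: zero_le_mult_iff)
  qed
  then show ?thesis by (simp add: a_def b_def c_def)
qed

end

locale invariant_kernel = borel_prob \<pi> for \<pi> :: "'a::topological_space measure" +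
  fixes P :: "'a \<Rightarrow> 'a measure"
  assumes ker: "prob_kernel P" and invariant: "\<pi> \<bind> P = \<pi>"
begin

lemma kernel_int_meas [measurable]: "u \<in> borel_measurable borel \<Longrightarrow> kernel_int P u \<in> borel_measurable borel"
  unfolding kernel_int_def[abs_def] by (rule measurable_kernel_integral[OF ker])

lemma kernel_meas: "u \<in> borel_measurable borel \<Longrightarrow> u \<in> borel_measurable (P x)"
  by (rule borel_measurable_kernel[OF ker])

text \<open>By invariance, the integral of P(x, N) under pi is 0 for a pi-null set N, so N is P(x,
  .)-null for pi-almost every x. This is what allows identities that hold pi-almost everywhere to
  pass under the kernel.\<close>

lemma AE_kernel:
  assumes "AE x in \<pi>. Q x" shows "AE x in \<pi>. AE y in P x. Q y"
proof -
  obtain N where N: "{x \<in> space \<pi>. \<not> Q x} \<subseteq> N" "emeasure \<pi> N = 0" "N \<in> sets \<pi>"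
    using AE_E[OF assms] by blast
  have [measurable]: "N \<in> sets borel" using N(3) sets_pi by simp
  have "AE x in \<pi>. x \<notin> N" using N by (intro AE_not_in) (auto simp: null_sets_def)
  then have "AE x in (\<pi> \<bind> P). x \<notin> N" unfolding invariant .
  then have "AE x in \<pi>. AE y in P x. y \<notin> N"
    by (subst (asm) AE_bind[OF prob_kernel_subprob[OF ker sets_pi]]) auto
  then show ?thesis
    by (rule AE_mp) (use N(1) sets_space_borel[OF sets_pi] in \<open>auto elim!: eventually_mono\<close>)
qed

lemma integrable_kernel:
  assumes "integrable \<pi> u"
  shows "AE x in \<pi>. integrable (P x) u" "integrable \<pi> (kernel_int P u)"
    "(LINT x|\<pi>. kernel_int P u x) = (LINT x|\<pi>. u x)"
  using integrable_bind_kernel[OF ker sets_pi, of u] assms unfolding invariant kernel_int_def[abs_def] by auto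

lemma kernel_int_AE_lin:
  assumes "integrable \<pi> u" "integrable \<pi> v"
  shows "AE x in \<pi>. kernel_int P (\<lambda>y. u y + v y) x = kernel_int P u x + kernel_int P v x"
    "AE x in \<pi>. kernel_int P (\<lambda>y. u y - v y) x = kernel_int P u x - kernel_int P v x"
  using integrable_kernel(1)[OF assms(1)] integrable_kernel(1)[OF assms(2)]
  by (eventually_elim, simp add: kernel_int_def)+

lemma kernel_int_cmult: "kernel_int P (\<lambda>y. c * u y) x = c * kernel_int P u x"
  by (simp add: kernel_int_def)

lemma kernel_int_AE_cong:
  assumes "u \<in> borel_measurable borel" "v \<in> borel_measurable borel" "AE x in \<pi>. u x = v x"
  shows "AE x in \<pi>. kernel_int P u x = kernel_int P v x"
  using AE_kernel[OF assms(3)]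
  by eventually_elim (unfold kernel_int_def, intro integral_cong_AE kernel_meas assms)

text \<open>The difference of the two sides is a variance under P(x, .).\<close>

lemma kernel_int_square_le:
  assumes "L2 \<pi> u"
  shows "AE x in \<pi>. (kernel_int P u x)\<^sup>2 \<le> kernel_int P (\<lambda>y. (u y)\<^sup>2) x"
proof -
  have "AE x in \<pi>. integrable (P x) (\<lambda>y. (u y)\<^sup>2)"
    using assms by (intro integrable_kernel) (auto simp: L2_def)
  then show ?thesis using integrable_kernel(1)[OF L2_integrable[OF assms]]
  proof eventually_elim
    case (elim x)
    interpret Px: prob_space "P x" by (rule prob_kernelD(1)[OF ker])
    define a where "a = kernel_int P u x"
    have "0 \<le> (LINT y|P x. (u y - a)\<^sup>2)" by simp
    also have "\<dots> = (LINT y|P x. (u y)\<^sup>2 - 2 * a * u y + a\<^sup>2)"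
      by (simp add: power2_diff mult_ac algebra_simps)
    also have "\<dots> = kernel_int P (\<lambda>y. (u y)\<^sup>2) x - a\<^sup>2"
      using elim by (simp add: Px.prob_space kernel_int_def a_def power2_eq_square)
    finally show ?case by (simp add: a_def)
  qed
qed

lemma kernel_int_L2: assumes u: "L2 \<pi> u" shows "L2 \<pi> (kernel_int P u)" and "sq_norm \<pi> (kernel_int P u) \<le> sq_norm \<pi> u"
proof -
  have iu: "integrable \<pi> (\<lambda>x. (u x)\<^sup>2)" using u by (simp add: L2_def)
  have m: "kernel_int P u \<in> borel_measurable borel" by (rule kernel_int_meas[OF L2_meas[OF u]])
  have *: "integrable \<pi> (\<lambda>x. (kernel_int P u x)\<^sup>2)"
    by (rule Bochner_Integration.integrable_bound[OF integrable_kernel(2)[OF iu]])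
      (use meas_pi[OF m] kernel_int_square_le[OF u] in \<open>auto elim!: eventually_mono\<close>)
  with m show "L2 \<pi> (kernel_int P u)" by (simp add: L2_def)
  have "sq_norm \<pi> (kernel_int P u) \<le> (LINT x|\<pi>. kernel_int P (\<lambda>y. (u y)\<^sup>2) x)"
    unfolding sq_norm_def by (intro integral_mono_AE * integrable_kernel(2) iu kernel_int_square_le u)
  then show "sq_norm \<pi> (kernel_int P u) \<le> sq_norm \<pi> u" by (simp add: integrable_kernel(3)[OF iu] sq_norm_def)
qed

end

text \<open>The single identity <Pu, Pv> = <u, Pv> encodes symmetry and idempotence, that is, an
  orthogonal projection. With nonnegative integrals it needs no integrability, which suits its
  derivation from indicators.\<close>

locale projection_kernel = invariant_kernel +
  assumes nn_projection: "\<And>u v. u \<in> borel_measurable borel \<Longrightarrow> v \<in> borel_measurable borel \<Longrightarrow>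
    (\<integral>\<^sup>+x. (\<integral>\<^sup>+y. u y \<partial>P x) * (\<integral>\<^sup>+y. v y \<partial>P x) \<partial>\<pi>) = (\<integral>\<^sup>+x. u x * (\<integral>\<^sup>+y. v y \<partial>P x) \<partial>\<pi>)"
begin

lemma projection_nonneg:
  assumes u: "L2 \<pi> u" "\<And>x. 0 \<le> u x" and v: "L2 \<pi> v" "\<And>x. 0 \<le> v x"
  shows "(LINT x|\<pi>. kernel_int P u x * kernel_int P v x) = (LINT x|\<pi>. u x * kernel_int P v x)"
proof -
  have e: "AE x in \<pi>. (\<integral>\<^sup>+y. ennreal (w y) \<partial>P x) = ennreal (kernel_int P w x)"
    if "L2 \<pi> w" "\<And>x. 0 \<le> w x" for w
    using integrable_kernel(1)[OF L2_integrable[OF that(1)]]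
    by eventually_elim (unfold kernel_int_def, intro nn_integral_eq_integral, use that in auto)
  have nn: "0 \<le> kernel_int P w x" if "\<And>x. 0 \<le> w x" for w x
    unfolding kernel_int_def using that by (intro integral_nonneg_AE) auto
  have m: "(\<lambda>x. ennreal (u x)) \<in> borel_measurable borel" "(\<lambda>x. ennreal (v x)) \<in> borel_measurable borel"
    using L2_meas[OF u(1)] L2_meas[OF v(1)] by auto
  have "ennreal (LINT x|\<pi>. kernel_int P u x * kernel_int P v x) = (\<integral>\<^sup>+x. ennreal (kernel_int P u x * kernel_int P v x) \<partial>\<pi>)"
    by (intro nn_integral_eq_integral[symmetric] L2_mult kernel_int_L2 u v) (auto simp: nn u v)
  also have "\<dots> = (\<integral>\<^sup>+x. (\<integral>\<^sup>+y. ennreal (u y) \<partial>P x) * (\<integral>\<^sup>+y. ennreal (v y) \<partial>P x) \<partial>\<pi>)"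
    by (intro nn_integral_cong_AE)
      (use e[OF u] e[OF v] in eventually_elim, simp add: nn u v ennreal_mult)
  also have "\<dots> = (\<integral>\<^sup>+x. ennreal (u x) * (\<integral>\<^sup>+y. ennreal (v y) \<partial>P x) \<partial>\<pi>)"
    by (rule nn_projection[OF m])
  also have "\<dots> = (\<integral>\<^sup>+x. ennreal (u x * kernel_int P v x) \<partial>\<pi>)"
    by (intro nn_integral_cong_AE)
      (use e[OF v] in eventually_elim, simp add: nn u v ennreal_mult)
  also have "\<dots> = ennreal (LINT x|\<pi>. u x * kernel_int P v x)"
    by (intro nn_integral_eq_integral L2_mult kernel_int_L2 u v) (auto simp: nn u v)
  finally show ?thesis
    by (subst (asm) ennreal_inj) (auto intro!: integral_nonneg_AE simp: nn u v)
qed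

lemma projection:
  assumes u: "L2 \<pi> u" and v: "L2 \<pi> v"
  shows "(LINT x|\<pi>. kernel_int P u x * kernel_int P v x) = (LINT x|\<pi>. u x * kernel_int P v x)"
proof -
  let ?p = "\<lambda>(u::'a \<Rightarrow> real) x. max (u x) 0" and ?n = "\<lambda>(u::'a \<Rightarrow> real) x. max (- u x) 0"
  have pn: "L2 \<pi> (?p w)" "L2 \<pi> (?n w)" if "L2 \<pi> w" for w
    using L2_meas[OF that] by (auto intro!: L2_bound[OF _ that])
  have split: "AE x in \<pi>. kernel_int P w x = kernel_int P (?p w) x - kernel_int P (?n w) x" if "L2 \<pi> w" for w
  proof -
    have "w = (\<lambda>x. ?p w x - ?n w x)" by (auto simp: max_def)
    then show ?thesis
      using kernel_int_AE_lin(2)[OF L2_integrable[OF pn(1)[OF that]] L2_integrable[OF pn(2)[OF that]]] by simp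
  qed
  note pu = pn[OF u] and pv = pn[OF v]
  have i: "integrable \<pi> (\<lambda>x. a x * kernel_int P b x)" if "L2 \<pi> a" "L2 \<pi> b" for a b
    by (intro L2_mult kernel_int_L2 that)
  have s: "(LINT x|\<pi>. (a x - a' x) * (b x - b' x)) =
      (LINT x|\<pi>. a x * b x) - (LINT x|\<pi>. a' x * b x) - (LINT x|\<pi>. a x * b' x) + (LINT x|\<pi>. a' x * b' x)"
    if "L2 \<pi> a" "L2 \<pi> a'" "L2 \<pi> b" "L2 \<pi> b'" for a a' b b'
  proof -
    have "(LINT x|\<pi>. (a x - a' x) * (b x - b' x)) = (LINT x|\<pi>. a x * b x - a' x * b x - a x * b' x + a' x * b' x)"
      by (intro Bochner_Integration.integral_cong) (auto simp: algebra_simps)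
    then show ?thesis using that by (simp add: L2_mult)
  qed
  have um: "u x = ?p u x - ?n u x" for x by (auto simp: max_def)
  have m: "kernel_int P u \<in> borel_measurable \<pi>" "kernel_int P v \<in> borel_measurable \<pi>" "u \<in> borel_measurable \<pi>"
    "kernel_int P (?p u) \<in> borel_measurable \<pi>" "kernel_int P (?n u) \<in> borel_measurable \<pi>"
    "kernel_int P (?p v) \<in> borel_measurable \<pi>" "kernel_int P (?n v) \<in> borel_measurable \<pi>"
    by (intro meas_pi kernel_int_meas L2_meas u v pu pv)+
  have "(LINT x|\<pi>. kernel_int P u x * kernel_int P v x)
      = (LINT x|\<pi>. (kernel_int P (?p u) x - kernel_int P (?n u) x) * (kernel_int P (?p v) x - kernel_int P (?n v) x))"
    using m split[OF u] split[OF v] by (intro integral_cong_AE) (auto elim: eventually_elim2)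
  also have "\<dots> = (LINT x|\<pi>. (?p u x - ?n u x) * (kernel_int P (?p v) x - kernel_int P (?n v) x))"
    using pu pv by (simp only: s kernel_int_L2 projection_nonneg max.cobounded2)
  also have "\<dots> = (LINT x|\<pi>. u x * (kernel_int P (?p v) x - kernel_int P (?n v) x))"
    by (simp only: um[symmetric])
  also have "\<dots> = (LINT x|\<pi>. u x * kernel_int P v x)"
    using m split[OF v] by (intro integral_cong_AE) auto
  finally show ?thesis .
qed

text \<open>Pythagoras: Pu and u - Pu are orthogonal.\<close>

lemma projection_defect:
  assumes u: "L2 \<pi> u"
  shows "sq_norm \<pi> (\<lambda>x. kernel_int P u x - u x) = sq_norm \<pi> u - sq_norm \<pi> (kernel_int P u)"
proof -
  have "sq_norm \<pi> (\<lambda>x. kernel_int P u x - u x) = (LINT x|\<pi>. (kernel_int P u x)\<^sup>2 - 2 * (u x * kernel_int P u x) + (u x)\<^sup>2)"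
    unfolding sq_norm_def by (intro Bochner_Integration.integral_cong) (auto simp: power2_eq_square algebra_simps)
  also have "\<dots> = sq_norm \<pi> (kernel_int P u) - 2 * (LINT x|\<pi>. u x * kernel_int P u x) + sq_norm \<pi> u"
    using u kernel_int_L2(1)[OF u] L2_mult[OF u kernel_int_L2(1)[OF u]] by (simp add: L2_def sq_norm_def)
  also have "(LINT x|\<pi>. u x * kernel_int P u x) = sq_norm \<pi> (kernel_int P u)"
    using projection[OF u u] by (simp add: sq_norm_def power2_eq_square)
  finally show ?thesis by simp
qed

end

text \<open>The Gibbs property speaks of one set at a time. Two sets give \<open>rectangle\<close>,
  by the defining property of conditional expectation. Functions are reached one argument at a time,
  by reading the identity as an equality of two measures on the state space and integrating against
  it. Invariance of pi is the case B = UNIV.\<close>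

lemma gibbs_projection_kernel:
  fixes \<pi> :: "'a::topological_space measure"
  assumes pi: "prob_space \<pi>" "sets \<pi> = sets borel"
    and h: "h \<in> borel \<rightarrow>\<^sub>M PiM {..<m} (\<lambda>_. borel)" and g: "gibbs_kernel P m h \<pi>"
  shows "projection_kernel \<pi> P"
proof -
  interpret prob_space \<pi> by fact
  define F where "F = vimage_algebra (space \<pi>) h (PiM {..<m} (\<lambda>_. borel))"
  have ker: "prob_kernel P" using g by (simp add: gibbs_kernel_def)
  have h': "h \<in> \<pi> \<rightarrow>\<^sub>M PiM {..<m} (\<lambda>_. borel)"
    using h measurable_cong_sets[OF pi(2) refl] by blast
  have sub: "subalgebra \<pi> F"
    unfolding subalgebra_def F_def using measurable_sets[OF h']
    by (auto simp: sets_vimage_algebra2[OF measurable_space[OF h', THEN funcsetI]])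
  interpret finite_measure_subalgebra \<pi> F
    by unfold_locales (rule sub)
  have cond: "AE x in \<pi>. measure (P x) A = real_cond_exp \<pi> F (indicator A) x" if "A \<in> sets borel" for A
    using g that by (simp add: gibbs_kernel_def F_def)
  have mP: "(\<lambda>x. measure (P x) A) \<in> borel_measurable borel" if "A \<in> sets borel" for A
    using prob_kernelD(4)[OF ker] that by measurable
  have mP': "(\<lambda>x. measure (P x) A) \<in> borel_measurable \<pi>" if "A \<in> sets borel" for A
    using mP[OF that] measurable_cong_sets[OF pi(2) refl] by blast
  have emP: "emeasure (P x) A = ennreal (measure (P x) A)" for x A
    using prob_space.finite_measure[OF prob_kernelD(1)[OF ker]]
    by (simp add: finite_measure.emeasure_eq_measure)
  have le1: "measure (P x) A \<le> 1" for x A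
    using prob_space.prob_le_1[OF prob_kernelD(1)[OF ker]] .
  have intI: "integrable \<pi> (indicat_real A)" if "A \<in> sets borel" for A
    using that pi(2) by (intro integrable_const_bound[of _ 1] borel_measurable_indicator) auto
  have rectangle: "(\<integral>\<^sup>+x. emeasure (P x) A * emeasure (P x) B \<partial>\<pi>)
      = (\<integral>\<^sup>+x. emeasure (P x) B * indicator A x \<partial>\<pi>)"
    if A: "A \<in> sets borel" and B: "B \<in> sets borel" for A B
  proof -
    let ?a = "real_cond_exp \<pi> F (indicator A)" and ?b = "real_cond_exp \<pi> F (indicator B)"
    have [measurable]: "?a \<in> borel_measurable \<pi>" "?b \<in> borel_measurable \<pi>" by auto
    note [measurable] = mP'[OF A] mP'[OF B]
    have ib: "integrable \<pi> (\<lambda>x. ?b x * indicator A x)"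
      using integrable_mult_indicator[OF _ real_cond_exp_int(1)[OF intI[OF B]], of A] A pi(2)
      by (simp add: mult.commute)
    have "(LINT x|\<pi>. measure (P x) A * measure (P x) B) = (LINT x|\<pi>. ?b x * ?a x)"
      using cond[OF A] cond[OF B] by (intro integral_cong_AE) (auto elim: eventually_elim2)
    also have "\<dots> = (LINT x|\<pi>. ?b x * indicator A x)"
      using A pi(2) by (intro real_cond_exp_intg ib) auto
    also have "\<dots> = (LINT x|\<pi>. measure (P x) B * indicator A x)"
      using cond[OF B] A pi(2) by (intro integral_cong_AE) (auto elim: eventually_mono)
    finally have eq: "(LINT x|\<pi>. measure (P x) A * measure (P x) B) = (LINT x|\<pi>. measure (P x) B * indicator A x)" .
    have "(\<integral>\<^sup>+x. emeasure (P x) A * emeasure (P x) B \<partial>\<pi>)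
        = ennreal (LINT x|\<pi>. measure (P x) A * measure (P x) B)"
      unfolding emP ennreal_mult'[OF measure_nonneg, symmetric]
      by (intro nn_integral_eq_integral integrable_const_bound[of _ 1])
        (auto simp: le1 mult_le_one)
    moreover have "(\<integral>\<^sup>+x. emeasure (P x) B * indicator A x \<partial>\<pi>)
        = (\<integral>\<^sup>+x. ennreal (measure (P x) B * indicator A x) \<partial>\<pi>)"
      unfolding emP by (intro nn_integral_cong) (auto simp: indicator_def)
    moreover have "\<dots> = ennreal (LINT x|\<pi>. measure (P x) B * indicator A x)"
      using A pi(2) by (intro nn_integral_eq_integral integrable_const_bound[of _ 1])
        (auto simp: le1 mult_le_one indicator_def)
    ultimately show ?thesis using eq by simp
  qed
  have sd: "sets (density \<pi> f) = sets borel" for f by (simp add: pi(2))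
  have mk: "(\<lambda>x. \<integral>\<^sup>+y. u y \<partial>P x) \<in> borel_measurable \<pi>" if "u \<in> borel_measurable borel" for u
    using measurable_kernel_nn_integral[OF ker that] measurable_cong_sets[OF pi(2) refl] by blast
  have me: "(\<lambda>x. emeasure (P x) A) \<in> borel_measurable \<pi>" if "A \<in> sets borel" for A
    unfolding emP using mP'[OF that] by simp
  have mpi: "u \<in> borel_measurable \<pi>" if "u \<in> borel_measurable borel" for u :: "'a \<Rightarrow> ennreal"
    using that measurable_cong_sets[OF pi(2) refl] by blast
  have half: "(\<integral>\<^sup>+x. (\<integral>\<^sup>+y. u y \<partial>P x) * emeasure (P x) B \<partial>\<pi>) = (\<integral>\<^sup>+x. u x * emeasure (P x) B \<partial>\<pi>)"
    if u: "u \<in> borel_measurable borel" and B: "B \<in> sets borel" for u B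
  proof -
    let ?d = "density \<pi> (\<lambda>x. emeasure (P x) B)"
    \<comment> \<open>\<open>rectangle\<close> says exactly that pi with density P(x, B) is
      invariant under P.\<close>
    have eq: "?d \<bind> P = ?d"
    proof (rule measure_eqI)
      show "sets (?d \<bind> P) = sets ?d" using sets_bind_kernel[OF ker sd] by (simp add: pi(2))
      fix A assume "A \<in> sets (?d \<bind> P)"
      then have A: "A \<in> sets borel" using sets_bind_kernel[OF ker sd] by simp
      have "emeasure (?d \<bind> P) A = (\<integral>\<^sup>+x. emeasure (P x) A \<partial>?d)"
        using A by (intro emeasure_bind[OF _ prob_kernel_subprob[OF ker sd]]) (auto simp: sets_space_borel[OF pi(2)])
      also have "\<dots> = (\<integral>\<^sup>+x. emeasure (P x) A * emeasure (P x) B \<partial>\<pi>)"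
        using me[OF A] me[OF B] by (subst nn_integral_density) (auto simp: mult.commute)
      also have "\<dots> = emeasure ?d A"
        using rectangle[OF A B] me[OF B] A pi(2) by (simp add: emeasure_density)
      finally show "emeasure (?d \<bind> P) A = emeasure ?d A" .
    qed
    have "(\<integral>\<^sup>+x. u x \<partial>(?d \<bind> P)) = (\<integral>\<^sup>+x. \<integral>\<^sup>+y. u y \<partial>P x \<partial>?d)"
      by (rule nn_integral_bind_kernel[OF ker sd u])
    then show ?thesis
      unfolding eq using me[OF B] mk[OF u] mpi[OF u]
      by (subst (asm) (1 2) nn_integral_density) (auto simp: mult.commute)
  qed
  have full: "(\<integral>\<^sup>+x. (\<integral>\<^sup>+y. u y \<partial>P x) * (\<integral>\<^sup>+y. v y \<partial>P x) \<partial>\<pi>) = (\<integral>\<^sup>+x. u x * (\<integral>\<^sup>+y. v y \<partial>P x) \<partial>\<pi>)"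
    if u: "u \<in> borel_measurable borel" and v: "v \<in> borel_measurable borel" for u v
  proof -
    let ?d1 = "density \<pi> (\<lambda>x. \<integral>\<^sup>+y. u y \<partial>P x)" and ?d2 = "density \<pi> u"
    \<comment> \<open>\<open>half\<close> says that the densities u and Pu lead to the same measure
      after one step of P.\<close>
    have eq: "?d1 \<bind> P = ?d2 \<bind> P"
    proof (rule measure_eqI)
      show "sets (?d1 \<bind> P) = sets (?d2 \<bind> P)" using sets_bind_kernel[OF ker sd] by simp
      fix B assume "B \<in> sets (?d1 \<bind> P)"
      then have B: "B \<in> sets borel" using sets_bind_kernel[OF ker sd] by simp
      have "emeasure (density \<pi> f \<bind> P) B = (\<integral>\<^sup>+x. f x * emeasure (P x) B \<partial>\<pi>)"
        if "f \<in> borel_measurable \<pi>" for f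
        using that me[OF B] B
        by (subst emeasure_bind[OF _ prob_kernel_subprob[OF ker sd]])
          (auto simp: nn_integral_density sets_space_borel[OF pi(2)])
      then show "emeasure (?d1 \<bind> P) B = emeasure (?d2 \<bind> P) B"
        using half[OF u B] mk[OF u] mpi[OF u] by simp
    qed
    have bd: "(\<integral>\<^sup>+x. v x \<partial>(density \<pi> f \<bind> P)) = (\<integral>\<^sup>+x. f x * (\<integral>\<^sup>+y. v y \<partial>P x) \<partial>\<pi>)"
      if "f \<in> borel_measurable \<pi>" for f
      using that mk[OF v] by (subst nn_integral_bind_kernel[OF ker sd v]) (simp add: nn_integral_density)
    show ?thesis using bd[OF mk[OF u]] bd[OF mpi[OF u]] unfolding eq by simp
  qed
  have inv: "\<pi> \<bind> P = \<pi>"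
  proof (rule measure_eqI)
    show "sets (\<pi> \<bind> P) = sets \<pi>" using sets_bind_kernel[OF ker pi(2)] by (simp add: pi(2))
    fix A assume "A \<in> sets (\<pi> \<bind> P)"
    then have A: "A \<in> sets borel" using sets_bind_kernel[OF ker pi(2)] by simp
    have one: "emeasure (P x) UNIV = 1" for x
      using prob_space.emeasure_space_1[OF prob_kernelD(1)[OF ker]] by (simp add: prob_kernelD(3)[OF ker])
    have "emeasure (\<pi> \<bind> P) A = (\<integral>\<^sup>+x. emeasure (P x) A \<partial>\<pi>)"
      using A by (intro emeasure_bind[OF _ prob_kernel_subprob[OF ker pi(2)]]) (auto simp: sets_space_borel[OF pi(2)])
    also have "\<dots> = emeasure \<pi> A"
      using rectangle[OF A, of UNIV] A pi(2) by (simp add: one)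
    finally show "emeasure (\<pi> \<bind> P) A = emeasure \<pi> A" .
  qed
  show ?thesis by unfold_locales (fact pi ker inv full)+
qed

section \<open>Sweeps of projections and the Poisson equation\<close>

lemma cyc_iter_in_range: "k \<in> {1..K} \<Longrightarrow> (cyc K ^^ t) k \<in> {1..K}"
  by (induction t) (simp_all only: funpow.simps comp_apply id_apply cyc_in_range)

text \<open>Phases run from 1 to K and residues from 0 to K - 1, hence the two shifts by
  one.\<close>

lemma cyc_iter_eq:
  assumes "k \<in> {1..K}" shows "(cyc K ^^ t) k = (k - 1 + t) mod K + 1"
proof (induction t)
  case 0
  then show ?case using assms by auto
next
  case (Suc t)
  let ?j = "(k - 1 + t) mod K"
  have "?j < K" using assms by auto
  have "(cyc K ^^ Suc t) k = (if ?j + 1 < K then ?j + 1 + 1 else 1)" by (simp add: Suc cyc_def)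
  also have "\<dots> = (Suc ?j) mod K + 1" using \<open>?j < K\<close> by (auto simp: mod_Suc)
  finally show ?case by (simp add: mod_Suc_eq)
qed

lemma cyc_iter_mult: assumes "k \<in> {1..K}" shows "(cyc K ^^ (n * K)) k = k"
proof -
  have "(k - 1 + n * K) mod K = k - 1"
    using assms by (simp only: mod_mult_self1) auto
  then show ?thesis using assms by (simp only: cyc_iter_eq[OF assms]) auto
qed

lemma cyc_iter_period: "k \<in> {1..K} \<Longrightarrow> (cyc K ^^ K) k = k"
  using cyc_iter_mult[of k K 1] by simp

lemma sum_cyc: "(\<Sum>k\<in>{1..K}. f (cyc K k)) = (\<Sum>k\<in>{1..K}. f k :: 'b::comm_monoid_add)"
proof (rule sum.reindex_bij_betw)
  have "inj_on (cyc K) {1..K}" by (auto simp: inj_on_def cyc_def)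
  moreover have "cyc K ` {1..K} \<subseteq> {1..K}" using cyc_in_range by auto
  ultimately show "bij_betw (cyc K) {1..K} {1..K}"
    unfolding bij_betw_def using endo_inj_surj[of "{1..K}" "cyc K"] by blast
qed

text \<open>One coordinate of \<open>sweep_op\<close>. It is an iterated integral with default value
  0 at every level, so it is compared with integration against \<open>sweep_kernel\<close> only
  almost everywhere.\<close>

primrec sweep_iter :: "(nat \<Rightarrow> 'a \<Rightarrow> 'a measure) \<Rightarrow> nat \<Rightarrow> nat \<Rightarrow> nat \<Rightarrow> ('a \<Rightarrow> real) \<Rightarrow> 'a \<Rightarrow> real" where
  "sweep_iter P K 0 k u = u"
| "sweep_iter P K (Suc t) k u = kernel_int (P k) (sweep_iter P K t (cyc K k) u)"

lemma sweep_iter_add: "sweep_iter P K (s + t) k u = sweep_iter P K s k (sweep_iter P K t ((cyc K ^^ s) k) u)"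
  by (induction s arbitrary: k) (simp_all add: funpow_swap1)

lemma sweep_op_nth: "sweep_op P K t k g x $ i = sweep_iter P K t k (\<lambda>y. g y $ i) x"
  by (induction t arbitrary: k x) (simp_all add: kernel_op_def kernel_int_def)

locale projection_sweep = borel_prob \<pi> for \<pi> :: "'a::topological_space measure" +
  fixes P :: "nat \<Rightarrow> 'a \<Rightarrow> 'a measure" and K :: nat
  assumes K: "1 \<le> K" and proj: "\<And>k. k \<in> {1..K} \<Longrightarrow> projection_kernel \<pi> (P k)"
begin

lemma inv_ker: "k \<in> {1..K} \<Longrightarrow> invariant_kernel \<pi> (P k)"
  using proj projection_kernel_def by blast

lemma ker: "k \<in> {1..K} \<Longrightarrow> prob_kernel (P k)"
  using inv_ker invariant_kernel.ker by blast

lemma sweep_iter_L2: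
  assumes "k \<in> {1..K}" "L2 \<pi> u"
  shows "L2 \<pi> (sweep_iter P K t k u)" and "sq_norm \<pi> (sweep_iter P K t k u) \<le> sq_norm \<pi> u"
proof -
  have "L2 \<pi> (sweep_iter P K t k u) \<and> sq_norm \<pi> (sweep_iter P K t k u) \<le> sq_norm \<pi> u"
    using assms(1)
  proof (induction t arbitrary: k)
    case 0
    then show ?case using assms(2) by simp
  next
    case (Suc t)
    interpret invariant_kernel \<pi> "P k" by (rule inv_ker[OF Suc.prems])
    show ?case using Suc.IH[OF cyc_in_range[OF Suc.prems]] kernel_int_L2[of "sweep_iter P K t (cyc K k) u"] by auto
  qed
  then show "L2 \<pi> (sweep_iter P K t k u)" "sq_norm \<pi> (sweep_iter P K t k u) \<le> sq_norm \<pi> u" by auto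
qed

lemma sweep_iter_AE_cong:
  assumes "k \<in> {1..K}" "L2 \<pi> u" "L2 \<pi> v" "AE x in \<pi>. u x = v x"
  shows "AE x in \<pi>. sweep_iter P K t k u x = sweep_iter P K t k v x"
  using assms(1)
proof (induction t arbitrary: k)
  case 0
  then show ?case using assms(4) by simp
next
  case (Suc t)
  interpret invariant_kernel \<pi> "P k" by (rule inv_ker[OF Suc.prems])
  note r = cyc_in_range[OF Suc.prems]
  show ?case
    using kernel_int_AE_cong[OF L2_meas[OF sweep_iter_L2(1)[OF r assms(2)]] L2_meas[OF sweep_iter_L2(1)[OF r assms(3)]] Suc.IH[OF r]]
    by simp
qed

lemma sweep_iter_AE_lin:
  assumes "k \<in> {1..K}" "L2 \<pi> u" "L2 \<pi> v"
  shows "AE x in \<pi>. sweep_iter P K t k (\<lambda>y. u y + v y) x = sweep_iter P K t k u x + sweep_iter P K t k v x" (is ?plus)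
    and "AE x in \<pi>. sweep_iter P K t k (\<lambda>y. u y - v y) x = sweep_iter P K t k u x - sweep_iter P K t k v x" (is ?minus)
proof -
  have "?plus \<and> ?minus" using assms(1)
  proof (induction t arbitrary: k)
    case 0
    then show ?case by simp
  next
    case (Suc t)
    interpret invariant_kernel \<pi> "P k" by (rule inv_ker[OF Suc.prems])
    note r = cyc_in_range[OF Suc.prems]
    let ?a = "sweep_iter P K t (cyc K k) u" and ?b = "sweep_iter P K t (cyc K k) v"
    note a = sweep_iter_L2(1)[OF r assms(2)] and b = sweep_iter_L2(1)[OF r assms(3)]
    note ab = sweep_iter_L2(1)[OF r L2_add[OF assms(2,3)]] sweep_iter_L2(1)[OF r L2_diff[OF assms(2,3)]]
    have "AE x in \<pi>. kernel_int (P k) (sweep_iter P K t (cyc K k) (\<lambda>y. u y + v y)) x = kernel_int (P k) (\<lambda>x. ?a x + ?b x) x"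
      "AE x in \<pi>. kernel_int (P k) (sweep_iter P K t (cyc K k) (\<lambda>y. u y - v y)) x = kernel_int (P k) (\<lambda>x. ?a x - ?b x) x"
      using Suc.IH[OF r] by (intro kernel_int_AE_cong L2_meas ab L2_add L2_diff a b; blast)+
    moreover note lin = kernel_int_AE_lin[OF L2_integrable[OF a] L2_integrable[OF b]]
    ultimately have "AE x in \<pi>. kernel_int (P k) (sweep_iter P K t (cyc K k) (\<lambda>y. u y + v y)) x = kernel_int (P k) ?a x + kernel_int (P k) ?b x
      \<and> kernel_int (P k) (sweep_iter P K t (cyc K k) (\<lambda>y. u y - v y)) x = kernel_int (P k) ?a x - kernel_int (P k) ?b x"
      using lin by eventually_elim simp
    then show ?case by simp
  qed
  then show ?plus ?minus by auto
qed

text \<open>Each factor contributes a Pythagorean defect, and the defects telescope. The factor t is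
  the price of adding t vectors; in the induction it comes from the weights 1 + t and 1 + 1 / t,
  which are applied to defects with the constants 1 and t.\<close>

lemma sweep_iter_defect:
  assumes "k \<in> {1..K}" "L2 \<pi> u"
  shows "sq_norm \<pi> (\<lambda>x. sweep_iter P K t k u x - u x) \<le> real t * (sq_norm \<pi> u - sq_norm \<pi> (sweep_iter P K t k u))"
  using assms(1)
proof (induction t arbitrary: k)
  case 0
  then show ?case by (simp add: sq_norm_def)
next
  case (Suc t)
  interpret projection_kernel \<pi> "P k" by (rule proj[OF Suc.prems])
  note r = cyc_in_range[OF Suc.prems]
  define y where "y = sweep_iter P K t (cyc K k) u"
  have y: "L2 \<pi> y" unfolding y_def by (rule sweep_iter_L2(1)[OF r assms(2)])
  have d: "sq_norm \<pi> (\<lambda>x. kernel_int (P k) y x - y x) = sq_norm \<pi> y - sq_norm \<pi> (kernel_int (P k) y)"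
    by (rule projection_defect[OF y])
  have IH: "sq_norm \<pi> (\<lambda>x. y x - u x) \<le> real t * (sq_norm \<pi> u - sq_norm \<pi> y)"
    unfolding y_def by (rule Suc.IH[OF r])
  show ?case
  proof (cases "t = 0")
    case True
    then show ?thesis using d by (simp add: y_def)
  next
    case False
    have "sq_norm \<pi> (\<lambda>x. (kernel_int (P k) y x - y x) + (y x - u x))
        \<le> (1 + real t) * sq_norm \<pi> (\<lambda>x. kernel_int (P k) y x - y x) + (1 + 1 / real t) * sq_norm \<pi> (\<lambda>x. y x - u x)"
      using False by (intro sq_norm_add_le L2_diff kernel_int_L2 y assms) auto
    also have "\<dots> \<le> (1 + real t) * (sq_norm \<pi> y - sq_norm \<pi> (kernel_int (P k) y)) + (1 + 1 / real t) * (real t * (sq_norm \<pi> u - sq_norm \<pi> y))"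
      unfolding d by (intro add_left_mono mult_left_mono IH) auto
    also have "\<dots> = real (Suc t) * (sq_norm \<pi> u - sq_norm \<pi> (kernel_int (P k) y))"
      using False by (simp add: field_simps)
    finally show ?thesis by (simp add: y_def)
  qed
qed

lemma sweep_kernel_prob: "k \<in> {1..K} \<Longrightarrow> prob_kernel (sweep_kernel P K t k)"
  by (rule sweep_kernel_measurable[OF ker])

lemma sweep_kernel_invariant: "k \<in> {1..K} \<Longrightarrow> invariant_kernel \<pi> (sweep_kernel P K t k)"
proof (induction t arbitrary: k)
  case 0
  have "\<pi> \<bind> return borel = \<pi> \<bind> return \<pi>"
    by (intro bind_cong refl return_cong) (simp add: sets_pi)
  then have "\<pi> \<bind> return borel = \<pi>" by (simp add: bind_return')
  then show ?case using sweep_kernel_prob[OF 0, of 0] by unfold_locales auto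
next
  case (Suc t)
  interpret a: invariant_kernel \<pi> "P k" by (rule inv_ker[OF Suc.prems])
  interpret b: invariant_kernel \<pi> "sweep_kernel P K t (cyc K k)"
    by (rule Suc.IH[OF cyc_in_range[OF Suc.prems]])
  have "\<pi> \<bind> (\<lambda>x. P k x \<bind> sweep_kernel P K t (cyc K k)) = (\<pi> \<bind> P k) \<bind> sweep_kernel P K t (cyc K k)"
    by (rule bind_assoc[symmetric, OF prob_kernel_subprob[OF a.ker sets_pi] prob_kernelD(4)[OF b.ker]])
  then have "\<pi> \<bind> sweep_kernel P K (Suc t) k = \<pi>"
    by (simp add: a.invariant b.invariant)
  then show ?case using sweep_kernel_prob[OF Suc.prems, of "Suc t"] by unfold_locales
qed

lemma sweep_kernel_add:
  assumes "k \<in> {1..K}"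
  shows "sweep_kernel P K (s + t) k x = sweep_kernel P K s k x \<bind> sweep_kernel P K t ((cyc K ^^ s) k)"
  using assms
proof (induction s arbitrary: k x)
  case 0
  show ?case
    using prob_kernelD(4)[OF sweep_kernel_prob[OF 0]] by (simp add: bind_return[where N=borel])
next
  case (Suc s)
  note r = cyc_in_range[OF Suc.prems]
  have "sweep_kernel P K (s + t) (cyc K k)
      = (\<lambda>x. sweep_kernel P K s (cyc K k) x \<bind> sweep_kernel P K t ((cyc K ^^ s) (cyc K k)))"
    using Suc.IH[OF r] by auto
  then show ?case
    using prob_kernel_subprob[OF sweep_kernel_prob[OF r] prob_kernelD(2)[OF ker[OF Suc.prems]]]
      prob_kernelD(4)[OF sweep_kernel_prob[OF cyc_iter_in_range[OF r]]]
    by (simp add: bind_assoc[where N=borel and R=borel] funpow_swap1)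
qed

lemma kernel_power_sweep:
  assumes "k \<in> {1..K}"
  shows "kernel_power (sweep_kernel P K K k) j x = sweep_kernel P K (j * K) k x"
proof (induction j arbitrary: x)
  case 0
  then show ?case by simp
next
  case (Suc j)
  then have "kernel_power (sweep_kernel P K K k) j = sweep_kernel P K (j * K) k" by auto
  then show ?case
    using sweep_kernel_add[OF assms, of K "j * K" x] by (simp add: cyc_iter_period[OF assms])
qed

text \<open>Where u is not integrable under the composed kernel the iterated integral may have a
  different value, so Fubini gives equality only pi-almost everywhere; invariance of pi keeps the
  exceptional sets null from step to step.\<close>

lemma sweep_iter_AE_sweep_kernel:
  assumes "k \<in> {1..K}" "L2 \<pi> u"
  shows "AE x in \<pi>. kernel_int (sweep_kernel P K t k) u x = sweep_iter P K t k u x"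
  using assms(1)
proof (induction t arbitrary: k)
  case 0
  then show ?case using L2_meas[OF assms(2)] by (simp add: kernel_int_def integral_return)
next
  case (Suc t)
  note r = cyc_in_range[OF Suc.prems]
  interpret a: invariant_kernel \<pi> "P k" by (rule inv_ker[OF Suc.prems])
  interpret b: invariant_kernel \<pi> "sweep_kernel P K t (cyc K k)" by (rule sweep_kernel_invariant[OF r])
  interpret c: invariant_kernel \<pi> "sweep_kernel P K (Suc t) k" by (rule sweep_kernel_invariant[OF Suc.prems])
  have "AE x in \<pi>. kernel_int (sweep_kernel P K (Suc t) k) u x = kernel_int (P k) (kernel_int (sweep_kernel P K t (cyc K k)) u) x"
    using c.integrable_kernel(1)[OF L2_integrable[OF assms(2)]]
  proof eventually_elim
    case (elim x)
    then show ?case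
      using integrable_bind_kernel(3)[OF b.ker prob_kernelD(2)[OF a.ker], of x u]
      by (simp add: kernel_int_def[abs_def])
  qed
  moreover have "AE x in \<pi>. kernel_int (P k) (kernel_int (sweep_kernel P K t (cyc K k)) u) x = sweep_iter P K (Suc t) k u x"
    unfolding sweep_iter.simps
    by (intro a.kernel_int_AE_cong b.kernel_int_meas L2_meas assms sweep_iter_L2 r Suc.IH)
  ultimately show ?case by (auto elim: eventually_elim2)
qed

text \<open>T^n u is the increment T^n v - T^(n + 1) v, whose squared norm is at most K times the
  drop in the squared norms of the T^n v. These norms decrease and hence converge, so the drops
  vanish; no spectral gap in L2(pi) enters and no rate results.\<close>

lemma cesaro_N2_limit:
  assumes k: "k \<in> {1..K}" and v: "L2 \<pi> v" and u: "L2 \<pi> u"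
    and eq: "AE x in \<pi>. u x = v x - sweep_iter P K K k v x"
  shows "(\<lambda>n. sq_norm \<pi> (sweep_iter P K (n * K) k u)) \<longlonglongrightarrow> 0"
proof -
  define a where "a n = sq_norm \<pi> (sweep_iter P K (n * K) k v)" for n
  have step: "sweep_iter P K K k (sweep_iter P K (n * K) k w) = sweep_iter P K (Suc n * K) k w" for n w
    using sweep_iter_add[of P K K "n * K" k w] by (simp add: cyc_iter_period[OF k])
  have L: "L2 \<pi> (sweep_iter P K t k v)" for t by (rule sweep_iter_L2(1)[OF k v])
  have "a (Suc n) \<le> a n" for n
    unfolding a_def step[symmetric] by (rule sweep_iter_L2(2)[OF k L])
  then have "decseq a" by (rule decseq_SucI)
  then obtain l where l: "a \<longlonglongrightarrow> l"
    by (rule decseq_convergent[of a 0]) (auto simp: a_def sq_norm_nonneg)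
  have lim: "(\<lambda>n. real K * (a n - a (Suc n))) \<longlonglongrightarrow> real K * (l - l)"
    by (intro tendsto_intros l LIMSEQ_Suc)
  have "sq_norm \<pi> (sweep_iter P K (n * K) k u) \<le> real K * (a n - a (Suc n))" for n
  proof -
    have "AE x in \<pi>. sweep_iter P K (n * K) k u x = sweep_iter P K (n * K) k (\<lambda>x. v x - sweep_iter P K K k v x) x"
      by (intro sweep_iter_AE_cong k u L2_diff v L eq)
    moreover have "AE x in \<pi>. sweep_iter P K (n * K) k (\<lambda>x. v x - sweep_iter P K K k v x) x
        = sweep_iter P K (n * K) k v x - sweep_iter P K (n * K) k (sweep_iter P K K k v) x"
      by (rule sweep_iter_AE_lin(2)[OF k v L])
    moreover have "sweep_iter P K (n * K) k (sweep_iter P K K k v) = sweep_iter P K (Suc n * K) k v"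
      using sweep_iter_add[of P K "n * K" K k v] by (simp add: cyc_iter_mult[OF k] add.commute)
    ultimately have "AE x in \<pi>. sweep_iter P K (n * K) k u x
        = - 1 * (sweep_iter P K K k (sweep_iter P K (n * K) k v) x - sweep_iter P K (n * K) k v x)"
      unfolding step by (auto elim: eventually_elim2)
    then have "sq_norm \<pi> (sweep_iter P K (n * K) k u)
        = sq_norm \<pi> (\<lambda>x. - 1 * (sweep_iter P K K k (sweep_iter P K (n * K) k v) x - sweep_iter P K (n * K) k v x))"
      using L by (intro sq_norm_cong_AE L2_meas L2_cmult L2_diff sweep_iter_L2(1) k u v)
    also have "\<dots> = sq_norm \<pi> (\<lambda>x. sweep_iter P K K k (sweep_iter P K (n * K) k v) x - sweep_iter P K (n * K) k v x)"
      by (simp only: sq_norm_def power_mult_distrib) simp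
    also have "\<dots> \<le> real K * (sq_norm \<pi> (sweep_iter P K (n * K) k v) - sq_norm \<pi> (sweep_iter P K K k (sweep_iter P K (n * K) k v)))"
      by (rule sweep_iter_defect[OF k L])
    finally show ?thesis by (simp only: step a_def)
  qed
  then have le: "\<forall>\<^sub>F n in sequentially. sq_norm \<pi> (sweep_iter P K (n * K) k u) \<le> real K * (a n - a (Suc n))"
    by (intro always_eventually allI)
  have lim0: "(\<lambda>n. real K * (a n - a (Suc n))) \<longlonglongrightarrow> 0" using lim by simp
  show ?thesis
    by (rule tendsto_sandwich[OF always_eventually le tendsto_const lim0]) (intro allI sq_norm_nonneg)
qed

end

context invariant_kernel begin

lemma kernel_int_AE_sum:
  assumes "finite I" "\<And>i. i \<in> I \<Longrightarrow> integrable \<pi> (u i)"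
  shows "AE x in \<pi>. kernel_int P (\<lambda>y. \<Sum>i\<in>I. u i y) x = (\<Sum>i\<in>I. kernel_int P (u i) x)"
proof -
  have "AE x in \<pi>. \<forall>i\<in>I. integrable (P x) (u i)"
    using assms integrable_kernel(1) by (intro AE_finite_allI) auto
  then show ?thesis by eventually_elim (simp add: kernel_int_def)
qed

end

context borel_prob begin

lemma sq_norm_sum_tendsto_0:
  assumes "finite I" "\<And>i n. i \<in> I \<Longrightarrow> L2 \<pi> (w i n)" "\<And>i. i \<in> I \<Longrightarrow> (\<lambda>n. sq_norm \<pi> (w i n)) \<longlonglongrightarrow> 0"
  shows "(\<lambda>n. sq_norm \<pi> (\<lambda>x. \<Sum>i\<in>I. w i n x)) \<longlonglongrightarrow> 0"
  using assms
proof (induction I rule: finite_induct)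
  case empty
  then show ?case by (simp add: sq_norm_def)
next
  case (insert i I)
  have IH: "(\<lambda>n. sq_norm \<pi> (\<lambda>x. \<Sum>i\<in>I. w i n x)) \<longlonglongrightarrow> 0"
    using insert by auto
  have le: "sq_norm \<pi> (\<lambda>x. \<Sum>i\<in>insert i I. w i n x) \<le> 2 * sq_norm \<pi> (w i n) + 2 * sq_norm \<pi> (\<lambda>x. \<Sum>i\<in>I. w i n x)" for n
    using sq_norm_add_le[of "w i n" "\<lambda>x. \<Sum>i\<in>I. w i n x" 1] insert by (simp add: L2_sum)
  have lim: "(\<lambda>n. 2 * sq_norm \<pi> (w i n) + 2 * sq_norm \<pi> (\<lambda>x. \<Sum>i\<in>I. w i n x)) \<longlonglongrightarrow> 0"
    by (rule tendsto_eq_rhs[OF tendsto_add[OF tendsto_mult_left tendsto_mult_left[OF IH]]])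
      (use insert in auto)
  show ?case
    by (rule tendsto_sandwich[OF always_eventually always_eventually tendsto_const lim])
      (intro allI sq_norm_nonneg le)+
qed

lemma L2_tendsto_integral:
  assumes h: "L2 \<pi> h" and w: "\<And>n. L2 \<pi> (w n)" and lim: "(\<lambda>n. sq_norm \<pi> (w n)) \<longlonglongrightarrow> 0"
  shows "(\<lambda>n. LINT x|\<pi>. h x * w n x) \<longlonglongrightarrow> 0"
proof -
  have "(\<lambda>n. sqrt (sq_norm \<pi> h * sq_norm \<pi> (w n))) \<longlonglongrightarrow> sqrt (sq_norm \<pi> h * 0)"
    by (intro tendsto_intros lim)
  then have lim': "(\<lambda>n. sqrt (sq_norm \<pi> h * sq_norm \<pi> (w n))) \<longlonglongrightarrow> 0" by simp
  have "norm (LINT x|\<pi>. h x * w n x) \<le> sqrt (sq_norm \<pi> h * sq_norm \<pi> (w n))" for n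
    using real_le_rsqrt[of "\<bar>LINT x|\<pi>. h x * w n x\<bar>"] Cauchy_Schwarz[OF h w, of n] by simp
  then show ?thesis by (intro Lim_null_comparison[OF always_eventually lim']) blast
qed

end

context projection_sweep begin

lemma sweep_iter_AE_sum:
  assumes k: "k \<in> {1..K}" and "finite I" "\<And>i. i \<in> I \<Longrightarrow> L2 \<pi> (u i)"
  shows "AE x in \<pi>. sweep_iter P K t k (\<lambda>y. \<Sum>i\<in>I. u i y) x = (\<Sum>i\<in>I. sweep_iter P K t k (u i) x)"
  using assms(2,3)
proof (induction I rule: finite_induct)
  case empty
  have "sweep_iter P K t k (\<lambda>y. 0) x = 0" for x
    by (induction t arbitrary: k x) (simp_all add: kernel_int_def)
  then show ?case by simp
next
  case (insert i I)
  have "AE x in \<pi>. sweep_iter P K t k (\<lambda>y. u i y + (\<Sum>i\<in>I. u i y)) x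
      = sweep_iter P K t k (u i) x + sweep_iter P K t k (\<lambda>y. \<Sum>i\<in>I. u i y) x"
    using insert by (intro sweep_iter_AE_lin(1) k L2_sum) auto
  moreover have "AE x in \<pi>. sweep_iter P K t k (\<lambda>y. \<Sum>i\<in>I. u i y) x = (\<Sum>i\<in>I. sweep_iter P K t k (u i) x)"
    using insert by auto
  ultimately show ?case by eventually_elim (simp add: insert)
qed

definition cycle_sum :: "(nat \<Rightarrow> 'a \<Rightarrow> real) \<Rightarrow> nat \<Rightarrow> 'a \<Rightarrow> real" where
  "cycle_sum u k x = (\<Sum>r<K. sweep_iter P K r k (u ((cyc K ^^ r) k)) x)"

lemma cycle_sum_L2:
  assumes "\<And>k. k \<in> {1..K} \<Longrightarrow> L2 \<pi> (u k)" "k \<in> {1..K}"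
  shows "L2 \<pi> (cycle_sum u k)"
  unfolding cycle_sum_def[abs_def] by (intro L2_sum sweep_iter_L2(1) assms cyc_iter_in_range)

text \<open>Applying Pi_k raises each index r by one, so only r = 0 and r = K survive the
  subtraction. Since the phase returns to k after K steps, what is left is the K-step equation at
  phase k alone.\<close>

lemma cycle_sum_poisson:
  assumes u: "\<And>k. k \<in> {1..K} \<Longrightarrow> L2 \<pi> (u k)" and k: "k \<in> {1..K}"
    and eq: "AE x in \<pi>. u k x - sweep_iter P K K k (u k) x = f x"
  shows "AE x in \<pi>. cycle_sum u k x - kernel_int (P k) (cycle_sum u (cyc K k)) x = f x"
proof -
  interpret invariant_kernel \<pi> "P k" by (rule inv_ker[OF k])
  let ?a = "\<lambda>r. sweep_iter P K r k (u ((cyc K ^^ r) k))"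
  have "AE x in \<pi>. kernel_int (P k) (cycle_sum u (cyc K k)) x
      = (\<Sum>r<K. kernel_int (P k) (sweep_iter P K r (cyc K k) (u ((cyc K ^^ r) (cyc K k)))) x)"
    unfolding cycle_sum_def[abs_def]
    by (intro kernel_int_AE_sum L2_integrable sweep_iter_L2(1) u cyc_iter_in_range cyc_in_range k) auto
  then show ?thesis using eq
  proof eventually_elim
    case (elim x)
    have "kernel_int (P k) (cycle_sum u (cyc K k)) x = (\<Sum>r<K. ?a (Suc r) x)"
      unfolding elim(1) by (simp add: funpow_swap1)
    then have "cycle_sum u k x - kernel_int (P k) (cycle_sum u (cyc K k)) x = (\<Sum>r<K. ?a r x - ?a (Suc r) x)"
      by (simp only: cycle_sum_def sum_subtractf)
    also have "\<dots> = ?a 0 x - ?a K x" by (rule sum_lessThan_telescope')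
    finally show ?case using elim(2) by (simp add: cyc_iter_period[OF k])
  qed
qed

text \<open>Write t = s + n * K with s < K. The s outer steps are contractions and lead from phase k
  to phase j, where the hypothesis on multiples of K applies; summing over all phases makes the
  bound independent of j.\<close>

lemma sweep_iter_N2_tendsto_0:
  assumes k: "k \<in> {1..K}" and u: "\<And>k. k \<in> {1..K} \<Longrightarrow> L2 \<pi> (u k)"
    and lim: "\<And>k. k \<in> {1..K} \<Longrightarrow> (\<lambda>n. sq_norm \<pi> (sweep_iter P K (n * K) k (u k))) \<longlonglongrightarrow> 0"
  shows "(\<lambda>t. sq_norm \<pi> (sweep_iter P K t k (u ((cyc K ^^ t) k)))) \<longlonglongrightarrow> 0"
proof -
  let ?b = "\<lambda>n. \<Sum>j\<in>{1..K}. sq_norm \<pi> (sweep_iter P K (n * K) j (u j))"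
  have "?b \<longlonglongrightarrow> (\<Sum>j\<in>{1..K}. 0)" by (intro tendsto_sum lim)
  then have b: "?b \<longlonglongrightarrow> 0" by simp
  have "filterlim (\<lambda>t. t div K) sequentially sequentially"
    unfolding filterlim_at_top
  proof
    fix Z
    show "\<forall>\<^sub>F t in sequentially. Z \<le> t div K"
      using K by (intro eventually_sequentiallyI[of "Z * K"]) (simp add: less_eq_div_iff_mult_less_eq)
  qed
  then have lim': "(\<lambda>t. ?b (t div K)) \<longlonglongrightarrow> 0" by (rule filterlim_compose[OF b])
  have "sq_norm \<pi> (sweep_iter P K t k (u ((cyc K ^^ t) k))) \<le> ?b (t div K)" for t
  proof -
    define s n j where "s = t mod K" and "n = t div K" and "j = (cyc K ^^ s) k"
    have t: "t = s + n * K" by (simp add: s_def n_def)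
    have j: "j \<in> {1..K}" unfolding j_def by (rule cyc_iter_in_range[OF k])
    have "(cyc K ^^ t) k = (cyc K ^^ (n * K)) j"
      unfolding t j_def by (metis add.commute comp_apply funpow_add)
    then have cj: "(cyc K ^^ t) k = j" by (simp add: cyc_iter_mult[OF j])
    have "sweep_iter P K t k (u j) = sweep_iter P K s k (sweep_iter P K (n * K) j (u j))"
      unfolding t sweep_iter_add j_def ..
    then have "sq_norm \<pi> (sweep_iter P K t k (u j)) \<le> sq_norm \<pi> (sweep_iter P K (n * K) j (u j))"
      using sweep_iter_L2(2)[OF k sweep_iter_L2(1)[OF j u[OF j]]] by simp
    also have "\<dots> \<le> ?b n" by (rule member_le_sum[OF j sq_norm_nonneg]) simp
    finally show ?thesis by (simp add: cj n_def)
  qed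
  then show ?thesis
    by (intro tendsto_sandwich[OF always_eventually always_eventually tendsto_const lim'] allI sq_norm_nonneg)
qed

lemma cycle_sum_telescope:
  assumes V: "\<And>k. k \<in> {1..K} \<Longrightarrow> L2 \<pi> (V k)" and f: "\<And>k. k \<in> {1..K} \<Longrightarrow> L2 \<pi> (f k)"
    and eq: "\<And>k. k \<in> {1..K} \<Longrightarrow> AE x in \<pi>. V k x - kernel_int (P k) (V (cyc K k)) x = f k x"
    and k: "k \<in> {1..K}"
  shows "AE x in \<pi>. V k x = (\<Sum>t<n. sweep_iter P K t k (f ((cyc K ^^ t) k)) x) + sweep_iter P K n k (V ((cyc K ^^ n) k)) x"
proof (induction n)
  case 0
  show ?case by simp
next
  case (Suc n)
  define j where "j = (cyc K ^^ n) k"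
  have j: "j \<in> {1..K}" unfolding j_def by (rule cyc_iter_in_range[OF k])
  interpret invariant_kernel \<pi> "P j" by (rule inv_ker[OF j])
  let ?W = "kernel_int (P j) (V (cyc K j))"
  have W: "L2 \<pi> ?W" by (intro kernel_int_L2 V cyc_in_range j)
  have "AE x in \<pi>. V j x = f j x + ?W x" using eq[OF j] by eventually_elim simp
  then have "AE x in \<pi>. sweep_iter P K n k (V j) x = sweep_iter P K n k (\<lambda>x. f j x + ?W x) x"
    by (intro sweep_iter_AE_cong k V j L2_add f W)
  moreover have "AE x in \<pi>. sweep_iter P K n k (\<lambda>x. f j x + ?W x) x = sweep_iter P K n k (f j) x + sweep_iter P K n k ?W x"
    by (rule sweep_iter_AE_lin(1)[OF k f[OF j] W])
  moreover note Suc[folded j_def]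
  ultimately have e: "AE x in \<pi>. V k x = (\<Sum>t<n. sweep_iter P K t k (f ((cyc K ^^ t) k)) x)
      + (sweep_iter P K n k (f j) x + sweep_iter P K n k ?W x)"
    by eventually_elim (simp only:)
  have W_eq: "sweep_iter P K n k ?W = sweep_iter P K (Suc n) k (V ((cyc K ^^ Suc n) k))"
    using sweep_iter_add[of P K n 1 k] by (simp add: j_def)
  show ?case using e unfolding W_eq by (simp only: sum.lessThan_Suc j_def add.assoc)
qed

text \<open>The remainder after n terms is P_k^n applied to a cycle sum, hence a sum of K terms
  P_k^t u, each tending to 0 in L2(pi) because u is of the form v - T v. Pairing with h in L2 is
  what the entries of the covariance series require.\<close>

lemma cycle_sum_sums:
  assumes f: "\<And>k. k \<in> {1..K} \<Longrightarrow> L2 \<pi> (f k)" and u: "\<And>k. k \<in> {1..K} \<Longrightarrow> L2 \<pi> (u k)"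
    and v: "\<And>k. k \<in> {1..K} \<Longrightarrow> L2 \<pi> (v k)"
    and uf: "\<And>k. k \<in> {1..K} \<Longrightarrow> AE x in \<pi>. u k x - sweep_iter P K K k (u k) x = f k x"
    and vu: "\<And>k. k \<in> {1..K} \<Longrightarrow> AE x in \<pi>. v k x - sweep_iter P K K k (v k) x = u k x"
    and k: "k \<in> {1..K}" and h: "L2 \<pi> h"
  shows "(\<lambda>t. LINT x|\<pi>. h x * sweep_iter P K t k (f ((cyc K ^^ t) k)) x) sums (LINT x|\<pi>. h x * cycle_sum u k x)"
proof -
  let ?V = "cycle_sum u"
  have V: "L2 \<pi> (?V j)" if "j \<in> {1..K}" for j by (rule cycle_sum_L2[OF u that])
  have eq: "AE x in \<pi>. ?V j x - kernel_int (P j) (?V (cyc K j)) x = f j x" if "j \<in> {1..K}" for j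
    by (rule cycle_sum_poisson[where u=u and k=j and f="f j", OF u that uf[OF that]])
  have ulim: "(\<lambda>n. sq_norm \<pi> (sweep_iter P K (n * K) j (u j))) \<longlonglongrightarrow> 0" if "j \<in> {1..K}" for j
    by (rule cesaro_N2_limit[OF that v[OF that] u[OF that]]) (use vu[OF that] in eventually_elim, simp)
  define R where "R n = sweep_iter P K n k (?V ((cyc K ^^ n) k))" for n
  have RL: "L2 \<pi> (R n)" for n unfolding R_def by (intro sweep_iter_L2(1) k V cyc_iter_in_range)
  have "(\<lambda>n. sq_norm \<pi> (R n)) \<longlonglongrightarrow> 0"
  proof -
    let ?w = "\<lambda>r n. sweep_iter P K (n + r) k (u ((cyc K ^^ (n + r)) k))"
    have "AE x in \<pi>. R n x = (\<Sum>r<K. ?w r n x)" for n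
    proof -
      let ?j = "(cyc K ^^ n) k"
      have "AE x in \<pi>. sweep_iter P K n k (\<lambda>x. \<Sum>r<K. sweep_iter P K r ?j (u ((cyc K ^^ r) ?j)) x) x
          = (\<Sum>r<K. sweep_iter P K n k (sweep_iter P K r ?j (u ((cyc K ^^ r) ?j))) x)"
        by (intro sweep_iter_AE_sum k sweep_iter_L2(1) u cyc_iter_in_range) auto
      moreover have "sweep_iter P K n k (sweep_iter P K r ?j (u ((cyc K ^^ r) ?j))) = ?w r n" for r
      proof -
        have "(cyc K ^^ r) ?j = (cyc K ^^ (n + r)) k" by (metis add.commute comp_apply funpow_add)
        then show ?thesis by (simp add: sweep_iter_add)
      qed
      ultimately show ?thesis by (simp add: R_def cycle_sum_def[abs_def])
    qed
    then have e: "sq_norm \<pi> (R n) = sq_norm \<pi> (\<lambda>x. \<Sum>r<K. ?w r n x)" for n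
      by (intro sq_norm_cong_AE L2_meas RL L2_sum sweep_iter_L2(1) k u cyc_iter_in_range)
    have "(\<lambda>n. sq_norm \<pi> (\<lambda>x. \<Sum>r<K. ?w r n x)) \<longlonglongrightarrow> 0"
    proof (rule sq_norm_sum_tendsto_0)
      fix r
      show "(\<lambda>n. sq_norm \<pi> (?w r n)) \<longlonglongrightarrow> 0"
        using LIMSEQ_ignore_initial_segment[OF sweep_iter_N2_tendsto_0[OF k u ulim], of r] by simp
    qed (auto intro!: sweep_iter_L2(1) k u cyc_iter_in_range simp del: atLeastAtMost_iff)
    then show ?thesis by (simp add: e)
  qed
  then have lim: "(\<lambda>n. LINT x|\<pi>. h x * R n x) \<longlonglongrightarrow> 0"
    by (rule L2_tendsto_integral[OF h RL])
  have "(\<Sum>t<n. LINT x|\<pi>. h x * sweep_iter P K t k (f ((cyc K ^^ t) k)) x)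
      = (LINT x|\<pi>. h x * ?V k x) - (LINT x|\<pi>. h x * R n x)" for n
  proof -
    let ?a = "\<lambda>t. sweep_iter P K t k (f ((cyc K ^^ t) k))"
    have a: "L2 \<pi> (?a t)" for t by (intro sweep_iter_L2(1) k f cyc_iter_in_range)
    have "(LINT x|\<pi>. h x * ?V k x) = (LINT x|\<pi>. h x * ((\<Sum>t<n. ?a t x) + R n x))"
    proof (rule integral_cong_AE)
      have m: "(\<lambda>x. (\<Sum>t<n. ?a t x) + R n x) \<in> borel_measurable \<pi>"
        by (intro meas_pi L2_meas L2_add L2_sum a RL)
      show "(\<lambda>x. h x * ((\<Sum>t<n. ?a t x) + R n x)) \<in> borel_measurable \<pi>"
        using m meas_pi[OF L2_meas[OF h]] by simp
      show "(\<lambda>x. h x * ?V k x) \<in> borel_measurable \<pi>"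
        using meas_pi[OF L2_meas[OF h]] meas_pi[OF L2_meas[OF V[OF k]]] by simp
      show "AE x in \<pi>. h x * ?V k x = h x * ((\<Sum>t<n. ?a t x) + R n x)"
      proof -
        have "AE x in \<pi>. ?V k x = (\<Sum>t<n. ?a t x) + sweep_iter P K n k (?V ((cyc K ^^ n) k)) x"
          by (intro cycle_sum_telescope V f eq k)
        then show ?thesis by eventually_elim (simp add: R_def)
      qed
    qed
    also have "\<dots> = (LINT x|\<pi>. (\<Sum>t<n. h x * ?a t x) + h x * R n x)"
      by (simp add: distrib_left sum_distrib_left)
    also have "\<dots> = (\<Sum>t<n. LINT x|\<pi>. h x * ?a t x) + (LINT x|\<pi>. h x * R n x)"
      using a h RL by (simp add: L2_mult)
    finally show ?thesis by simp
  qed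
  then have e: "(\<lambda>n. \<Sum>t<n. LINT x|\<pi>. h x * sweep_iter P K t k (f ((cyc K ^^ t) k)) x)
      = (\<lambda>n. (LINT x|\<pi>. h x * ?V k x) - (LINT x|\<pi>. h x * R n x))" by (rule ext)
  have "(\<lambda>n. (LINT x|\<pi>. h x * ?V k x) - (LINT x|\<pi>. h x * R n x)) \<longlonglongrightarrow> (LINT x|\<pi>. h x * ?V k x) - 0"
    by (intro tendsto_diff tendsto_const lim)
  then show ?thesis unfolding sums_def e by simp
qed

end

section \<open>The central limit theorem for sweeps\<close>

text \<open>The integrand depends on the starting point as well as on the endpoint; nonnegativity
  reduces the claim to joint measurability for nonnegative integrals.\<close>

lemma kernel_integral_measurable2:
  fixes g :: "'a::topological_space \<Rightarrow> 'a \<Rightarrow> real"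
  assumes P: "prob_kernel P" and g: "(\<lambda>(x, y). g x y) \<in> borel_measurable (borel \<Otimes>\<^sub>M borel)"
    and pos: "\<And>x y. 0 \<le> g x y"
  shows "(\<lambda>x. LINT y|P x. g x y) \<in> borel_measurable borel"
proof -
  have m: "g x \<in> borel_measurable (P x)" for x
  proof -
    have "(\<lambda>y. (\<lambda>(x, y). g x y) (x, y)) \<in> borel_measurable borel"
      by (rule measurable_compose[OF _ g]) simp
    then show ?thesis using borel_measurable_kernel[OF P] by simp
  qed
  have "(\<lambda>x. \<integral>\<^sup>+y. ennreal (g x y) \<partial>P x) \<in> borel_measurable borel"
    by (rule nn_integral_measurable_subprob_algebra2[OF _ prob_kernelD(4)[OF P]]) (use g in measurable)
  then have "(\<lambda>x. enn2real (\<integral>\<^sup>+y. ennreal (g x y) \<partial>P x)) \<in> borel_measurable borel" by simp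
  then show ?thesis by (subst integral_eq_nn_integral) (auto simp: m pos)
qed

text \<open>Remainder of the second-order Taylor expansion. Of its two bounds below, the quadratic
  one supplies an integrable dominating function under second moments alone, the cubic one the
  pointwise limit.\<close>

definition iexp_rem :: "real \<Rightarrow> complex" where
  "iexp_rem z = iexp z - (1 + \<i> * of_real z - of_real (z\<^sup>2) / 2)"

lemma iexp_rem_le: "cmod (iexp_rem z) \<le> z\<^sup>2" "cmod (iexp_rem z) \<le> \<bar>z\<bar> ^ 3 / 6"
proof -
  have s: "(\<Sum>k\<le>2. (\<i> * complex_of_real z) ^ k / fact k) = 1 + \<i> * of_real z - of_real (z\<^sup>2) / 2"
    by (simp add: numeral_2_eq_2 power_mult_distrib power2_eq_square)
  show "cmod (iexp_rem z) \<le> z\<^sup>2"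
    using iexp_approx2[of z 2] unfolding s iexp_rem_def by simp
  show "cmod (iexp_rem z) \<le> \<bar>z\<bar> ^ 3 / 6"
    using iexp_approx1[of z 2] unfolding s iexp_rem_def by (simp add: fact_numeral numeral_3_eq_3)
qed

lemma iexp_rem_measurable [measurable]: "iexp_rem \<in> borel_measurable borel"
  unfolding iexp_rem_def[abs_def] by measurable

lemma cmod_iexp_minus_1_le: "cmod (iexp z - 1) \<le> 2" "cmod (iexp z - 1) \<le> \<bar>z\<bar>"
  using norm_triangle_ineq4[of "iexp z" 1] iexp_approx1[of z 0] by simp_all

definition kernel_cint :: "('a \<Rightarrow> 'a measure) \<Rightarrow> ('a \<Rightarrow> complex) \<Rightarrow> 'a \<Rightarrow> complex" where
  "kernel_cint P u x = (CLINT y|P x. u y)"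

context invariant_kernel begin

lemma kernel_cint_meas: "u \<in> borel_measurable borel \<Longrightarrow> kernel_cint P u \<in> borel_measurable borel"
  unfolding kernel_cint_def[abs_def] by (rule measurable_kernel_integral[OF ker])

lemma cmeas_pi: "u \<in> borel_measurable borel \<Longrightarrow> (u :: 'a \<Rightarrow> complex) \<in> borel_measurable \<pi>"
  using measurable_cong_sets[OF sets_pi refl] by blast

lemma kernel_cint_contraction:
  assumes m: "u \<in> borel_measurable borel" and i: "integrable \<pi> u"
  shows "AE x in \<pi>. integrable (P x) u" "integrable \<pi> (kernel_cint P u)"
    "(LINT x|\<pi>. cmod (kernel_cint P u x)) \<le> (LINT x|\<pi>. cmod (u x))"
proof -
  have n: "integrable \<pi> (\<lambda>x. cmod (u x))" using i by simp
  have mP: "u \<in> borel_measurable (P x)" for x by (rule borel_measurable_kernel[OF ker m])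
  show "AE x in \<pi>. integrable (P x) u"
    using integrable_kernel(1)[OF n] by eventually_elim (use mP in \<open>simp add: integrable_norm_iff\<close>)
  have le: "cmod (kernel_cint P u x) \<le> kernel_int P (\<lambda>y. cmod (u y)) x" for x
    unfolding kernel_cint_def kernel_int_def by (rule integral_norm_bound)
  show ic: "integrable \<pi> (kernel_cint P u)"
    by (rule Bochner_Integration.integrable_bound[OF integrable_kernel(2)[OF n]])
      (use cmeas_pi[OF kernel_cint_meas[OF m]] in \<open>auto intro!: AE_I2 order_trans[OF le abs_ge_self]\<close>)
  have "(LINT x|\<pi>. cmod (kernel_cint P u x)) \<le> (LINT x|\<pi>. kernel_int P (\<lambda>y. cmod (u y)) x)"
    using ic by (intro integral_mono integrable_kernel(2) n le) auto
  then show "(LINT x|\<pi>. cmod (kernel_cint P u x)) \<le> (LINT x|\<pi>. cmod (u x))"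
    by (simp add: integrable_kernel(3)[OF n])
qed

text \<open>For V in L2(pi), the variance of V under P(x, .) for pi-almost every x.\<close>

definition kernel_var :: "('a \<Rightarrow> real) \<Rightarrow> 'a \<Rightarrow> real" where
  "kernel_var V x = kernel_int P (\<lambda>y. (V y)\<^sup>2) x - (kernel_int P V x)\<^sup>2"

lemma kernel_var_integrable:
  assumes "L2 \<pi> V" shows "integrable \<pi> (kernel_var V)" "(LINT x|\<pi>. kernel_var V x) = sq_norm \<pi> V - sq_norm \<pi> (kernel_int P V)"
proof -
  have i: "integrable \<pi> (\<lambda>x. (V x)\<^sup>2)" "integrable \<pi> (\<lambda>x. (kernel_int P V x)\<^sup>2)"
    using assms kernel_int_L2(1)[OF assms] by (auto simp: L2_def)
  show "integrable \<pi> (kernel_var V)" "(LINT x|\<pi>. kernel_var V x) = sq_norm \<pi> V - sq_norm \<pi> (kernel_int P V)"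
    unfolding kernel_var_def[abs_def] using integrable_kernel(2,3)[OF i(1)] i
    by (simp_all add: sq_norm_def)
qed

text \<open>
  One step of the recursion for \<open>F\<close>, with \<open>\<epsilon>\<^sup>2 = 1 / M\<close>: \<open>exp(i\<epsilon>V) (1 - \<epsilon>\<^sup>2w/2)\<close> is an approximate eigenfunction
  for \<open>exp(-\<epsilon>\<^sup>2s2/2)\<close>.
\<close>

lemma step_error:
  assumes V': "L2 \<pi> V'" and V: "V \<in> borel_measurable borel" and f: "f \<in> borel_measurable borel"
    and w': "w' \<in> borel_measurable borel" "integrable \<pi> w'"
    and w: "w \<in> borel_measurable borel" "integrable \<pi> w"
    and eq: "AE x in \<pi>. f x = V x - kernel_int P V' x"
    and ap: "(LINT x|\<pi>. \<bar>kernel_var V' x - s2 - (w x - kernel_int P w' x)\<bar>) \<le> \<delta>" and \<delta>: "0 < \<delta>"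
  shows "\<forall>\<^sub>F M in sequentially. real M * (LINT x|\<pi>. cmod
      (iexp (f x / sqrt (real M)) * kernel_cint P (\<lambda>y. iexp (V' y / sqrt (real M)) * of_real (1 - w' y / (2 * real M))) x
        - of_real (exp (- s2 / (2 * real M))) * (iexp (V x / sqrt (real M)) * of_real (1 - w x / (2 * real M))))) \<le> \<delta>"
proof -
  define \<mu> where "\<mu> = kernel_int P V'"
  \<comment> \<open>\<open>T1\<close> is M times the Taylor remainder at scale 1 / sqrt M, and
    \<open>T2\<close> is the cross term between the oscillating factor and the corrector w'. Both
    vanish in L1(pi) by dominated convergence, applied once inside the kernel and once under
    pi.\<close>
  define T1 where "T1 M x = (LINT y|P x. real M * cmod (iexp_rem ((V' y - \<mu> x) / sqrt (real M))))" for M x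
  define T2 where "T2 M x = (LINT y|P x. cmod (iexp ((V' y - \<mu> x) / sqrt (real M)) - 1) * \<bar>w' y\<bar>)" for M x
  define A where "A x = \<bar>kernel_var V' x - s2 - (w x - kernel_int P w' x)\<bar>" for x
  define a where "a M = exp (- s2 / (2 * real M))" for M
  \<comment> \<open>M times the error of the first-order expansion of exp(-s2 / (2M)).\<close>
  define c where "c M = real M * \<bar>1 - a M - s2 / (2 * real M)\<bar>" for M
  define G where "G M x = iexp (f x / sqrt (real M)) * kernel_cint P (\<lambda>y. iexp (V' y / sqrt (real M)) * of_real (1 - w' y / (2 * real M))) x
        - of_real (a M) * (iexp (V x / sqrt (real M)) * of_real (1 - w x / (2 * real M)))" for M x
  have V'm: "V' \<in> borel_measurable borel" by (rule L2_meas[OF V'])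
  have \<mu>m: "\<mu> \<in> borel_measurable borel" unfolding \<mu>_def by (rule kernel_int_meas[OF V'm])
  note [measurable] = V'm \<mu>m w'(1) w(1) V f
  have ae: "AE x in \<pi>. integrable (P x) V' \<and> integrable (P x) (\<lambda>y. (V' y)\<^sup>2) \<and> integrable (P x) w'"
    using integrable_kernel(1)[OF L2_integrable[OF V']] integrable_kernel(1)[OF w'(2)]
      integrable_kernel(1)[of "\<lambda>y. (V' y)\<^sup>2"] V'
    by (auto simp: L2_def)
  have T1m: "T1 M \<in> borel_measurable \<pi>" for M
    unfolding T1_def[abs_def] by (intro meas_pi kernel_integral_measurable2[OF ker]) measurable
  have T2m: "T2 M \<in> borel_measurable \<pi>" for M
    unfolding T2_def[abs_def] by (intro meas_pi kernel_integral_measurable2[OF ker]) measurable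
  have b1: "real M * cmod (iexp_rem (d / sqrt (real M))) \<le> d\<^sup>2"
    and b1': "real M * cmod (iexp_rem (d / sqrt (real M))) \<le> \<bar>d\<bar> ^ 3 / 6 / sqrt (real M)" for M d
  proof -
    show "real M * cmod (iexp_rem (d / sqrt (real M))) \<le> d\<^sup>2"
      using mult_left_mono[OF iexp_rem_le(1)[of "d / sqrt (real M)"], of "real M"]
      by (cases "M = 0") (auto simp: power_divide)
    show "real M * cmod (iexp_rem (d / sqrt (real M))) \<le> \<bar>d\<bar> ^ 3 / 6 / sqrt (real M)"
    proof (cases "M = 0")
      case False
      have "real M * cmod (iexp_rem (d / sqrt (real M))) \<le> real M * (\<bar>d / sqrt (real M)\<bar> ^ 3 / 6)"
        by (intro mult_left_mono iexp_rem_le) auto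
      also have "\<bar>d / sqrt (real M)\<bar> ^ 3 = \<bar>d\<bar> ^ 3 / (real M * sqrt (real M))"
        by (simp add: power3_eq_cube abs_divide)
      finally show ?thesis using False by (simp add: field_simps)
    qed simp
  qed
  have invsqrt: "(\<lambda>M. r / sqrt (real M)) \<longlonglongrightarrow> 0" for r by real_asymp
  \<comment> \<open>Centering at the conditional mean removes the linear Taylor term and leaves the
    conditional variance as the quadratic one.\<close>
  have D: "integrable (P x) (\<lambda>y. (V' y - \<mu> x)\<^sup>2)" "(LINT y|P x. (V' y - \<mu> x)\<^sup>2) = kernel_var V' x"
    "(LINT y|P x. V' y - \<mu> x) = 0" "integrable (P x) (\<lambda>y. V' y - \<mu> x)"
    if "integrable (P x) V'" "integrable (P x) (\<lambda>y. (V' y)\<^sup>2)" for x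
  proof -
    interpret Px: prob_space "P x" by (rule prob_kernelD(1)[OF ker])
    have e: "(V' y - \<mu> x)\<^sup>2 = (V' y)\<^sup>2 - 2 * \<mu> x * V' y + (\<mu> x)\<^sup>2" for y
      by (simp add: power2_diff mult_ac)
    show "integrable (P x) (\<lambda>y. (V' y - \<mu> x)\<^sup>2)" unfolding e using that by simp
    show "(LINT y|P x. (V' y - \<mu> x)\<^sup>2) = kernel_var V' x" unfolding e using that
      by (simp add: kernel_var_def kernel_int_def \<mu>_def Px.prob_space power2_eq_square)
    show "(LINT y|P x. V' y - \<mu> x) = 0" "integrable (P x) (\<lambda>y. V' y - \<mu> x)"
      using that by (simp_all add: \<mu>_def kernel_int_def Px.prob_space)
  qed
  have kernel_int_abs_int: "integrable \<pi> (kernel_int P (\<lambda>y. \<bar>w' y\<bar>))"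
    using integrable_kernel(2)[of "\<lambda>y. \<bar>w' y\<bar>"] w'(2) by simp
  have T1_le: "AE x in \<pi>. norm (T1 M x) \<le> kernel_var V' x" for M
    using ae
  proof eventually_elim
    case (elim x)
    have Dx: "integrable (P x) (\<lambda>y. (V' y - \<mu> x)\<^sup>2)" using D(1) elim by blast
    have m: "(\<lambda>y. real M * cmod (iexp_rem ((V' y - \<mu> x) / sqrt (real M)))) \<in> borel_measurable (P x)"
      by (rule borel_measurable_kernel[OF ker]) measurable
    have "T1 M x \<le> (LINT y|P x. (V' y - \<mu> x)\<^sup>2)"
      unfolding T1_def by (intro integral_mono Dx b1 Bochner_Integration.integrable_bound[OF Dx m]) (use b1 in auto)
    moreover have "0 \<le> T1 M x" unfolding T1_def by (intro integral_nonneg_AE) auto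
    ultimately show ?case using D(2) elim by auto
  qed
  have T1_lim: "AE x in \<pi>. (\<lambda>M. T1 M x) \<longlonglongrightarrow> 0"
    using ae
  proof eventually_elim
    case (elim x)
    have Dx: "integrable (P x) (\<lambda>y. (V' y - \<mu> x)\<^sup>2)" using D(1) elim by blast
    have "(\<lambda>M. LINT y|P x. real M * cmod (iexp_rem ((V' y - \<mu> x) / sqrt (real M)))) \<longlonglongrightarrow> (LINT y|P x. 0)"
    proof (rule integral_dominated_convergence[OF _ _ Dx])
      show "(\<lambda>y. real M * cmod (iexp_rem ((V' y - \<mu> x) / sqrt (real M)))) \<in> borel_measurable (P x)" for M
        by (rule borel_measurable_kernel[OF ker]) measurable
      show "AE y in P x. (\<lambda>M. real M * cmod (iexp_rem ((V' y - \<mu> x) / sqrt (real M)))) \<longlonglongrightarrow> 0"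
      proof (rule AE_I2)
        fix y
        show "(\<lambda>M. real M * cmod (iexp_rem ((V' y - \<mu> x) / sqrt (real M)))) \<longlonglongrightarrow> 0"
          by (rule tendsto_sandwich[OF always_eventually always_eventually tendsto_const
                invsqrt[of "\<bar>V' y - \<mu> x\<bar> ^ 3 / 6"]]) (rule allI, simp, rule allI, rule b1')
      qed
      show "AE y in P x. norm (real M * cmod (iexp_rem ((V' y - \<mu> x) / sqrt (real M)))) \<le> (V' y - \<mu> x)\<^sup>2" for M
        using b1 by auto
    qed simp
    then show ?case by (simp add: T1_def)
  qed
  have T2_le: "AE x in \<pi>. norm (T2 M x) \<le> 2 * kernel_int P (\<lambda>y. \<bar>w' y\<bar>) x" for M
    using ae
  proof eventually_elim
    case (elim x)
    have i: "integrable (P x) (\<lambda>y. 2 * \<bar>w' y\<bar>)" using elim by simp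
    have m: "(\<lambda>y. cmod (iexp ((V' y - \<mu> x) / sqrt (real M)) - 1) * \<bar>w' y\<bar>) \<in> borel_measurable (P x)"
      by (rule borel_measurable_kernel[OF ker]) measurable
    have le: "cmod (iexp ((V' y - \<mu> x) / sqrt (real M)) - 1) * \<bar>w' y\<bar> \<le> 2 * \<bar>w' y\<bar>" for y
      by (intro mult_right_mono cmod_iexp_minus_1_le) auto
    have "T2 M x \<le> (LINT y|P x. 2 * \<bar>w' y\<bar>)"
      unfolding T2_def by (intro integral_mono i le Bochner_Integration.integrable_bound[OF i m]) (use le in auto)
    moreover have "0 \<le> T2 M x" unfolding T2_def by (intro integral_nonneg_AE) auto
    ultimately show ?case by (simp add: kernel_int_def)
  qed
  have T2_lim: "AE x in \<pi>. (\<lambda>M. T2 M x) \<longlonglongrightarrow> 0"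
    using ae
  proof eventually_elim
    case (elim x)
    have i: "integrable (P x) (\<lambda>y. 2 * \<bar>w' y\<bar>)" using elim by simp
    have "(\<lambda>M. LINT y|P x. cmod (iexp ((V' y - \<mu> x) / sqrt (real M)) - 1) * \<bar>w' y\<bar>) \<longlonglongrightarrow> (LINT y|P x. 0)"
    proof (rule integral_dominated_convergence[OF _ _ i])
      show "(\<lambda>y. cmod (iexp ((V' y - \<mu> x) / sqrt (real M)) - 1) * \<bar>w' y\<bar>) \<in> borel_measurable (P x)" for M
        by (rule borel_measurable_kernel[OF ker]) measurable
      show "AE y in P x. (\<lambda>M. cmod (iexp ((V' y - \<mu> x) / sqrt (real M)) - 1) * \<bar>w' y\<bar>) \<longlonglongrightarrow> 0"
      proof (intro AE_I2 tendsto_mult_left_zero)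
        fix y
        have b: "cmod (iexp ((V' y - \<mu> x) / sqrt (real M)) - 1) \<le> \<bar>V' y - \<mu> x\<bar> / sqrt (real M)" for M
          using cmod_iexp_minus_1_le(2)[of "(V' y - \<mu> x) / sqrt (real M)"] by (simp add: abs_divide)
        show "(\<lambda>M. cmod (iexp ((V' y - \<mu> x) / sqrt (real M)) - 1)) \<longlonglongrightarrow> 0"
          by (rule tendsto_sandwich[OF always_eventually always_eventually tendsto_const
                invsqrt[of "\<bar>V' y - \<mu> x\<bar>"]]) (intro allI b norm_ge_zero)+
      qed
      show "AE y in P x. norm (cmod (iexp ((V' y - \<mu> x) / sqrt (real M)) - 1) * \<bar>w' y\<bar>) \<le> 2 * \<bar>w' y\<bar>" for M
        by (rule AE_I2) (simp only: real_norm_def abs_mult abs_norm_cancel abs_abs, intro mult_right_mono cmod_iexp_minus_1_le abs_ge_zero)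
    qed simp
    then show ?case by (simp add: T2_def)
  qed
  have T1_int: "integrable \<pi> (T1 M)" for M
    by (rule Bochner_Integration.integrable_bound[OF kernel_var_integrable(1)[OF V'] T1m])
      (use T1_le[of M] in eventually_elim, simp)
  have i2: "integrable \<pi> (\<lambda>x. 2 * kernel_int P (\<lambda>y. \<bar>w' y\<bar>) x)" using kernel_int_abs_int by simp
  have T2_int: "integrable \<pi> (T2 M)" for M
    by (rule Bochner_Integration.integrable_bound[OF i2 T2m])
      (use T2_le[of M] in eventually_elim, simp)
  have T1_0: "(\<lambda>M. LINT x|\<pi>. T1 M x) \<longlonglongrightarrow> 0"
    using integral_dominated_convergence[OF _ T1m kernel_var_integrable(1)[OF V'] T1_lim T1_le] by simp
  have T2_0: "(\<lambda>M. LINT x|\<pi>. T2 M x) \<longlonglongrightarrow> 0"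
    using integral_dominated_convergence[OF _ T2m i2 T2_lim T2_le] by simp
  have A_int: "integrable \<pi> A"
    unfolding A_def[abs_def] using kernel_var_integrable(1)[OF V'] w(2) integrable_kernel(2)[OF w'(2)] by simp
  have point: "AE x in \<pi>. real M * cmod (G M x)
      \<le> T1 M x + T2 M x / 2 + c M + A x / 2 + \<bar>a M - 1\<bar> * \<bar>w x\<bar> / 2" if M: "0 < M" for M
    using ae eq
  proof eventually_elim
    case (elim x)
    interpret Px: prob_space "P x" by (rule prob_kernelD(1)[OF ker])
    define d where "d y = V' y - \<mu> x" for y
    define s where "s = sqrt (real M)"
    have s: "0 < s" "s\<^sup>2 = real M" using M by (simp_all add: s_def)
    have d: "integrable (P x) d" "integrable (P x) (\<lambda>y. (d y)\<^sup>2)" "(LINT y|P x. d y) = 0"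
      "(LINT y|P x. (d y)\<^sup>2) = kernel_var V' x"
      using D[of x] elim unfolding d_def[abs_def] by auto
    have dm: "d \<in> borel_measurable borel" unfolding d_def[abs_def] by measurable
    note [measurable] = dm
    have wx: "integrable (P x) w'" using elim by simp
    have r_int: "integrable (P x) (\<lambda>y. iexp_rem (d y / s))"
    proof (rule Bochner_Integration.integrable_bound)
      show "integrable (P x) (\<lambda>y. (d y)\<^sup>2 / real M)" using d by simp
      show "(\<lambda>y. iexp_rem (d y / s)) \<in> borel_measurable (P x)"
        by (rule borel_measurable_kernel[OF ker]) measurable
      show "AE y in P x. norm (iexp_rem (d y / s)) \<le> norm ((d y)\<^sup>2 / real M)"
        using iexp_rem_le(1)[of "d y / s" for y] by (auto simp: power_divide s)
    qed
    have e_int: "integrable (P x) (\<lambda>y. (iexp (d y / s) - 1) * of_real (w' y))"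
    proof (rule Bochner_Integration.integrable_bound)
      show "integrable (P x) (\<lambda>y. 2 * \<bar>w' y\<bar>)" using wx by simp
      show "(\<lambda>y. (iexp (d y / s) - 1) * of_real (w' y)) \<in> borel_measurable (P x)"
        by (rule borel_measurable_kernel[OF ker]) measurable
      show "AE y in P x. norm ((iexp (d y / s) - 1) * of_real (w' y)) \<le> norm (2 * \<bar>w' y\<bar>)"
        by (rule AE_I2) (simp only: norm_mult norm_of_real real_norm_def abs_mult abs_abs abs_numeral,
            intro mult_right_mono cmod_iexp_minus_1_le abs_ge_zero)
    qed
    define I1 where "I1 = (CLINT y|P x. iexp_rem (d y / s))"
    define I2 where "I2 = (CLINT y|P x. (iexp (d y / s) - 1) * of_real (w' y))"
    have C: "(CLINT y|P x. iexp (d y / s) * of_real (1 - w' y / (2 * real M)))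
        = I1 + 1 - of_real (kernel_var V' x / (2 * real M)) - I2 / of_real (2 * real M) - of_real (kernel_int P w' x / (2 * real M))"
    proof -
      have alg: "z * (1 - v / (2 * N)) = (z - (1 + Z - q / 2)) + 1 + Z - q / 2 - (z - 1) * v / (2 * N) - v / (2 * N)"
        if "N \<noteq> 0" for z v N Z q :: complex
        using that by (simp add: field_simps)
      have q: "(d y / s)\<^sup>2 = (d y)\<^sup>2 / real M" for y by (simp add: power_divide s)
      have e: "iexp (d y / s) * of_real (1 - w' y / (2 * real M))
          = iexp_rem (d y / s) + 1 + \<i> * of_real (d y / s) - of_real ((d y)\<^sup>2 / real M) / 2
            - (iexp (d y / s) - 1) * of_real (w' y) / (2 * of_real (real M)) - of_real (w' y) / (2 * of_real (real M))" for y
        using alg[of "of_real (real M)" "iexp (d y / s)" "of_real (w' y)" "\<i> * of_real (d y / s)" "of_real ((d y)\<^sup>2 / real M)"] M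
        unfolding iexp_rem_def q by simp
      have h1: "has_bochner_integral (P x) (\<lambda>y. iexp_rem (d y / s)) I1"
        using r_int by (simp add: has_bochner_integral_iff I1_def)
      have h2: "has_bochner_integral (P x) (\<lambda>y. 1 :: complex) 1"
        by (simp add: has_bochner_integral_iff Px.prob_space)
      have h3: "has_bochner_integral (P x) (\<lambda>y. \<i> * of_real (d y / s)) 0"
        using d by (simp add: has_bochner_integral_iff)
      have h4: "has_bochner_integral (P x) (\<lambda>y. of_real ((d y)\<^sup>2 / real M) / 2) (complex_of_real (kernel_var V' x / real M) / 2)"
        using d by (simp add: has_bochner_integral_iff del: of_real_power)
      have h5: "has_bochner_integral (P x) (\<lambda>y. (iexp (d y / s) - 1) * of_real (w' y) / (2 * of_real (real M)))
          (I2 / (2 * of_real (real M)))"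
        using e_int by (simp add: has_bochner_integral_iff I2_def)
      have h6: "has_bochner_integral (P x) (\<lambda>y. of_real (w' y) / (2 * of_real (real M)))
          (complex_of_real (kernel_int P w' x) / (2 * of_real (real M)))"
        using wx by (simp add: has_bochner_integral_iff kernel_int_def)
      have "has_bochner_integral (P x) (\<lambda>y. iexp (d y / s) * of_real (1 - w' y / (2 * real M)))
          (I1 + 1 + 0 - complex_of_real (kernel_var V' x / real M) / 2 - I2 / (2 * of_real (real M))
            - complex_of_real (kernel_int P w' x) / (2 * of_real (real M)))"
        unfolding e by (intro has_bochner_integral_add has_bochner_integral_diff h1 h2 h3 h4 h5 h6)
      then show ?thesis by (simp add: has_bochner_integral_iff mult.commute)
    qed
    \<comment> \<open>f x + V' y = V x + d y, so a factor of modulus 1 that depends on x alone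
      leaves the integral.\<close>
    have "iexp (f x / s) * kernel_cint P (\<lambda>y. iexp (V' y / s) * of_real (1 - w' y / (2 * real M))) x
        = iexp (V x / s) * (CLINT y|P x. iexp (d y / s) * of_real (1 - w' y / (2 * real M)))"
    proof -
      have "iexp (f x / s) * iexp (V' y / s) = iexp (V x / s) * iexp (d y / s)" for y
        unfolding exp_add[symmetric] d_def \<mu>_def elim(2)
        by (rule arg_cong[where f=exp]) (simp add: field_simps add_divide_distrib diff_divide_distrib)
      then have "iexp (f x / s) * (iexp (V' y / s) * z) = iexp (V x / s) * (iexp (d y / s) * z)" for y z
        by (simp only: mult.assoc[symmetric])
      then show ?thesis
        unfolding kernel_cint_def by (simp only: integral_mult_right_zero[symmetric])
    qed
    then have "G M x = iexp (V x / s) * (I1 + 1 - of_real (kernel_var V' x / (2 * real M)) - I2 / of_real (2 * real M)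
        - of_real (kernel_int P w' x / (2 * real M)) - of_real (a M) * of_real (1 - w x / (2 * real M)))"
      unfolding G_def s_def[symmetric] C by (simp only: right_diff_distrib mult.left_commute)
    then have "cmod (G M x) = cmod (I1 + 1 - of_real (kernel_var V' x / (2 * real M)) - I2 / of_real (2 * real M)
        - of_real (kernel_int P w' x / (2 * real M)) - of_real (a M) * of_real (1 - w x / (2 * real M)))"
      by (simp add: norm_mult)
    \<comment> \<open>The constants cancel up to the error collected in \<open>c\<close>, and the
      terms of order 1 / M combine to
      \<open>kernel_var V' x - s2 - (w x - kernel_int P w' x)\<close>, which \<open>\<delta>\<close>
      controls in L1(pi).\<close>
    also have "I1 + 1 - of_real (kernel_var V' x / (2 * real M)) - I2 / of_real (2 * real M)
        - of_real (kernel_int P w' x / (2 * real M)) - of_real (a M) * of_real (1 - w x / (2 * real M))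
      = I1 - I2 / of_real (2 * real M) + of_real ((1 - a M - s2 / (2 * real M))
         - (kernel_var V' x - s2 - (w x - kernel_int P w' x)) / (2 * real M) + (a M - 1) * w x / (2 * real M))"
      using M by (simp add: field_simps)
    also have "cmod \<dots> \<le> cmod I1 + cmod I2 / (2 * real M) + (\<bar>1 - a M - s2 / (2 * real M)\<bar>
        + A x / (2 * real M) + \<bar>a M - 1\<bar> * \<bar>w x\<bar> / (2 * real M))"
    proof -
      have "cmod (I1 - I2 / of_real (2 * real M)) \<le> cmod I1 + cmod I2 / (2 * real M)"
        using norm_triangle_ineq4[of I1 "I2 / of_real (2 * real M)"] by (simp add: norm_divide norm_mult)
      moreover have "\<bar>(1 - a M - s2 / (2 * real M))
         - (kernel_var V' x - s2 - (w x - kernel_int P w' x)) / (2 * real M) + (a M - 1) * w x / (2 * real M)\<bar>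
         \<le> \<bar>1 - a M - s2 / (2 * real M)\<bar> + A x / (2 * real M) + \<bar>a M - 1\<bar> * \<bar>w x\<bar> / (2 * real M)"
      proof -
        have "\<bar>p - q + r\<bar> \<le> \<bar>p\<bar> + \<bar>q\<bar> + \<bar>r\<bar>" for p q r :: real by linarith
        from this[of "1 - a M - s2 / (2 * real M)" "(kernel_var V' x - s2 - (w x - kernel_int P w' x)) / (2 * real M)" "(a M - 1) * w x / (2 * real M)"]
        show ?thesis by (simp add: A_def abs_divide abs_mult)
      qed
      ultimately show ?thesis
        by (intro norm_triangle_mono) (simp_all only: norm_of_real)
    qed
    finally have "real M * cmod (G M x) \<le> real M * (cmod I1 + cmod I2 / (2 * real M) + (\<bar>1 - a M - s2 / (2 * real M)\<bar>
        + A x / (2 * real M) + \<bar>a M - 1\<bar> * \<bar>w x\<bar> / (2 * real M)))"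
      by (rule mult_left_mono) simp
    also have "\<dots> = real M * cmod I1 + cmod I2 / 2 + c M + A x / 2 + \<bar>a M - 1\<bar> * \<bar>w x\<bar> / 2"
      using M by (simp add: c_def field_simps)
    also have "\<dots> \<le> T1 M x + T2 M x / 2 + c M + A x / 2 + \<bar>a M - 1\<bar> * \<bar>w x\<bar> / 2"
    proof -
      have "real M * cmod I1 \<le> real M * (LINT y|P x. cmod (iexp_rem (d y / s)))"
        unfolding I1_def by (intro mult_left_mono integral_norm_bound) simp
      then have "real M * cmod I1 \<le> T1 M x" by (simp add: T1_def d_def s_def)
      moreover have "cmod I2 \<le> T2 M x"
        unfolding I2_def T2_def d_def s_def[symmetric]
        by (rule order_trans[OF integral_norm_bound]) (simp add: norm_mult)
      ultimately show ?thesis by simp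
    qed
    finally show ?case .
  qed
  have Gm: "G M \<in> borel_measurable \<pi>" for M
  proof (rule cmeas_pi)
    have "kernel_cint P (\<lambda>y. iexp (V' y / sqrt (real M)) * of_real (1 - w' y / (2 * real M))) \<in> borel_measurable borel"
      by (rule kernel_cint_meas) measurable
    then show "G M \<in> borel_measurable borel" unfolding G_def[abs_def] by measurable
  qed
  define U where "U M = (LINT x|\<pi>. T1 M x) + (LINT x|\<pi>. T2 M x) / 2 + c M + (LINT x|\<pi>. A x) / 2
      + \<bar>a M - 1\<bar> * (LINT x|\<pi>. \<bar>w x\<bar>) / 2" for M
  have le: "real M * (LINT x|\<pi>. cmod (G M x)) \<le> U M" if M: "0 < M" for M
  proof -
    let ?B = "\<lambda>x. T1 M x + T2 M x / 2 + c M + A x / 2 + \<bar>a M - 1\<bar> * \<bar>w x\<bar> / 2"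
    have B: "integrable \<pi> ?B" using T1_int T2_int A_int w(2) by simp
    have "integrable \<pi> (\<lambda>x. real M * cmod (G M x))"
    proof (rule Bochner_Integration.integrable_bound[OF B])
      show "(\<lambda>x. real M * cmod (G M x)) \<in> borel_measurable \<pi>" using Gm by simp
      show "AE x in \<pi>. norm (real M * cmod (G M x)) \<le> norm (?B x)"
        using point[OF M] by eventually_elim auto
    qed
    then have "(LINT x|\<pi>. real M * cmod (G M x)) \<le> (LINT x|\<pi>. ?B x)"
      using point[OF M] B by (intro integral_mono_AE) auto
    also have "\<dots> = U M"
      using T1_int T2_int A_int w(2) by (simp add: U_def prob_space)
    finally show ?thesis by simp
  qed
  have a_lim: "a \<longlonglongrightarrow> 1" unfolding a_def[abs_def] by real_asymp
  have c_lim: "c \<longlonglongrightarrow> 0"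
  proof -
    have "(\<lambda>M. real M * (1 - a M - s2 / (2 * real M))) \<longlonglongrightarrow> 0"
      unfolding a_def by real_asymp
    then have "(\<lambda>M. \<bar>real M * (1 - a M - s2 / (2 * real M))\<bar>) \<longlonglongrightarrow> 0" by (rule tendsto_rabs_zero)
    then show ?thesis by (simp add: c_def[abs_def] abs_mult)
  qed
  have "U \<longlonglongrightarrow> 0 + 0 / 2 + 0 + (LINT x|\<pi>. A x) / 2 + \<bar>1 - 1\<bar> * (LINT x|\<pi>. \<bar>w x\<bar>) / 2"
    unfolding U_def[abs_def] by (intro tendsto_intros T1_0 T2_0 a_lim c_lim) auto
  \<comment> \<open>The factor 1 / 2 in front of the defect puts the limit at or below \<delta> / 2,
    which leaves room for a strict inequality.\<close>
  moreover have "0 + 0 / 2 + 0 + (LINT x|\<pi>. A x) / 2 + \<bar>1 - 1\<bar> * (LINT x|\<pi>. \<bar>w x\<bar>) / 2 < \<delta>"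
    using ap \<delta> by (simp add: A_def)
  ultimately have "\<forall>\<^sub>F M in sequentially. U M < \<delta>" by (rule order_tendstoD)
  then have "\<forall>\<^sub>F M in sequentially. real M * (LINT x|\<pi>. cmod (G M x)) \<le> \<delta>"
    using eventually_gt_at_top[of 0]
  proof eventually_elim
    case (elim M)
    then show ?case using le[OF elim(2)] by linarith
  qed
  then show ?thesis by (simp only: G_def a_def)
qed

end

text \<open>The expectation of exp(i S) for the sum S of the first n summands of a sweep started at
  x in phase k. Defined by kernels alone, it has a value at every x, independently of any chain and
  initial law.\<close>

primrec sweep_char :: "(nat \<Rightarrow> 'a \<Rightarrow> 'a measure) \<Rightarrow> nat \<Rightarrow> (nat \<Rightarrow> 'a \<Rightarrow> real) \<Rightarrow> nat \<Rightarrow> nat \<Rightarrow> 'a \<Rightarrow> complex" where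
  "sweep_char P K f 0 k x = 1"
| "sweep_char P K f (Suc n) k x = iexp (f k x) * kernel_cint (P k) (sweep_char P K f n (cyc K k)) x"

lemma sweep_char_measurable:
  fixes f :: "nat \<Rightarrow> 'a::topological_space \<Rightarrow> real"
  assumes "\<And>k. k \<in> {1..K} \<Longrightarrow> prob_kernel (P k)" "\<And>k. k \<in> {1..K} \<Longrightarrow> f k \<in> borel_measurable borel"
  shows "k \<in> {1..K} \<Longrightarrow> sweep_char P K f n k \<in> borel_measurable borel"
proof (induction n arbitrary: k)
  case 0
  have "sweep_char P K f 0 k = (\<lambda>x. 1)" by auto
  then show ?case by simp
next
  case (Suc n)
  have "kernel_cint (P k) (sweep_char P K f n (cyc K k)) \<in> borel_measurable borel"
    unfolding kernel_cint_def[abs_def]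
    by (rule measurable_kernel_integral[OF assms(1)[OF Suc.prems] Suc.IH[OF cyc_in_range[OF Suc.prems]]])
  moreover have "sweep_char P K f (Suc n) k = (\<lambda>x. iexp (f k x) * kernel_cint (P k) (sweep_char P K f n (cyc K k)) x)" by auto
  ultimately show ?case using assms(2)[OF Suc.prems] by simp
qed

lemma sweep_char_norm_le:
  fixes f :: "nat \<Rightarrow> 'a::topological_space \<Rightarrow> real"
  assumes "\<And>k. k \<in> {1..K} \<Longrightarrow> prob_kernel (P k)" "\<And>k. k \<in> {1..K} \<Longrightarrow> f k \<in> borel_measurable borel"
  shows "k \<in> {1..K} \<Longrightarrow> cmod (sweep_char P K f n k x) \<le> 1"
proof (induction n arbitrary: k x)
  case 0
  then show ?case by simp
next
  case (Suc n)
  note r = cyc_in_range[OF Suc.prems] and kr = assms(1)[OF Suc.prems]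
  interpret Px: prob_space "P k x" by (rule prob_kernelD(1)[OF kr])
  have m: "(\<lambda>y. cmod (sweep_char P K f n (cyc K k) y)) \<in> borel_measurable (P k x)"
    using borel_measurable_kernel[OF kr sweep_char_measurable[OF assms r]] by simp
  have "cmod (kernel_cint (P k) (sweep_char P K f n (cyc K k)) x) \<le> (LINT y|P k x. cmod (sweep_char P K f n (cyc K k) y))"
    unfolding kernel_cint_def by (rule integral_norm_bound)
  also have "\<dots> \<le> (LINT y|P k x. 1)"
    using Suc.IH[OF r] by (intro integral_mono Px.integrable_const_bound[of _ 1] m) auto
  finally show ?case by (simp add: norm_mult Px.prob_space)
qed

lemma cmod_complex_power_le_1: "0 \<le> a \<Longrightarrow> a \<le> 1 \<Longrightarrow> cmod (of_real (a ^ n)) \<le> 1"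
  by (simp add: norm_power power_le_one)

context projection_sweep begin

text \<open>Kernels contract L1(pi), the factors exp(i f) have modulus 1 and a <= 1, so one-step
  errors only add, and M errors of order \<delta> / M stay small. There are M - s summands under the
  scaling sqrt M because the first s steps are later cut off.\<close>

theorem stationary_clt:
  assumes f: "\<And>k. k \<in> {1..K} \<Longrightarrow> f k \<in> borel_measurable borel"
    and V: "\<And>k. k \<in> {1..K} \<Longrightarrow> L2 \<pi> (V k)"
    and eq: "\<And>k. k \<in> {1..K} \<Longrightarrow> AE x in \<pi>. f k x = V k x - kernel_int (P k) (V (cyc K k)) x"
    and s2: "0 \<le> s2"
    and ap: "\<And>\<delta>. 0 < \<delta> \<Longrightarrow> \<exists>w. (\<forall>k\<in>{1..K}. w k \<in> borel_measurable borel \<and> integrable \<pi> (w k)) \<and>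
      (\<forall>k\<in>{1..K}. (LINT x|\<pi>. \<bar>invariant_kernel.kernel_var (P k) (V (cyc K k)) x - s2
          - (w k x - kernel_int (P k) (w (cyc K k)) x)\<bar>) \<le> \<delta>)"
    and k0: "k0 \<in> {1..K}"
  shows "(\<lambda>M. LINT x|\<pi>. cmod (sweep_char P K (\<lambda>k x. f k x / sqrt (real M)) (M - s) k0 x - of_real (exp (- s2 / 2)))) \<longlonglongrightarrow> 0"
proof (rule LIMSEQ_I)
  fix e :: real assume e: "0 < e"
  \<comment> \<open>Each of the K phases contributes \<delta> to the accumulated error, e / 4 in
    total.\<close>
  define \<delta> where "\<delta> = e / (4 * real K)"
  have \<delta>: "0 < \<delta>" using e K by (simp add: \<delta>_def)
  obtain w where w: "\<And>k. k \<in> {1..K} \<Longrightarrow> w k \<in> borel_measurable borel" "\<And>k. k \<in> {1..K} \<Longrightarrow> integrable \<pi> (w k)"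
    and wap: "\<And>k. k \<in> {1..K} \<Longrightarrow> (LINT x|\<pi>. \<bar>invariant_kernel.kernel_var (P k) (V (cyc K k)) x - s2
          - (w k x - kernel_int (P k) (w (cyc K k)) x)\<bar>) \<le> \<delta>"
    using ap[OF \<delta>] by blast
  define a where "a M = exp (- s2 / (2 * real M))" for M
  define H where "H M k x = iexp (V k x / sqrt (real M)) * complex_of_real (1 - w k x / (2 * real M))" for M k x
  define F where "F M n k = sweep_char P K (\<lambda>k x. f k x / sqrt (real M)) n k" for M n k
  define R where "R M k = (LINT x|\<pi>. cmod (iexp (f k x / sqrt (real M)) * kernel_cint (P k) (H M (cyc K k)) x
      - of_real (a M) * H M k x))" for M k
  define B where "B M k = (LINT x|\<pi>. cmod (H M k x - 1))" for M k
  define L where "L = exp (- s2 / 2)"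
  have a01: "0 \<le> a M" "a M \<le> 1" for M using s2 by (auto simp: a_def)
  have fm: "(\<lambda>x. f k x / sqrt (real M)) \<in> borel_measurable borel" if "k \<in> {1..K}" for k M
    using f[OF that] by simp
  have Fm: "F M n k \<in> borel_measurable borel" if "k \<in> {1..K}" for M n k
    unfolding F_def by (intro sweep_char_measurable ker fm that)
  have F1: "cmod (F M n k x) \<le> 1" if "k \<in> {1..K}" for M n k x
    unfolding F_def by (intro sweep_char_norm_le ker fm that)
  have cm: "u \<in> borel_measurable \<pi>" if "u \<in> borel_measurable borel" for u :: "'a \<Rightarrow> complex"
    using that measurable_cong_sets[OF sets_pi refl] by blast
  have Fi: "integrable \<pi> (F M n k)" if "k \<in> {1..K}" for M n k
    by (rule integrable_const_bound[of _ 1]) (use F1[OF that] cm[OF Fm[OF that]] in auto)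
  have Hm: "H M k \<in> borel_measurable borel" if "k \<in> {1..K}" for M k
  proof -
    note [measurable] = w(1)[OF that] L2_meas[OF V[OF that]]
    show ?thesis unfolding H_def[abs_def] by measurable
  qed
  have H_le: "cmod (H M k x) \<le> 1 + \<bar>w k x\<bar>" for M k x
  proof -
    have "\<bar>w k x / (2 * real M)\<bar> \<le> \<bar>w k x\<bar>"
      by (cases "M = 0") (auto simp: abs_divide abs_mult divide_le_eq mult_le_cancel_left1)
    then have "\<bar>1 - w k x / (2 * real M)\<bar> \<le> 1 + \<bar>w k x\<bar>" by linarith
    then show ?thesis unfolding H_def norm_mult norm_of_real by simp
  qed
  have Hi: "integrable \<pi> (H M k)" if "k \<in> {1..K}" for M k
  proof (rule Bochner_Integration.integrable_bound)
    show "integrable \<pi> (\<lambda>x. 1 + \<bar>w k x\<bar>)" using w(2)[OF that] by simp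
    show "H M k \<in> borel_measurable \<pi>" by (rule cm[OF Hm[OF that]])
    show "AE x in \<pi>. norm (H M k x) \<le> norm (1 + \<bar>w k x\<bar>)" using H_le by (auto intro: order_trans)
  qed
  have B_lim: "(\<lambda>M. B M k) \<longlonglongrightarrow> 0" if k: "k \<in> {1..K}" for k
  proof -
    have "(\<lambda>M. LINT x|\<pi>. cmod (H M k x - 1)) \<longlonglongrightarrow> (LINT x|\<pi>. 0)"
    proof (rule integral_dominated_convergence[where w="\<lambda>x. 2 + \<bar>w k x\<bar>"])
      show "integrable \<pi> (\<lambda>x. 2 + \<bar>w k x\<bar>)" using w(2)[OF k] by simp
      show "(\<lambda>x. cmod (H M k x - 1)) \<in> borel_measurable \<pi>" for M using cm[OF Hm[OF k]] by simp
      show "AE x in \<pi>. norm (cmod (H M k x - 1)) \<le> 2 + \<bar>w k x\<bar>" for M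
      proof (rule AE_I2)
        fix x
        show "norm (cmod (H M k x - 1)) \<le> 2 + \<bar>w k x\<bar>"
          using norm_triangle_ineq4[of "H M k x" 1] H_le[of M k x] by simp
      qed
      show "AE x in \<pi>. (\<lambda>M. cmod (H M k x - 1)) \<longlonglongrightarrow> 0"
      proof (rule AE_I2)
        fix x
        have i: "(\<lambda>M. r / sqrt (real M)) \<longlonglongrightarrow> 0" "(\<lambda>M. r / (2 * real M)) \<longlonglongrightarrow> 0" for r by real_asymp+
        have "(\<lambda>M. H M k x) \<longlonglongrightarrow> iexp 0 * complex_of_real (1 - 0)"
          unfolding H_def by (intro tendsto_intros i)
        then have "(\<lambda>M. H M k x - 1) \<longlonglongrightarrow> 0" using LIM_zero by fastforce
        then show "(\<lambda>M. cmod (H M k x - 1)) \<longlonglongrightarrow> 0" by (rule tendsto_norm_zero)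
      qed
    qed simp
    then show ?thesis by (simp add: B_def)
  qed
  have B_nn: "0 \<le> B M k" for M k by (simp add: B_def)
  have R_nn: "0 \<le> R M k" for M k by (simp add: R_def)
  have R_ev: "\<forall>\<^sub>F M in sequentially. real M * R M k \<le> \<delta>" if k: "k \<in> {1..K}" for k
  proof -
    interpret invariant_kernel \<pi> "P k" by (rule inv_ker[OF k])
    note r = cyc_in_range[OF k]
    show ?thesis unfolding R_def H_def a_def
      by (rule step_error[OF V[OF r] L2_meas[OF V[OF k]] f[OF k] w(1)[OF r] w(2)[OF r] w(1)[OF k] w(2)[OF k] eq[OF k] wap[OF k] \<delta>])
  qed
  \<comment> \<open>Consecutive steps use different phases; sums over all phases give bounds that do
    not depend on where the recursion stands.\<close>
  define RS where "RS M = (\<Sum>k\<in>{1..K}. R M k)" for M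
  define BS where "BS M = (\<Sum>k\<in>{1..K}. B M k)" for M
  have R_RS: "R M k \<le> RS M" and B_BS: "B M k \<le> BS M" if "k \<in> {1..K}" for M k
    unfolding RS_def BS_def using that R_nn B_nn by (auto intro!: member_le_sum simp del: atLeastAtMost_iff)
  have main: "(LINT x|\<pi>. cmod (F M n k x - of_real (a M ^ n) * H M k x)) \<le> real n * RS M + BS M"
    if "k \<in> {1..K}" for M n k
    using that
  proof (induction n arbitrary: k)
    case 0
    have "(LINT x|\<pi>. cmod (F M 0 k x - of_real (a M ^ 0) * H M k x)) = B M k"
      unfolding B_def F_def by (intro Bochner_Integration.integral_cong) (auto simp: norm_minus_commute)
    then show ?case using B_BS[OF 0] by simp
  next
    case (Suc n)
    interpret invariant_kernel \<pi> "P k" by (rule inv_ker[OF Suc.prems])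
    note k = Suc.prems and r = cyc_in_range[OF Suc.prems]
    define u where "u y = F M n (cyc K k) y - of_real (a M ^ n) * H M (cyc K k) y" for y
    define v where "v x = iexp (f k x / sqrt (real M)) * kernel_cint (P k) (H M (cyc K k)) x - of_real (a M) * H M k x" for x
    have um: "u \<in> borel_measurable borel" unfolding u_def[abs_def] using Fm[OF r] Hm[OF r] by measurable
    have ui: "integrable \<pi> u" unfolding u_def[abs_def] using Fi[OF r] Hi[OF r] by simp
    have vi: "integrable \<pi> v"
    proof -
      have "integrable \<pi> (\<lambda>x. iexp (f k x / sqrt (real M)) * kernel_cint (P k) (H M (cyc K k)) x)"
      proof (rule Bochner_Integration.integrable_bound[OF kernel_cint_contraction(2)[OF Hm[OF r, of M] Hi[OF r, of M]]])
        show "(\<lambda>x. iexp (f k x / sqrt (real M)) * kernel_cint (P k) (H M (cyc K k)) x) \<in> borel_measurable \<pi>"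
        proof (rule cm)
          note [measurable] = f[OF k] kernel_cint_meas[OF Hm[OF r]]
          show "(\<lambda>x. iexp (f k x / sqrt (real M)) * kernel_cint (P k) (H M (cyc K k)) x) \<in> borel_measurable borel" by measurable
        qed
      qed (simp add: norm_mult)
      then show ?thesis unfolding v_def[abs_def] using Hi[OF k] by simp
    qed
    have "AE x in \<pi>. cmod (F M (Suc n) k x - of_real (a M ^ Suc n) * H M k x) \<le> cmod (kernel_cint (P k) u x) + cmod (v x)"
      using kernel_cint_contraction(1)[OF Fm[OF r, of M n] Fi[OF r, of M n]]
        kernel_cint_contraction(1)[OF Hm[OF r, of M] Hi[OF r, of M]]
    proof eventually_elim
      case (elim x)
      have "kernel_cint (P k) u x = kernel_cint (P k) (F M n (cyc K k)) x - of_real (a M ^ n) * kernel_cint (P k) (H M (cyc K k)) x"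
        unfolding kernel_cint_def u_def using elim by simp
      \<comment> \<open>The new error is the old one pushed through one kernel, plus a^n times the
        one-step error.\<close>
      then have "F M (Suc n) k x - of_real (a M ^ Suc n) * H M k x
          = iexp (f k x / sqrt (real M)) * kernel_cint (P k) u x + of_real (a M ^ n) * v x"
        unfolding F_def v_def sweep_char.simps by (simp add: right_diff_distrib mult_ac)
      then have "cmod (F M (Suc n) k x - of_real (a M ^ Suc n) * H M k x)
          \<le> cmod (iexp (f k x / sqrt (real M)) * kernel_cint (P k) u x) + cmod (of_real (a M ^ n) * v x)"
        by (simp only: norm_triangle_ineq)
      also have "\<dots> \<le> cmod (kernel_cint (P k) u x) + 1 * cmod (v x)"
        unfolding norm_mult using cmod_complex_power_le_1[OF a01] by (intro add_mono mult_right_mono) auto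
      finally show ?case by simp
    qed
    then have "(LINT x|\<pi>. cmod (F M (Suc n) k x - of_real (a M ^ Suc n) * H M k x))
        \<le> (LINT x|\<pi>. cmod (kernel_cint (P k) u x) + cmod (v x))"
      using Fi[OF k] Hi[OF k] kernel_cint_contraction(2)[OF um ui] vi by (intro integral_mono_AE) auto
    also have "\<dots> = (LINT x|\<pi>. cmod (kernel_cint (P k) u x)) + R M k"
      using kernel_cint_contraction(2)[OF um ui] vi by (simp add: R_def v_def[abs_def])
    also have "\<dots> \<le> (LINT x|\<pi>. cmod (u x)) + RS M"
      by (intro add_mono kernel_cint_contraction(3) um ui R_RS k)
    also have "\<dots> \<le> real n * RS M + BS M + RS M"
      unfolding u_def using Suc.IH[OF r] by simp
    finally show ?case by (simp add: algebra_simps)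
  qed
  have RS_nn: "0 \<le> RS M" for M unfolding RS_def by (intro sum_nonneg R_nn)
  have bound: "(LINT x|\<pi>. cmod (F M n k0 x - of_real L)) \<le> real n * RS M + 2 * BS M + \<bar>a M ^ n - L\<bar>" for M n
  proof -
    have "(LINT x|\<pi>. cmod (F M n k0 x - of_real L)) \<le>
        (LINT x|\<pi>. cmod (F M n k0 x - of_real (a M ^ n) * H M k0 x) + cmod (H M k0 x - 1) + \<bar>a M ^ n - L\<bar>)"
    proof (rule integral_mono)
      show "integrable \<pi> (\<lambda>x. cmod (F M n k0 x - of_real L))" using Fi[OF k0] by simp
      show "integrable \<pi> (\<lambda>x. cmod (F M n k0 x - of_real (a M ^ n) * H M k0 x) + cmod (H M k0 x - 1) + \<bar>a M ^ n - L\<bar>)"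
        using Fi[OF k0] Hi[OF k0] by simp
      fix x
      have "F M n k0 x - of_real L = (F M n k0 x - of_real (a M ^ n) * H M k0 x) + of_real (a M ^ n) * (H M k0 x - 1) + of_real (a M ^ n - L)"
        by (simp add: algebra_simps)
      then have "cmod (F M n k0 x - of_real L) \<le> cmod (F M n k0 x - of_real (a M ^ n) * H M k0 x)
          + cmod (of_real (a M ^ n) * (H M k0 x - 1)) + cmod (of_real (a M ^ n - L))"
        by (metis norm_triangle_mono norm_triangle_ineq order_refl)
      also have "\<dots> \<le> cmod (F M n k0 x - of_real (a M ^ n) * H M k0 x) + 1 * cmod (H M k0 x - 1) + \<bar>a M ^ n - L\<bar>"
        unfolding norm_mult norm_of_real[of "a M ^ n - L"] using cmod_complex_power_le_1[OF a01]
        by (intro add_mono mult_right_mono) auto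
      finally show "cmod (F M n k0 x - of_real L) \<le> cmod (F M n k0 x - of_real (a M ^ n) * H M k0 x) + cmod (H M k0 x - 1) + \<bar>a M ^ n - L\<bar>"
        by simp
    qed
    also have "\<dots> = (LINT x|\<pi>. cmod (F M n k0 x - of_real (a M ^ n) * H M k0 x)) + B M k0 + \<bar>a M ^ n - L\<bar>"
      using Fi[OF k0] Hi[OF k0] by (simp add: B_def prob_space)
    also have "\<dots> \<le> (real n * RS M + BS M) + BS M + \<bar>a M ^ n - L\<bar>"
      by (intro add_mono main B_BS k0 order_refl)
    finally show ?thesis by simp
  qed
  have BS_lim: "BS \<longlonglongrightarrow> 0"
  proof -
    have "BS \<longlonglongrightarrow> (\<Sum>k\<in>{1..K}. 0)" unfolding BS_def[abs_def] by (intro tendsto_sum B_lim)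
    then show ?thesis by simp
  qed
  have a_lim: "(\<lambda>M. a M ^ (M - s)) \<longlonglongrightarrow> L"
  proof -
    have "(\<lambda>M. exp (- s2 / 2 * (real M - real s) / real M)) \<longlonglongrightarrow> L"
    proof -
      have "(\<lambda>M. (real M - real s) / real M) \<longlonglongrightarrow> 1" by real_asymp
      then have "(\<lambda>M. exp (- s2 / 2 * ((real M - real s) / real M))) \<longlonglongrightarrow> exp (- s2 / 2 * 1)"
        by (intro tendsto_intros)
      then show ?thesis by (simp add: L_def)
    qed
    moreover have "\<forall>\<^sub>F M in sequentially. exp (- s2 / 2 * (real M - real s) / real M) = a M ^ (M - s)"
      using eventually_ge_at_top[of s]
    proof eventually_elim
      case (elim M)
      then show ?case unfolding a_def exp_of_nat_mult[symmetric]
        by (intro arg_cong[where f=exp]) (simp add: of_nat_diff field_simps)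
    qed
    ultimately show ?thesis by (rule Lim_transform_eventually)
  qed
  have ev1: "\<forall>\<^sub>F M in sequentially. \<forall>k\<in>{1..K}. real M * R M k \<le> \<delta>"
    using R_ev by (simp add: eventually_ball_finite_distrib)
  have ev2: "\<forall>\<^sub>F M in sequentially. BS M < e / 8"
    using BS_lim e by (intro order_tendstoD) auto
  have "(\<lambda>M. \<bar>a M ^ (M - s) - L\<bar>) \<longlonglongrightarrow> 0"
    using a_lim LIM_zero tendsto_rabs_zero by blast
  then have ev3: "\<forall>\<^sub>F M in sequentially. \<bar>a M ^ (M - s) - L\<bar> < e / 4"
    using e by (intro order_tendstoD) auto
  have "\<forall>\<^sub>F M in sequentially. norm ((LINT x|\<pi>. cmod (F M (M - s) k0 x - of_real L)) - 0) < e"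
    using ev1 ev2 ev3
  proof eventually_elim
    case (elim M)
    have "real (M - s) * RS M \<le> real M * RS M" by (intro mult_right_mono RS_nn) simp
    also have "\<dots> = (\<Sum>k\<in>{1..K}. real M * R M k)" by (simp add: RS_def sum_distrib_left)
    also have "\<dots> \<le> (\<Sum>k\<in>{1..K}. \<delta>)" using elim(1) by (intro sum_mono) blast
    also have "\<dots> = e / 4" using K by (simp add: \<delta>_def)
    finally have "(LINT x|\<pi>. cmod (F M (M - s) k0 x - of_real L)) < e"
      using bound[of M "M - s"] elim e by linarith
    then show ?case by simp
  qed
  then show "\<exists>N. \<forall>M\<ge>N. norm ((LINT x|\<pi>. cmod (sweep_char P K (\<lambda>k x. f k x / sqrt (real M)) (M - s) k0 x - of_real (exp (- s2 / 2)))) - 0) < e"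
    by (simp only: eventually_sequentially F_def L_def)
qed

end

section \<open>From the stationary law to an arbitrary starting point\<close>

context projection_sweep begin

lemma sweep_char_meas:
  "(\<And>k. k \<in> {1..K} \<Longrightarrow> f k \<in> borel_measurable borel) \<Longrightarrow> k \<in> {1..K} \<Longrightarrow> sweep_char P K f n k \<in> borel_measurable borel"
  by (rule sweep_char_measurable[OF ker])

lemma sweep_char_norm:
  "(\<And>k. k \<in> {1..K} \<Longrightarrow> f k \<in> borel_measurable borel) \<Longrightarrow> k \<in> {1..K} \<Longrightarrow> cmod (sweep_char P K f n k x) \<le> 1"
  by (rule sweep_char_norm_le[OF ker])

text \<open>
  Bounds the effect on the characteristic function of the first \<open>t\<close> summands. It vanishes in the limit
  at every \<open>x\<close> without a moment condition, which copes with points where \<open>\<Pi>\<^sub>k g\<close> is the junk value 0.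
\<close>

primrec start_err :: "(nat \<Rightarrow> 'a \<Rightarrow> real) \<Rightarrow> nat \<Rightarrow> nat \<Rightarrow> 'a \<Rightarrow> real" where
  "start_err f 0 k x = 0"
| "start_err f (Suc t) k x = cmod (iexp (f k x) - 1) + kernel_int (P k) (start_err f t (cyc K k)) x"

lemma start_err_props:
  assumes f: "\<And>k. k \<in> {1..K} \<Longrightarrow> f k \<in> borel_measurable borel" and "k \<in> {1..K}"
  shows "start_err f t k \<in> borel_measurable borel" "0 \<le> start_err f t k x" "start_err f t k x \<le> 2 * real t"
proof -
  have "start_err f t k \<in> borel_measurable borel \<and> (\<forall>x. 0 \<le> start_err f t k x \<and> start_err f t k x \<le> 2 * real t)"
    using assms(2)
  proof (induction t arbitrary: k)
    case 0
    have "start_err f 0 k = (\<lambda>x. 0)" by auto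
    then show ?case by simp
  next
    case (Suc t)
    interpret invariant_kernel \<pi> "P k" by (rule inv_ker[OF Suc.prems])
    note IH = Suc.IH[OF cyc_in_range[OF Suc.prems]]
    let ?s = "start_err f t (cyc K k)"
    have m: "kernel_int (P k) ?s \<in> borel_measurable borel" using IH by (intro kernel_int_meas) blast
    have "start_err f (Suc t) k = (\<lambda>x. cmod (iexp (f k x) - 1) + kernel_int (P k) ?s x)" by auto
    moreover note [measurable] = f[OF Suc.prems] m
    have "(\<lambda>x. cmod (iexp (f k x) - 1) + kernel_int (P k) ?s x) \<in> borel_measurable borel" by measurable
    moreover have "0 \<le> start_err f (Suc t) k x \<and> start_err f (Suc t) k x \<le> 2 * real (Suc t)" for x
    proof -
      interpret Px: prob_space "P k x" by (rule prob_kernelD(1)[OF ker])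
      have i: "integrable (P k x) ?s"
        by (rule Px.integrable_const_bound[of _ "2 * real t"]) (use IH kernel_meas in auto)
      have k0: "0 \<le> kernel_int (P k) ?s x" unfolding kernel_int_def using IH by (intro integral_nonneg_AE) auto
      have "kernel_int (P k) ?s x \<le> (LINT y|P k x. 2 * real t)"
        unfolding kernel_int_def using IH by (intro integral_mono i) auto
      then have k1: "kernel_int (P k) ?s x \<le> 2 * real t" by (simp add: Px.prob_space)
      have "0 \<le> start_err f (Suc t) k x"
        unfolding start_err.simps by (intro add_nonneg_nonneg norm_ge_zero k0)
      moreover have "start_err f (Suc t) k x \<le> 2 + 2 * real t"
        unfolding start_err.simps by (intro add_mono cmod_iexp_minus_1_le(1) k1)
      ultimately show ?thesis by simp
    qed
    ultimately show ?case by simp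
  qed
  then show "start_err f t k \<in> borel_measurable borel" "0 \<le> start_err f t k x" "start_err f t k x \<le> 2 * real t"
    by auto
qed

text \<open>Dominated convergence at each level, with the constant 2 t as dominating function: a
  summand is measured by |exp(i f) - 1| <= 2 and not by |f|, which a kernel may fail to
  integrate.\<close>

lemma start_err_tendsto_0:
  assumes f: "\<And>k. k \<in> {1..K} \<Longrightarrow> f k \<in> borel_measurable borel" and k: "k \<in> {1..K}"
  shows "(\<lambda>M. start_err (\<lambda>k x. f k x / sqrt (real M)) t k x) \<longlonglongrightarrow> 0"
  using k
proof (induction t arbitrary: k x)
  case 0
  then show ?case by simp
next
  case (Suc t)
  interpret invariant_kernel \<pi> "P k" by (rule inv_ker[OF Suc.prems])
  note r = cyc_in_range[OF Suc.prems]
  let ?s = "\<lambda>M. start_err (\<lambda>k x. f k x / sqrt (real M)) t (cyc K k)"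
  have fm: "(\<lambda>x. f k x / sqrt (real M)) \<in> borel_measurable borel" if "k \<in> {1..K}" for k M
    using f[OF that] by simp
  interpret Px: prob_space "P k x" by (rule prob_kernelD(1)[OF ker])
  have "(\<lambda>M. LINT y|P k x. ?s M y) \<longlonglongrightarrow> (LINT y|P k x. 0)"
  proof (rule integral_dominated_convergence[where w="\<lambda>_. 2 * real t"])
    show "?s M \<in> borel_measurable (P k x)" for M
      by (rule kernel_meas[OF start_err_props(1)[OF fm r]])
    show "AE y in P k x. (\<lambda>M. ?s M y) \<longlonglongrightarrow> 0" using Suc.IH[OF r] by simp
    show "AE y in P k x. norm (?s M y) \<le> 2 * real t" for M
      using start_err_props(2,3)[where f="\<lambda>k x. f k x / sqrt (real M)" and t=t, OF fm r] by simp
  qed simp_all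
  then have l2: "(\<lambda>M. kernel_int (P k) (?s M) x) \<longlonglongrightarrow> 0" by (simp add: kernel_int_def)
  have inv: "(\<lambda>M. c / sqrt (real M)) \<longlonglongrightarrow> 0" for c by real_asymp
  have "(\<lambda>M. cmod (iexp (f k x / sqrt (real M)) - 1)) \<longlonglongrightarrow> cmod (iexp 0 - 1)"
    by (intro tendsto_intros inv)
  then have "(\<lambda>M. cmod (iexp (f k x / sqrt (real M)) - 1)) \<longlonglongrightarrow> 0" by simp
  from tendsto_add[OF this l2] show ?case by simp
qed

text \<open>Dropping the first t summands costs at most \<open>start_err\<close>; what is left is
  the deviation of the remaining n summands, averaged over the law of the state after t
  steps.\<close>

lemma sweep_char_shift_bound:
  assumes f: "\<And>k. k \<in> {1..K} \<Longrightarrow> f k \<in> borel_measurable borel" and "k \<in> {1..K}" and L: "cmod L \<le> 1"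
  shows "cmod (sweep_char P K f (t + n) k x - L)
      \<le> start_err f t k x + kernel_int (sweep_kernel P K t k) (\<lambda>y. cmod (sweep_char P K f n ((cyc K ^^ t) k) y - L)) x"
  using assms(2)
proof (induction t arbitrary: k x)
  case 0
  have "(\<lambda>y. cmod (sweep_char P K f n k y - L)) \<in> borel_measurable borel"
    using sweep_char_meas[where f=f and n=n, OF f 0] by simp
  then show ?case by (simp add: kernel_int_def integral_return)
next
  case (Suc t)
  interpret invariant_kernel \<pi> "P k" by (rule inv_ker[OF Suc.prems])
  note r = cyc_in_range[OF Suc.prems]
  interpret s: invariant_kernel \<pi> "sweep_kernel P K t (cyc K k)" by (rule sweep_kernel_invariant[OF r])
  interpret Px: prob_space "P k x" by (rule prob_kernelD(1)[OF ker])
  let ?F = "sweep_char P K f (t + n) (cyc K k)"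
  define j where "j = (cyc K ^^ t) (cyc K k)"
  have j: "j \<in> {1..K}" unfolding j_def by (rule cyc_iter_in_range[OF r])
  let ?h = "\<lambda>y. cmod (sweep_char P K f n j y - L)"
  note Fm = sweep_char_meas[where f=f and n="t + n", OF f r] and F1 = sweep_char_norm[where f=f and n="t + n", OF f r]
  have hm: "?h \<in> borel_measurable borel" using sweep_char_meas[where f=f and n=n, OF f j] by simp
  have h2: "?h y \<le> 2" for y
    using norm_triangle_ineq4[of "sweep_char P K f n j y" L] sweep_char_norm[where f=f and n=n and x=y, OF f j] L by simp
  have Fi: "integrable (P k x) ?F"
    by (rule Px.integrable_const_bound[of _ 1]) (use F1 borel_measurable_kernel[OF ker Fm] in auto)
  have bint: "integrable (P k x \<bind> sweep_kernel P K t (cyc K k)) ?h"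
  proof -
    have p: "prob_space (P k x \<bind> sweep_kernel P K t (cyc K k))"
      using prob_kernelD(1)[OF sweep_kernel_prob[OF Suc.prems], of "Suc t" x] by simp
    have "sets (P k x \<bind> sweep_kernel P K t (cyc K k)) = sets borel"
      by (rule sets_bind_kernel[OF s.ker prob_kernelD(2)[OF ker]])
    then have "?h \<in> borel_measurable (P k x \<bind> sweep_kernel P K t (cyc K k))"
      using hm measurable_cong_sets by blast
    then show ?thesis
      using h2 by (intro finite_measure.integrable_const_bound[OF prob_space.finite_measure[OF p], of _ 2]) auto
  qed
  note ib = integrable_bind_kernel(2,3)[OF s.ker prob_kernelD(2)[OF ker] bint]
  have si: "integrable (P k x) (start_err f t (cyc K k))"
    using start_err_props[where f=f and t=t, OF f r]
    by (intro Px.integrable_const_bound[of _ "2 * real t"] kernel_meas) auto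
  \<comment> \<open>Replacing the first factor by 1 costs at most |exp(i f) - 1|, as the factor it
    multiplies has modulus at most 1.\<close>
  have "sweep_char P K f (Suc t + n) k x - L = (iexp (f k x) - 1) * kernel_cint (P k) ?F x + (kernel_cint (P k) ?F x - L)"
    by (simp add: algebra_simps)
  then have "cmod (sweep_char P K f (Suc t + n) k x - L)
      \<le> cmod (iexp (f k x) - 1) * cmod (kernel_cint (P k) ?F x) + cmod (kernel_cint (P k) ?F x - L)"
    using norm_triangle_ineq[of "(iexp (f k x) - 1) * kernel_cint (P k) ?F x" "kernel_cint (P k) ?F x - L"]
    by (simp only: norm_mult)
  also have "\<dots> \<le> cmod (iexp (f k x) - 1) * 1 + (LINT y|P k x. start_err f t (cyc K k) y + kernel_int (sweep_kernel P K t (cyc K k)) ?h y)"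
  proof (intro add_mono mult_left_mono)
    \<comment> \<open>One more step multiplies the kernel integral by a number of modulus 1, so the
      bound for \<open>sweep_char\<close> transfers to it.\<close>
    have "cmod (sweep_char P K f (Suc (t + n)) k x) \<le> 1" by (rule sweep_char_norm[OF f Suc.prems])
    then show "cmod (kernel_cint (P k) ?F x) \<le> 1" by (simp add: norm_mult)
    have "kernel_cint (P k) ?F x - L = (CLINT y|P k x. ?F y - L)"
      unfolding kernel_cint_def using Fi by (simp add: Px.prob_space)
    then have "cmod (kernel_cint (P k) ?F x - L) \<le> (LINT y|P k x. cmod (?F y - L))" by (simp only: integral_norm_bound)
    also have "\<dots> \<le> (LINT y|P k x. start_err f t (cyc K k) y + kernel_int (sweep_kernel P K t (cyc K k)) ?h y)"
      using Fi si ib(1) Suc.IH[OF r] by (intro integral_mono) (auto simp: kernel_int_def[abs_def] j_def)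
    finally show "cmod (kernel_cint (P k) ?F x - L) \<le> \<dots>" .
  qed simp
  also have "\<dots> = start_err f (Suc t) k x + kernel_int (sweep_kernel P K (Suc t) k) ?h x"
    using si ib by (simp add: kernel_int_def[abs_def])
  finally show ?case by (simp add: j_def funpow_swap1)
qed

text \<open>Cut off j cycles for each j < J and average over j. The laws of the state after j cycles
  from x, averaged, integrate bounded functions almost like pi, with an error of order 1 / J uniform
  in M, and under pi the deviation from L is small. J is fixed before M grows.\<close>

theorem pointwise_clt:
  assumes f: "\<And>k. k \<in> {1..K} \<Longrightarrow> f k \<in> borel_measurable borel" and k: "k \<in> {1..K}" and L: "cmod L \<le> 1"
    and stat: "\<And>s. (\<lambda>M. LINT x|\<pi>. cmod (sweep_char P K (\<lambda>k x. f k x / sqrt (real M)) (M - s) k x - L)) \<longlonglongrightarrow> 0"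
    and erg: "\<And>u c x n. u \<in> borel_measurable borel \<Longrightarrow> 0 \<le> c \<Longrightarrow> (\<And>x. \<bar>u x\<bar> \<le> c) \<Longrightarrow> 0 < n \<Longrightarrow>
      \<bar>(\<Sum>j<n. LINT y|kernel_power (sweep_kernel P K K k) j x. u y) / real n - (LINT x|\<pi>. u x)\<bar> \<le> B x * c / real n"
  shows "(\<lambda>M. sweep_char P K (\<lambda>k x. f k x / sqrt (real M)) M k x) \<longlonglongrightarrow> L"
proof (rule LIMSEQ_I)
  fix e :: real assume e: "0 < e"
  define g where "g M = (\<lambda>k x. f k x / sqrt (real M))" for M :: nat
  have gm: "g M k \<in> borel_measurable borel" if "k \<in> {1..K}" for M k
    unfolding g_def using f[OF that] by simp
  \<comment> \<open>Makes the ergodic error 2 * B x / J of functions bounded by 2 smaller than e /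
    2, whatever M is.\<close>
  define J where "J = Suc (nat \<lceil>8 * \<bar>B x\<bar> / e\<rceil>)"
  have J0: "0 < J" by (simp add: J_def)
  have "8 * \<bar>B x\<bar> / e < real J" unfolding J_def by linarith
  then have J: "B x * 2 / real J < e / 2"
    using e J0 abs_ge_self[of "B x"] by (simp add: field_simps)
  define h where "h M j y = cmod (sweep_char P K (g M) (M - j * K) k y - L)" for M j y
  \<comment> \<open>After j cycles M - j * K summands remain, so the deviation depends on j, whereas
    the ergodic average needs one function. \<open>H\<close> dominates all of them; truncation at 2
    keeps its supremum, and with it the choice of J, free of J itself.\<close>
  define H where "H M y = min 2 (\<Sum>j<J. h M j y)" for M y
  have hm: "h M j \<in> borel_measurable borel" for M j
    unfolding h_def[abs_def] using sweep_char_meas[where f="g M" and n="M - j * K", OF gm k] by simp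
  have h0: "0 \<le> h M j y" for M j y by (simp add: h_def)
  have h2: "h M j y \<le> 2" for M j y
    unfolding h_def using norm_triangle_ineq4[of "sweep_char P K (g M) (M - j * K) k y" L]
      sweep_char_norm[where f="g M" and n="M - j * K" and x=y, OF gm k] L by simp
  have Hm: "H M \<in> borel_measurable borel" for M
    unfolding H_def[abs_def] by (intro borel_measurable_min borel_measurable_sum hm) simp
  have H02: "0 \<le> H M y" "H M y \<le> 2" for M y unfolding H_def using h0 by (auto intro: sum_nonneg)
  have hH: "h M j y \<le> H M y" if "j < J" for M j y
    unfolding H_def using h2 h0 that by (auto intro!: member_le_sum)
  have hint: "integrable \<pi> (h M j)" for M j
    by (rule integrable_const_bound[of _ 2]) (use h0 h2 meas_pi[OF hm] in auto)
  have Hint: "integrable \<pi> (H M)" for M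
    by (rule integrable_const_bound[of _ 2]) (use H02 meas_pi[OF Hm] in auto)
  have "(\<lambda>M. \<Sum>j<J. LINT x|\<pi>. h M j x) \<longlonglongrightarrow> (\<Sum>j<J. 0)"
    unfolding h_def g_def by (intro tendsto_sum stat)
  then have "(\<lambda>M. \<Sum>j<J. LINT x|\<pi>. h M j x) \<longlonglongrightarrow> 0" by simp
  then have ev1: "\<forall>\<^sub>F M in sequentially. (\<Sum>j<J. LINT x|\<pi>. h M j x) < e / 4"
    using e by (intro order_tendstoD) auto
  have "(\<lambda>M. (\<Sum>j<J. start_err (g M) (j * K) k x) / real J) \<longlonglongrightarrow> (\<Sum>j<J. 0) / real J"
    unfolding g_def using J0 by (intro tendsto_intros start_err_tendsto_0 f k) auto
  then have ev2: "\<forall>\<^sub>F M in sequentially. (\<Sum>j<J. start_err (g M) (j * K) k x) / real J < e / 4"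
    using e by (intro order_tendstoD) auto
  have "\<forall>\<^sub>F M in sequentially. cmod (sweep_char P K (g M) M k x - L) < e"
    using ev1 ev2 eventually_ge_at_top[of "J * K"]
  proof eventually_elim
    case (elim M)
    let ?c = "cmod (sweep_char P K (g M) M k x - L)"
    have "?c \<le> start_err (g M) (j * K) k x + (LINT y|kernel_power (sweep_kernel P K K k) j x. H M y)" if j: "j < J" for j
    proof -
      have "j * K \<le> M" using j elim(3) by (meson le_trans less_imp_le mult_le_mono1)
      then have M: "M = j * K + (M - j * K)" by simp
      have eq: "kernel_power (sweep_kernel P K K k) j = sweep_kernel P K (j * K) k"
        by (rule ext) (rule kernel_power_sweep[OF k])
      interpret s: invariant_kernel \<pi> "sweep_kernel P K (j * K) k" by (rule sweep_kernel_invariant[OF k])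
      interpret sx: prob_space "sweep_kernel P K (j * K) k x" by (rule prob_kernelD(1)[OF s.ker])
      have "?c \<le> start_err (g M) (j * K) k x + kernel_int (sweep_kernel P K (j * K) k) (h M j) x"
        using sweep_char_shift_bound[where f="g M" and t="j * K" and n="M - j * K" and x=x, OF gm k L] M
        by (simp add: cyc_iter_mult[OF k] h_def[abs_def])
      also have "kernel_int (sweep_kernel P K (j * K) k) (h M j) x \<le> kernel_int (sweep_kernel P K (j * K) k) (H M) x"
        unfolding kernel_int_def
      proof (intro integral_mono hH j)
        show "integrable (sweep_kernel P K (j * K) k x) (h M j)"
          by (rule sx.integrable_const_bound[of _ 2]) (use h0 h2 s.kernel_meas[OF hm] in auto)
        show "integrable (sweep_kernel P K (j * K) k x) (H M)"
          by (rule sx.integrable_const_bound[of _ 2]) (use H02 s.kernel_meas[OF Hm] in auto)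
      qed
      finally show ?thesis by (simp add: eq kernel_int_def)
    qed
    then have "(\<Sum>j<J. ?c) \<le> (\<Sum>j<J. start_err (g M) (j * K) k x + (LINT y|kernel_power (sweep_kernel P K K k) j x. H M y))"
      by (intro sum_mono) auto
    then have "?c \<le> (\<Sum>j<J. start_err (g M) (j * K) k x) / real J
        + (\<Sum>j<J. LINT y|kernel_power (sweep_kernel P K K k) j x. H M y) / real J"
      using J0 by (simp add: sum.distrib field_simps)
    moreover have "(\<Sum>j<J. LINT y|kernel_power (sweep_kernel P K K k) j x. H M y) / real J \<le> (LINT x|\<pi>. H M x) + B x * 2 / real J"
      using erg[OF Hm _ _ J0, of 2 M x] H02 by (auto simp: abs_le_iff)
    moreover have "(LINT x|\<pi>. H M x) \<le> (\<Sum>j<J. LINT x|\<pi>. h M j x)"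
    proof -
      have "(LINT x|\<pi>. H M x) \<le> (LINT x|\<pi>. (\<Sum>j<J. h M j x))"
        using Hint hint by (intro integral_mono) (auto simp: H_def)
      then show ?thesis using hint by simp
    qed
    ultimately show ?case using elim J by linarith
  qed
  then show "\<exists>N. \<forall>M\<ge>N. norm (sweep_char P K (\<lambda>k x. f k x / sqrt (real M)) M k x - L) < e"
    by (simp add: eventually_sequentially g_def)
qed

end

section \<open>Characteristic functions along the chain\<close>

lemma emeasure_density_distr:
  assumes "X \<in> M \<rightarrow>\<^sub>M N" "Y \<in> borel_measurable M" "A \<in> sets N"
  shows "emeasure (distr (density M Y) N X) A = (\<integral>\<^sup>+\<omega>. Y \<omega> * indicator A (X \<omega>) \<partial>M)"
proof -
  have X: "X \<in> density M Y \<rightarrow>\<^sub>M N" using assms(1) by simp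
  have "emeasure (distr (density M Y) N X) A = emeasure (density M Y) (X -` A \<inter> space M)"
    using emeasure_distr[OF X assms(3)] by simp
  also have "\<dots> = (\<integral>\<^sup>+\<omega>. Y \<omega> * indicator (X -` A \<inter> space M) \<omega> \<partial>M)"
    using assms by (intro emeasure_density measurable_sets)
  also have "\<dots> = (\<integral>\<^sup>+\<omega>. Y \<omega> * indicator A (X \<omega>) \<partial>M)"
    by (intro nn_integral_cong) (auto simp: indicator_def)
  finally show ?thesis .
qed

text \<open>A single transition, stripped of time: F is the past, X the present and X' the next
  state.\<close>

locale markov_step = prob_space M for M :: "'w measure" +
  fixes F :: "'w measure" and X X' :: "'w \<Rightarrow> 'a::topological_space" and P :: "'a \<Rightarrow> 'a measure"
  assumes sub: "subalgebra M F" and X: "X \<in> M \<rightarrow>\<^sub>M borel" and X': "X' \<in> M \<rightarrow>\<^sub>M borel" and ker: "prob_kernel P"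
    and cond: "\<And>A. A \<in> sets borel \<Longrightarrow> AE \<omega> in M.
      real_cond_exp M F (\<lambda>\<omega>. indicator A (X' \<omega>)) \<omega> = measure (P (X \<omega>)) A"
begin

sublocale finite_measure_subalgebra M F by unfold_locales (rule sub)

text \<open>With Y as a density on the sample space, the conditional probabilities of sets say that
  the law of X' is the law of X followed by P. An equality of measures yields all nonnegative u at
  once.\<close>

lemma step_nn:
  fixes Y :: "'w \<Rightarrow> real"
  assumes Y: "Y \<in> borel_measurable F" "\<And>\<omega>. 0 \<le> Y \<omega>" "\<And>\<omega>. Y \<omega> \<le> c" and u: "u \<in> borel_measurable borel"
  shows "(\<integral>\<^sup>+\<omega>. ennreal (Y \<omega>) * u (X' \<omega>) \<partial>M) = (\<integral>\<^sup>+\<omega>. ennreal (Y \<omega>) * (\<integral>\<^sup>+y. u y \<partial>P (X \<omega>)) \<partial>M)"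
proof -
  have YM: "Y \<in> borel_measurable M" by (rule measurable_from_subalg[OF sub Y(1)])
  then have YM': "(\<lambda>\<omega>. ennreal (Y \<omega>)) \<in> borel_measurable M" by simp
  let ?D = "density M (\<lambda>\<omega>. ennreal (Y \<omega>))"
  let ?m = "distr ?D borel X"
  have eq: "distr ?D borel X' = ?m \<bind> P"
  proof (rule measure_eqI)
    show "sets (distr ?D borel X') = sets (?m \<bind> P)"
      using sets_bind_kernel[OF ker, of ?m] by simp
    fix A assume "A \<in> sets (distr ?D borel X')"
    then have A: "A \<in> sets borel" by simp
    have mP: "(\<lambda>x. measure (P x) A) \<in> borel_measurable borel"
      using prob_kernelD(4)[OF ker] A by measurable
    have em: "emeasure (P x) A = ennreal (measure (P x) A)" for x
      using prob_space.finite_measure[OF prob_kernelD(1)[OF ker]]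
      by (simp add: finite_measure.emeasure_eq_measure)
    have le1: "measure (P x) A \<le> 1" for x
      using prob_space.prob_le_1[OF prob_kernelD(1)[OF ker]] .
    have indm: "(\<lambda>\<omega>. indicat_real A (X' \<omega>)) \<in> borel_measurable M"
      by (rule measurable_compose[OF X']) (use A in simp)
    have mPX: "(\<lambda>\<omega>. measure (P (X \<omega>)) A) \<in> borel_measurable M" by (rule measurable_compose[OF X mP])
    have c0: "0 \<le> c" using Y(2,3) order_trans by blast
    have i1: "integrable M (\<lambda>\<omega>. Y \<omega> * indicat_real A (X' \<omega>))"
      by (rule integrable_const_bound[of _ c]) (use Y c0 YM indm in \<open>auto simp: indicator_def\<close>)
    have i2: "integrable M (\<lambda>\<omega>. Y \<omega> * measure (P (X \<omega>)) A)"
    proof (rule integrable_const_bound[of _ "c * 1"])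
      show "AE \<omega> in M. norm (Y \<omega> * measure (P (X \<omega>)) A) \<le> c * 1"
      proof (rule AE_I2)
        fix \<omega>
        show "norm (Y \<omega> * measure (P (X \<omega>)) A) \<le> c * 1"
          using mult_mono[OF Y(3)[of \<omega>] le1[of "X \<omega>"] c0 measure_nonneg] Y(2)[of \<omega>] by (simp add: abs_mult)
      qed
    qed (use YM mPX in simp)
    have "(LINT \<omega>|M. Y \<omega> * indicat_real A (X' \<omega>))
        = (LINT \<omega>|M. Y \<omega> * real_cond_exp M F (\<lambda>\<omega>. indicat_real A (X' \<omega>)) \<omega>)"
      by (rule real_cond_exp_intg(2)[OF i1 Y(1) indm, symmetric])
    also have "\<dots> = (LINT \<omega>|M. Y \<omega> * measure (P (X \<omega>)) A)"
      using cond[OF A] YM mPX by (intro integral_cong_AE) (auto elim: eventually_mono)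
    finally have e: "(LINT \<omega>|M. Y \<omega> * indicat_real A (X' \<omega>)) = (LINT \<omega>|M. Y \<omega> * measure (P (X \<omega>)) A)" .
    have "emeasure (distr ?D borel X') A = (\<integral>\<^sup>+\<omega>. ennreal (Y \<omega> * indicat_real A (X' \<omega>)) \<partial>M)"
      unfolding emeasure_density_distr[OF X' YM' A]
      by (intro nn_integral_cong) (auto simp: indicator_def)
    also have "\<dots> = ennreal (LINT \<omega>|M. Y \<omega> * indicat_real A (X' \<omega>))"
      using Y by (intro nn_integral_eq_integral i1) auto
    also have "\<dots> = (\<integral>\<^sup>+\<omega>. ennreal (Y \<omega> * measure (P (X \<omega>)) A) \<partial>M)"
      unfolding e using Y by (intro nn_integral_eq_integral[symmetric] i2) auto
    also have "\<dots> = (\<integral>\<^sup>+\<omega>. ennreal (Y \<omega>) * emeasure (P (X \<omega>)) A \<partial>M)"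
      using Y by (simp add: em ennreal_mult)
    also have "\<dots> = (\<integral>\<^sup>+\<omega>. emeasure (P (X \<omega>)) A \<partial>?D)"
      using YM' mPX by (subst nn_integral_density) (auto simp: em)
    also have "\<dots> = (\<integral>\<^sup>+x. emeasure (P x) A \<partial>?m)"
      using X mP by (subst nn_integral_distr) (auto simp: em)
    also have "\<dots> = emeasure (?m \<bind> P) A"
      using A prob_kernel_subprob[OF ker, of ?m] by (intro emeasure_bind[symmetric]) auto
    finally show "emeasure (distr ?D borel X') A = emeasure (?m \<bind> P) A" .
  qed
  have uX: "(\<lambda>\<omega>. u (X' \<omega>)) \<in> borel_measurable M" by (rule measurable_compose[OF X' u])
  have kX: "(\<lambda>\<omega>. \<integral>\<^sup>+y. u y \<partial>P (X \<omega>)) \<in> borel_measurable M"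
    by (rule measurable_compose[OF X measurable_kernel_nn_integral[OF ker u]])
  have "(\<integral>\<^sup>+\<omega>. ennreal (Y \<omega>) * u (X' \<omega>) \<partial>M) = (\<integral>\<^sup>+x. u x \<partial>distr ?D borel X')"
    using X' u uX YM' by (simp add: nn_integral_distr nn_integral_density)
  also have "\<dots> = (\<integral>\<^sup>+x. \<integral>\<^sup>+y. u y \<partial>P x \<partial>?m)"
    unfolding eq by (rule nn_integral_bind_kernel[OF ker _ u]) simp
  also have "\<dots> = (\<integral>\<^sup>+\<omega>. ennreal (Y \<omega>) * (\<integral>\<^sup>+y. u y \<partial>P (X \<omega>)) \<partial>M)"
    using X measurable_kernel_nn_integral[OF ker u] kX YM' by (simp add: nn_integral_distr nn_integral_density)
  finally show ?thesis .
qed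

lemma kernel_int_bound:
  assumes "u \<in> borel_measurable borel" "\<And>x. \<bar>u x\<bar> \<le> c"
  shows "\<bar>kernel_int P u x\<bar> \<le> c" "integrable (P x) u"
proof -
  interpret Px: prob_space "P x" by (rule prob_kernelD(1)[OF ker])
  show i: "integrable (P x) u"
    by (rule Px.integrable_const_bound[of _ c]) (use assms borel_measurable_kernel[OF ker] in auto)
  have "\<bar>kernel_int P u x\<bar> \<le> (LINT y|P x. \<bar>u y\<bar>)" unfolding kernel_int_def by (rule integral_abs_bound)
  also have "\<dots> \<le> (LINT y|P x. c)" using i assms(2) by (intro integral_mono) auto
  finally show "\<bar>kernel_int P u x\<bar> \<le> c" by (simp add: Px.prob_space)
qed

lemma prod_integrable:
  fixes Y Z :: "'w \<Rightarrow> real"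
  assumes "Y \<in> borel_measurable M" "\<And>\<omega>. \<bar>Y \<omega>\<bar> \<le> c" "Z \<in> borel_measurable M" "\<And>\<omega>. \<bar>Z \<omega>\<bar> \<le> d"
  shows "integrable M (\<lambda>\<omega>. Y \<omega> * Z \<omega>)"
proof (rule integrable_const_bound[of _ "c * d"])
  have "0 \<le> c" using assms(2) abs_ge_zero order_trans by blast
  then show "AE \<omega> in M. norm (Y \<omega> * Z \<omega>) \<le> c * d"
    using assms(2,4) by (auto simp: abs_mult intro!: mult_mono)
qed (use assms in simp)

lemma kernel_intX_meas: "u \<in> borel_measurable borel \<Longrightarrow> (\<lambda>\<omega>. kernel_int P u (X \<omega>)) \<in> borel_measurable M"
  unfolding kernel_int_def by (rule measurable_compose[OF X measurable_kernel_integral[OF ker]])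

lemma step_real_nonneg:
  assumes Y: "Y \<in> borel_measurable F" "\<And>\<omega>. 0 \<le> Y \<omega>" "\<And>\<omega>. Y \<omega> \<le> c"
    and u: "u \<in> borel_measurable borel" "\<And>x. 0 \<le> u x" "\<And>x. u x \<le> d"
  shows "(LINT \<omega>|M. Y \<omega> * u (X' \<omega>)) = (LINT \<omega>|M. Y \<omega> * kernel_int P u (X \<omega>))"
proof -
  have YM: "Y \<in> borel_measurable M" by (rule measurable_from_subalg[OF sub Y(1)])
  have ub: "\<bar>u x\<bar> \<le> d" for x using u by simp
  have nn: "0 \<le> kernel_int P u x" for x unfolding kernel_int_def using u by (intro integral_nonneg_AE) auto
  have e: "(\<integral>\<^sup>+y. ennreal (u y) \<partial>P x) = ennreal (kernel_int P u x)" for x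
    unfolding kernel_int_def using u kernel_int_bound(2)[OF u(1) ub] by (intro nn_integral_eq_integral) auto
  have uX: "(\<lambda>\<omega>. u (X' \<omega>)) \<in> borel_measurable M" by (rule measurable_compose[OF X' u(1)])
  have "ennreal (LINT \<omega>|M. Y \<omega> * u (X' \<omega>)) = (\<integral>\<^sup>+\<omega>. ennreal (Y \<omega> * u (X' \<omega>)) \<partial>M)"
    using Y u by (intro nn_integral_eq_integral[symmetric] prod_integrable[of _ c _ d] YM uX) auto
  also have "\<dots> = (\<integral>\<^sup>+\<omega>. ennreal (Y \<omega>) * ennreal (u (X' \<omega>)) \<partial>M)"
    using Y u by (simp add: ennreal_mult)
  also have "\<dots> = (\<integral>\<^sup>+\<omega>. ennreal (Y \<omega>) * (\<integral>\<^sup>+y. ennreal (u y) \<partial>P (X \<omega>)) \<partial>M)"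
    by (rule step_nn[OF Y]) (use u in simp)
  also have "\<dots> = (\<integral>\<^sup>+\<omega>. ennreal (Y \<omega> * kernel_int P u (X \<omega>)) \<partial>M)"
    unfolding e using Y nn by (simp add: ennreal_mult)
  also have "\<dots> = ennreal (LINT \<omega>|M. Y \<omega> * kernel_int P u (X \<omega>))"
    using Y nn kernel_int_bound(1)[OF u(1) ub]
    by (intro nn_integral_eq_integral prod_integrable[of _ c _ d] YM kernel_intX_meas u) auto
  finally show ?thesis
    using Y u nn by (subst (asm) ennreal_inj) (auto intro!: integral_nonneg_AE)
qed

text \<open>Adding the bounds c and d makes both factors nonnegative, and the terms produced by the
  shift agree on the two sides.\<close>

lemma step_real:
  assumes Y: "Y \<in> borel_measurable F" "\<And>\<omega>. \<bar>Y \<omega>\<bar> \<le> c"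
    and u: "u \<in> borel_measurable borel" "\<And>x. \<bar>u x\<bar> \<le> d"
  shows "(LINT \<omega>|M. Y \<omega> * u (X' \<omega>)) = (LINT \<omega>|M. Y \<omega> * kernel_int P u (X \<omega>))"
proof -
  have YM: "Y \<in> borel_measurable M" by (rule measurable_from_subalg[OF sub Y(1)])
  have YF: "(\<lambda>\<omega>. Y \<omega> + c) \<in> borel_measurable F" using Y(1) by simp
  have uX: "(\<lambda>\<omega>. u (X' \<omega>)) \<in> borel_measurable M" by (rule measurable_compose[OF X' u(1)])
  have c: "0 \<le> Y \<omega> + c" "Y \<omega> + c \<le> 2 * c" for \<omega> using Y(2)[of \<omega>] by (auto simp: abs_le_iff)
  have d: "0 \<le> u x + d" "u x + d \<le> 2 * d" for x using u(2)[of x] by (auto simp: abs_le_iff)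
  have cc: "0 \<le> c" using Y(2) abs_ge_zero order_trans by blast
  have dd: "0 \<le> d" using u(2) abs_ge_zero order_trans by blast
  have shift: "kernel_int P (\<lambda>y. u y + d) x = kernel_int P u x + d" for x
  proof -
    interpret Px: prob_space "P x" by (rule prob_kernelD(1)[OF ker])
    show ?thesis unfolding kernel_int_def using kernel_int_bound(2)[OF u] by (simp add: Px.prob_space)
  qed
  have cst: "kernel_int P (\<lambda>y. d) x = d" for x
    using prob_space.prob_space[OF prob_kernelD(1)[OF ker]] by (simp add: kernel_int_def)
  have A: "(LINT \<omega>|M. (Y \<omega> + c) * (u (X' \<omega>) + d)) = (LINT \<omega>|M. (Y \<omega> + c) * (kernel_int P u (X \<omega>) + d))"
    using step_real_nonneg[OF YF c, of "\<lambda>y. u y + d" "2 * d"] u(1) d unfolding shift by auto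
  have B: "(LINT \<omega>|M. c * (u (X' \<omega>) + d)) = (LINT \<omega>|M. c * (kernel_int P u (X \<omega>) + d))"
    using step_real_nonneg[of "\<lambda>_. c" c "\<lambda>y. u y + d" "2 * d"] u(1) d cc unfolding shift by auto
  note i = prod_integrable[OF YM Y(2) uX u(2)] prod_integrable[OF YM Y(2) kernel_intX_meas[OF u(1)] kernel_int_bound(1)[OF u]]
  have iY: "integrable M Y" by (rule integrable_const_bound[of _ c]) (use Y YM in auto)
  have iu: "integrable M (\<lambda>\<omega>. u (X' \<omega>))" by (rule integrable_const_bound[of _ d]) (use u uX in auto)
  have ik: "integrable M (\<lambda>\<omega>. kernel_int P u (X \<omega>))"
    by (rule integrable_const_bound[of _ d]) (use kernel_int_bound(1)[OF u] kernel_intX_meas[OF u(1)] in auto)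
  have exp: "(LINT \<omega>|M. (Y \<omega> + c) * (Z \<omega> + d)) - (LINT \<omega>|M. c * (Z \<omega> + d)) = (LINT \<omega>|M. Y \<omega> * Z \<omega>) + d * (LINT \<omega>|M. Y \<omega>)"
    if "integrable M Z" "integrable M (\<lambda>\<omega>. Y \<omega> * Z \<omega>)" for Z
  proof -
    have "(LINT \<omega>|M. (Y \<omega> + c) * (Z \<omega> + d)) = (LINT \<omega>|M. Y \<omega> * Z \<omega> + d * Y \<omega> + c * (Z \<omega> + d))"
      by (intro Bochner_Integration.integral_cong) (auto simp: algebra_simps)
    then show ?thesis using that iY by simp
  qed
  show ?thesis using exp[OF iu i(1)] exp[OF ik i(2)] A B by linarith
qed

lemma step_complex:
  fixes Y :: "'w \<Rightarrow> complex" and u :: "'a \<Rightarrow> complex"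
  assumes Y: "Y \<in> borel_measurable F" "\<And>\<omega>. cmod (Y \<omega>) \<le> 1"
    and u: "u \<in> borel_measurable borel" "\<And>x. cmod (u x) \<le> 1"
  shows "(CLINT \<omega>|M. Y \<omega> * u (X' \<omega>)) = (CLINT \<omega>|M. Y \<omega> * kernel_cint P u (X \<omega>))"
proof -
  have YM: "Y \<in> borel_measurable M" by (rule measurable_from_subalg[OF sub Y(1)])
  have uX: "(\<lambda>\<omega>. u (X' \<omega>)) \<in> borel_measurable M" by (rule measurable_compose[OF X' u(1)])
  have kX: "(\<lambda>\<omega>. kernel_cint P u (X \<omega>)) \<in> borel_measurable M"
    unfolding kernel_cint_def by (rule measurable_compose[OF X measurable_kernel_integral[OF ker u(1)]])
  have uP: "integrable (P x) u" for x
  proof -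
    interpret Px: prob_space "P x" by (rule prob_kernelD(1)[OF ker])
    show ?thesis by (rule Px.integrable_const_bound[of _ 1]) (use u borel_measurable_kernel[OF ker] in auto)
  qed
  have k1: "cmod (kernel_cint P u x) \<le> 1" for x
  proof -
    interpret Px: prob_space "P x" by (rule prob_kernelD(1)[OF ker])
    have "cmod (kernel_cint P u x) \<le> (LINT y|P x. cmod (u y))" unfolding kernel_cint_def by (rule integral_norm_bound)
    also have "\<dots> \<le> (LINT y|P x. 1)" using uP u(2) by (intro integral_mono) auto
    finally show ?thesis by (simp add: Px.prob_space)
  qed
  have k: "Re (kernel_cint P u x) = kernel_int P (\<lambda>y. Re (u y)) x" "Im (kernel_cint P u x) = kernel_int P (\<lambda>y. Im (u y)) x" for x
    unfolding kernel_cint_def kernel_int_def using uP by simp_all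
  have b: "\<bar>Re (Y \<omega>)\<bar> \<le> 1" "\<bar>Im (Y \<omega>)\<bar> \<le> 1" for \<omega>
    using Y(2)[of \<omega>] abs_Re_le_cmod[of "Y \<omega>"] abs_Im_le_cmod[of "Y \<omega>"] by linarith+
  have ub: "\<bar>Re (u x)\<bar> \<le> 1" "\<bar>Im (u x)\<bar> \<le> 1" for x
    using u(2)[of x] abs_Re_le_cmod[of "u x"] abs_Im_le_cmod[of "u x"] by linarith+
  have m: "(\<lambda>\<omega>. Re (Y \<omega>)) \<in> borel_measurable F" "(\<lambda>\<omega>. Im (Y \<omega>)) \<in> borel_measurable F"
    "(\<lambda>x. Re (u x)) \<in> borel_measurable borel" "(\<lambda>x. Im (u x)) \<in> borel_measurable borel"
    using Y(1) u(1) by auto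
  note mM = measurable_from_subalg[OF sub m(1)] measurable_from_subalg[OF sub m(2)]
  note s = step_real[OF m(1) b(1) m(3) ub(1)] step_real[OF m(1) b(1) m(4) ub(2)]
    step_real[OF m(2) b(2) m(3) ub(1)] step_real[OF m(2) b(2) m(4) ub(2)]
  have uXr: "(\<lambda>\<omega>. Re (u (X' \<omega>))) \<in> borel_measurable M" "(\<lambda>\<omega>. Im (u (X' \<omega>))) \<in> borel_measurable M"
    using uX by auto
  have p: "integrable M (\<lambda>\<omega>. Y \<omega> * u (X' \<omega>))" "integrable M (\<lambda>\<omega>. Y \<omega> * kernel_cint P u (X \<omega>))"
    using YM uX kX Y(2) u(2) k1
    by (auto intro!: integrable_const_bound[of _ 1] simp: norm_mult mult_le_one)
  note iu = prod_integrable[OF mM(1) b(1) uXr(1) ub(1)] prod_integrable[OF mM(1) b(1) uXr(2) ub(2)]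
    prod_integrable[OF mM(2) b(2) uXr(1) ub(1)] prod_integrable[OF mM(2) b(2) uXr(2) ub(2)]
  note ik = prod_integrable[OF mM(1) b(1) kernel_intX_meas[OF m(3)] kernel_int_bound(1)[OF m(3) ub(1)]]
    prod_integrable[OF mM(1) b(1) kernel_intX_meas[OF m(4)] kernel_int_bound(1)[OF m(4) ub(2)]]
    prod_integrable[OF mM(2) b(2) kernel_intX_meas[OF m(3)] kernel_int_bound(1)[OF m(3) ub(1)]]
    prod_integrable[OF mM(2) b(2) kernel_intX_meas[OF m(4)] kernel_int_bound(1)[OF m(4) ub(2)]]
  show ?thesis
  proof (rule complex_eqI)
    show "Re (CLINT \<omega>|M. Y \<omega> * u (X' \<omega>)) = Re (CLINT \<omega>|M. Y \<omega> * kernel_cint P u (X \<omega>))"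
      using iu ik s by (simp add: integral_Re[OF p(1), symmetric] integral_Re[OF p(2), symmetric] k)
    show "Im (CLINT \<omega>|M. Y \<omega> * u (X' \<omega>)) = Im (CLINT \<omega>|M. Y \<omega> * kernel_cint P u (X \<omega>))"
      using iu ik s by (simp add: integral_Im[OF p(1), symmetric] integral_Im[OF p(2), symmetric] k)
  qed
qed

end

text \<open>The expectation of exp(i times the first s summands) times the conditional
  characteristic function of the remaining n - s is the same for all s <= n; s = n and s = 0 give
  the two sides.\<close>

theorem sweep_chain_char:
  fixes P :: "nat \<Rightarrow> 'a::topological_space \<Rightarrow> 'a measure"
  assumes K: "1 \<le> K" and ker: "\<And>k. k \<in> {1..K} \<Longrightarrow> prob_kernel (P k)"
    and f: "\<And>k. k \<in> {1..K} \<Longrightarrow> f k \<in> borel_measurable borel" and ch: "sweep_chain P K \<nu> M X"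
  shows "(CLINT \<omega>|M. iexp (\<Sum>t<n. f ((cyc K ^^ t) 1) (X t \<omega>))) = (CLINT \<omega>|M. sweep_char P K f n 1 (X 0 \<omega>))"
proof -
  interpret prob_space M using ch by (simp add: sweep_chain_def)
  have X: "X t \<in> M \<rightarrow>\<^sub>M borel" for t using ch by (simp add: sweep_chain_def)
  define c where "c t = (cyc K ^^ t) 1" for t
  have c: "c t \<in> {1..K}" for t unfolding c_def using K by (intro cyc_iter_in_range) simp
  define Fl where "Fl t = vimage_algebra (space M) (\<lambda>\<omega>. \<lambda>i\<in>{..t}. X i \<omega>) (PiM {..t} (\<lambda>_. borel :: 'a measure))" for t
  have rm: "(\<lambda>\<omega>. \<lambda>i\<in>{..t}. X i \<omega>) \<in> M \<rightarrow>\<^sub>M PiM {..t} (\<lambda>_. borel)" for t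
    by (rule measurable_restrict) (rule X)
  have sub: "subalgebra M (Fl t)" for t
    unfolding subalgebra_def Fl_def using measurable_sets[OF rm]
    by (auto simp: sets_vimage_algebra2[OF measurable_space[OF rm, THEN funcsetI]])
  have XF: "X i \<in> Fl t \<rightarrow>\<^sub>M borel" if "i \<le> t" for i t
  proof -
    have "(\<lambda>\<omega>. \<lambda>i\<in>{..t}. X i \<omega>) \<in> Fl t \<rightarrow>\<^sub>M PiM {..t} (\<lambda>_. borel)"
      unfolding Fl_def by (rule measurable_vimage_algebra1[OF measurable_space[OF rm, THEN funcsetI]])
    then have "(\<lambda>\<omega>. (\<lambda>i\<in>{..t}. X i \<omega>) i) \<in> Fl t \<rightarrow>\<^sub>M borel"
      by (rule measurable_compose[OF _ measurable_component_singleton]) (use that in simp)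
    then show ?thesis using that by simp
  qed
  have step: "markov_step M (Fl t) (X t) (X (Suc t)) (P (c t))" for t
    using ch ker[OF c] sub X
    by (unfold_locales) (auto simp: sweep_chain_def Fl_def c_def)
  define Y where "Y t \<omega> = iexp (\<Sum>i<t. f (c i) (X i \<omega>))" for t \<omega>
  have "(CLINT \<omega>|M. Y s \<omega> * sweep_char P K f (n - s) (c s) (X s \<omega>)) = (CLINT \<omega>|M. sweep_char P K f n 1 (X 0 \<omega>))" if "s \<le> n" for s
    using that
  proof (induction s)
    case 0
    then show ?case by (simp add: Y_def c_def)
  next
    case (Suc s)
    interpret markov_step M "Fl s" "X s" "X (Suc s)" "P (c s)" by (rule step)
    have cs: "c (Suc s) = cyc K (c s)" by (simp add: c_def)
    have ns: "n - s = Suc (n - Suc s)" using Suc.prems by simp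
    \<comment> \<open>The summand with index s is a function of the past up to s, so it belongs to
      the factor known before the transition.\<close>
    have YF: "Y (Suc s) \<in> borel_measurable (Fl s)"
    proof -
      have "(\<lambda>\<omega>. f (c i) (X i \<omega>)) \<in> borel_measurable (Fl s)" if "i < Suc s" for i
        by (rule measurable_compose[OF XF f[OF c]]) (use that in simp)
      then have "(\<lambda>\<omega>. \<Sum>i<Suc s. f (c i) (X i \<omega>)) \<in> borel_measurable (Fl s)"
        by (intro borel_measurable_sum) simp
      then show ?thesis unfolding Y_def[abs_def] by measurable
    qed
    have Y1: "cmod (Y (Suc s) \<omega>) \<le> 1" for \<omega> unfolding Y_def by simp
    have "Y s \<omega> * sweep_char P K f (n - s) (c s) (X s \<omega>)
        = Y (Suc s) \<omega> * kernel_cint (P (c s)) (sweep_char P K f (n - Suc s) (c (Suc s))) (X s \<omega>)" for \<omega>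
      unfolding ns sweep_char.simps cs Y_def by (simp add: exp_add distrib_left mult_ac)
    then have "(CLINT \<omega>|M. Y s \<omega> * sweep_char P K f (n - s) (c s) (X s \<omega>))
        = (CLINT \<omega>|M. Y (Suc s) \<omega> * kernel_cint (P (c s)) (sweep_char P K f (n - Suc s) (c (Suc s))) (X s \<omega>))" by simp
    also have "\<dots> = (CLINT \<omega>|M. Y (Suc s) \<omega> * sweep_char P K f (n - Suc s) (c (Suc s)) (X (Suc s) \<omega>))"
    proof -
      have kerr: "\<And>k. k \<in> {1..K} \<Longrightarrow> prob_kernel (P k)" by fact
      show ?thesis
        by (rule step_complex[OF YF Y1 sweep_char_measurable[OF kerr f c] sweep_char_norm_le[OF kerr f c], symmetric])
    qed
    finally show ?case using Suc by simp
  qed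
  from this[of n] show ?thesis by (simp add: Y_def c_def)
qed

section \<open>Weak convergence in several dimensions\<close>

lemma outer_prod_vector: "outer_prod u v *v t = (v \<bullet> t) *\<^sub>R u"
  by (simp add: vec_eq_iff outer_prod_def matrix_vector_mult_def inner_vec_def sum_distrib_left mult_ac)

text \<open>The Schur complement of the entry (i, i). Its form at t is the minimum of the form of S
  along the line t - r e_i, attained at r = (v . t) / c.\<close>

lemma psd_diff_rank_one:
  fixes S :: "real ^ 'd ^ 'd"
  assumes "psd S" and i: "0 < S $ i $ i"
  defines "v \<equiv> S *v axis i 1" and "c \<equiv> S $ i $ i"
  shows "psd (S - (1 / c) *\<^sub>R outer_prod v v)"
proof -
  have sym: "transpose S = S" and pos: "\<And>t. 0 \<le> t \<bullet> (S *v t)" using assms by (auto simp: psd_def)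
  have symm: "x \<bullet> (S *v y) = y \<bullet> (S *v x)" for x y
    using dot_lmul_matrix[of x S y] sym transpose_matrix_vector[of S x] by (simp add: inner_commute)
  have vi: "v $ i = c" by (simp add: v_def c_def matrix_vector_mul_component inner_axis)
  have "transpose (outer_prod v v) = outer_prod v v"
    by (simp add: outer_prod_def transpose_def vec_eq_iff)
  then have "transpose (S - (1 / c) *\<^sub>R outer_prod v v) = S - (1 / c) *\<^sub>R outer_prod v v"
    using sym by (simp add: transpose_def vec_eq_iff)
  moreover have "0 \<le> t \<bullet> ((S - (1 / c) *\<^sub>R outer_prod v v) *v t)" for t
  proof -
    define r where "r = (v \<bullet> t) / c"
    let ?e = "axis i 1 :: real ^ 'd"
    have e: "t \<bullet> (S *v ?e) = v \<bullet> t" "?e \<bullet> (S *v t) = v \<bullet> t" "?e \<bullet> (S *v ?e) = c"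
      using symm[of t ?e] vi by (simp_all add: v_def[symmetric] inner_commute inner_axis)
    have "0 \<le> (t - r *\<^sub>R ?e) \<bullet> (S *v (t - r *\<^sub>R ?e))" by (rule pos)
    also have "\<dots> = t \<bullet> (S *v t) - 2 * r * (v \<bullet> t) + r\<^sup>2 * c"
      by (simp add: matrix_vector_mult_diff_distrib matrix_vector_mult_scaleR inner_diff_left inner_diff_right e
          power2_eq_square) (simp add: algebra_simps)
    also have "\<dots> = t \<bullet> (S *v t) - (v \<bullet> t)\<^sup>2 / c"
      using i unfolding r_def c_def[symmetric] by (simp add: power2_eq_square field_simps)
    also have "\<dots> = t \<bullet> ((S - (1 / c) *\<^sub>R outer_prod v v) *v t)"
      by (simp add: matrix_vector_mult_diff_rdistrib scaleR_matrix_vector_assoc[symmetric] outer_prod_vector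
          inner_diff_right inner_commute power2_eq_square)
    finally show ?thesis .
  qed
  ultimately show ?thesis by (simp add: psd_def)
qed

lemma psd_diag_nonneg: assumes "psd S" shows "0 \<le> S $ i $ i"
proof -
  have "axis i 1 \<bullet> (S *v axis i 1) = S $ i $ i"
    by (simp add: inner_axis' matrix_vector_mul_component inner_axis)
  then show ?thesis using assms unfolding psd_def by metis
qed

text \<open>With zero diagonal the form on e_b + r e_a is linear in r, so nonnegativity at r = 1 and
  r = -1 makes the off-diagonal entry vanish.\<close>

lemma psd_zero_diag:
  fixes S :: "real ^ 'd ^ 'd"
  assumes "psd S" and z: "\<And>i. S $ i $ i = 0" shows "S = 0"
proof -
  have sym: "transpose S = S" and pos: "\<And>t. 0 \<le> t \<bullet> (S *v t)" using assms by (auto simp: psd_def)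
  have e: "axis a 1 \<bullet> (S *v axis b 1) = S $ a $ b" for a b
    by (simp add: inner_axis' matrix_vector_mul_component inner_axis)
  have s: "S $ a $ b = S $ b $ a" for a b using sym by (simp add: transpose_def vec_eq_iff)
  have "S $ a $ b = 0" for a b
  proof -
    have p: "0 \<le> 2 * r * S $ a $ b" for r
      using pos[of "axis b 1 + r *\<^sub>R axis a 1"]
      by (simp add: matrix_vector_right_distrib matrix_vector_mult_scaleR inner_add_left inner_add_right e z s[of b a])
    show ?thesis using p[of 1] p[of "-1"] by simp
  qed
  then show ?thesis by (simp add: vec_eq_iff)
qed

text \<open>Cholesky factorization by induction: a normal vector for the Schur complement plus an
  independent standard normal multiple of v / sqrt c. The number of nonzero diagonal entries drops,
  since entry i becomes 0 and zero entries stay 0.\<close>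

lemma gaussian_exists:
  fixes S :: "real ^ 'd ^ 'd"
  assumes "psd S"
  shows "\<exists>N. prob_space N \<and> sets N = sets borel \<and>
    (\<forall>t. (CLINT y|N. iexp (t \<bullet> y)) = complex_of_real (exp (- (t \<bullet> (S *v t)) / 2)))"
  using assms
proof (induction "card {i. S $ i $ i \<noteq> 0}" arbitrary: S rule: less_induct)
  case less
  show ?case
  proof (cases "\<forall>i. S $ i $ i = 0")
    case True
    then have S: "S = 0" using psd_zero_diag[OF less.prems] by blast
    have m: "(\<lambda>y. iexp (t \<bullet> y)) \<in> borel_measurable borel" for t :: "real ^ 'd"
      by (intro borel_measurable_continuous_onI continuous_intros)
    show ?thesis
      by (rule exI[of _ "return borel 0"]) (simp add: prob_space_return S integral_return[OF _ m])
  next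
    case False
    then obtain i where "S $ i $ i \<noteq> 0" by blast
    then have i: "0 < S $ i $ i" using psd_diag_nonneg[OF less.prems, of i] by simp
    define v c where "v = S *v axis i 1" and "c = S $ i $ i"
    define S' where "S' = S - (1 / c) *\<^sub>R outer_prod v v"
    have c: "0 < c" using i by (simp add: c_def)
    have vi: "v $ i = c" by (simp add: v_def c_def matrix_vector_mul_component inner_axis)
    have S': "psd S'" unfolding S'_def v_def c_def by (rule psd_diff_rank_one[OF less.prems i])
    have diag: "S' $ j $ j = S $ j $ j - (v $ j)\<^sup>2 / c" for j
      by (simp add: S'_def outer_prod_def power2_eq_square)
    \<comment> \<open>Passing to \<open>S'\<close> can only lower the diagonal, and positive
      semidefiniteness keeps it nonnegative.\<close>
    have z: "S' $ j $ j = 0" if "S $ j $ j = 0" for j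
    proof -
      have "0 \<le> (v $ j)\<^sup>2 / c" using c by simp
      then show ?thesis using psd_diag_nonneg[OF S', of j] unfolding diag that by linarith
    qed
    have zi: "S' $ i $ i = 0" unfolding diag vi using c by (simp add: c_def[symmetric] power2_eq_square)
    have "i \<in> {j. S $ j $ j \<noteq> 0}" "i \<notin> {j. S' $ j $ j \<noteq> 0}"
      using i zi by simp_all
    moreover have "{j. S' $ j $ j \<noteq> 0} \<subseteq> {j. S $ j $ j \<noteq> 0}" using z by blast
    ultimately have "{j. S' $ j $ j \<noteq> 0} \<subset> {j. S $ j $ j \<noteq> 0}" by blast
    then have "card {j. S' $ j $ j \<noteq> 0} < card {j. S $ j $ j \<noteq> 0}" by (intro psubset_card_mono) auto
    from less.hyps[OF this S'] obtain N' where N': "prob_space N'" "sets N' = sets borel"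
      and cf: "\<And>t. (CLINT y|N'. iexp (t \<bullet> y)) = complex_of_real (exp (- (t \<bullet> (S' *v t)) / 2))" by blast
    interpret N': prob_space N' by fact
    interpret Z: real_distribution std_normal_distribution by (rule real_dist_normal_dist)
    interpret pair_prob_space N' std_normal_distribution ..
    let ?g = "\<lambda>(y, z). y + (z / sqrt c) *\<^sub>R v"
    have gm: "?g \<in> borel_measurable (N' \<Otimes>\<^sub>M std_normal_distribution)"
    proof -
      have [measurable]: "fst \<in> N' \<Otimes>\<^sub>M std_normal_distribution \<rightarrow>\<^sub>M borel"
        by (rule measurable_compose[OF measurable_fst]) (simp add: measurable_ident_sets[OF N'(2)])
      have [measurable]: "snd \<in> N' \<Otimes>\<^sub>M std_normal_distribution \<rightarrow>\<^sub>M borel"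
        by (rule measurable_compose[OF measurable_snd]) (simp add: measurable_ident_sets)
      show ?thesis unfolding case_prod_beta by measurable
    qed
    have im: "(\<lambda>y. iexp (t \<bullet> y)) \<in> borel_measurable borel" for t :: "real ^ 'd"
      by (intro borel_measurable_continuous_onI continuous_intros)
    show ?thesis
    proof (intro exI[of _ "distr (N' \<Otimes>\<^sub>M std_normal_distribution) borel ?g"] conjI allI)
      show "prob_space (distr (N' \<Otimes>\<^sub>M std_normal_distribution) borel ?g)"
        by (rule prob_space_distr[OF gm])
      show "sets (distr (N' \<Otimes>\<^sub>M std_normal_distribution) borel ?g) = sets borel" by simp
      fix t :: "real ^ 'd"
      define r where "r = (t \<bullet> v) / sqrt c"
      have int: "integrable (N' \<Otimes>\<^sub>M std_normal_distribution) (\<lambda>p. iexp (t \<bullet> ?g p))"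
        by (rule integrable_const_bound[of _ 1]) (use measurable_compose[OF gm im] in auto)
      have split: "iexp (t \<bullet> ?g (y, z)) = iexp (t \<bullet> y) * iexp (r * z)" for y z
        unfolding exp_add[symmetric]
        by (rule arg_cong[where f=exp]) (simp add: inner_add_right r_def algebra_simps)
      have "(CLINT y|distr (N' \<Otimes>\<^sub>M std_normal_distribution) borel ?g. iexp (t \<bullet> y))
          = (CLINT p|N' \<Otimes>\<^sub>M std_normal_distribution. iexp (t \<bullet> ?g p))"
        by (rule integral_distr[OF gm im])
      also have "\<dots> = (CLINT y|N'. CLINT z|std_normal_distribution. iexp (t \<bullet> ?g (y, z)))"
        by (rule integral_fst'[OF int, symmetric])
      also have "\<dots> = (CLINT y|N'. iexp (t \<bullet> y) * char std_normal_distribution r)"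
        unfolding split char_def by (simp only: integral_mult_right_zero)
      also have "\<dots> = complex_of_real (exp (- (t \<bullet> (S' *v t)) / 2)) * complex_of_real (exp (- (r\<^sup>2) / 2))"
        by (simp only: integral_mult_left_zero cf char_std_normal_distribution)
      also have "\<dots> = complex_of_real (exp (- (t \<bullet> (S' *v t)) / 2 + - (r\<^sup>2) / 2))"
        by (simp only: exp_add of_real_mult)
      also have "- (t \<bullet> (S' *v t)) / 2 + - (r\<^sup>2) / 2 = - (t \<bullet> (S *v t)) / 2"
        using c by (simp add: S'_def matrix_vector_mult_diff_rdistrib scaleR_matrix_vector_assoc[symmetric]
          outer_prod_vector inner_diff_right r_def power_divide power2_eq_square inner_commute field_simps)
      finally show "(CLINT y|distr (N' \<Otimes>\<^sub>M std_normal_distribution) borel ?g. iexp (t \<bullet> y))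
          = complex_of_real (exp (- (t \<bullet> (S *v t)) / 2))" .
    qed
  qed
qed

section \<open>Trigonometric polynomials and the continuity theorem\<close>

inductive trig_poly :: "(real ^ 'd \<Rightarrow> complex) \<Rightarrow> bool" where
  monomial: "trig_poly (\<lambda>x. a * iexp (t \<bullet> x))"
| add: "trig_poly p \<Longrightarrow> trig_poly q \<Longrightarrow> trig_poly (\<lambda>x. p x + q x)"

lemma trig_poly_const: "trig_poly (\<lambda>x. a)"
  using trig_poly.monomial[of a 0] by simp

lemma trig_poly_mult:
  assumes "trig_poly p" "trig_poly q" shows "trig_poly (\<lambda>x. p x * q x)"
  using assms(1)
proof induction
  case (monomial a t)
  show ?case using assms(2)
  proof induction
    case (monomial b s)
    have "(\<lambda>x. a * iexp (t \<bullet> x) * (b * iexp (s \<bullet> x))) = (\<lambda>x. (a * b) * iexp ((t + s) \<bullet> x))"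
      by (simp add: inner_add_left distrib_left exp_add mult_ac)
    then show ?case using trig_poly.monomial[of "a * b" "t + s"] by simp
  next
    case (add p q)
    then show ?case using trig_poly.add by (simp add: distrib_left)
  qed
next
  case (add p q)
  then show ?case using trig_poly.add by (simp add: distrib_right)
qed

lemma trig_poly_sum: "finite I \<Longrightarrow> (\<And>i. i \<in> I \<Longrightarrow> trig_poly (p i)) \<Longrightarrow> trig_poly (\<lambda>x. \<Sum>i\<in>I. p i x)"
  by (induction I rule: finite_induct) (auto intro: trig_poly_const trig_poly.add)

lemma trig_poly_bounded:
  "trig_poly p \<Longrightarrow> p \<in> borel_measurable borel \<and> (\<exists>B. \<forall>x. cmod (p x) \<le> B)"
proof (induction rule: trig_poly.induct)
  case (monomial a t)
  have "(\<lambda>x. a * iexp (t \<bullet> x)) \<in> borel_measurable borel"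
    by (intro borel_measurable_continuous_onI continuous_intros)
  then show ?case by (auto simp: norm_mult)
next
  case (add p q)
  then obtain A B where "\<And>x. cmod (p x) \<le> A" "\<And>x. cmod (q x) \<le> B" by blast
  then have "cmod (p x + q x) \<le> A + B" for x using norm_triangle_mono by blast
  then show ?case using add by auto
qed

lemma trig_poly_sin:
  "trig_poly (\<lambda>x. complex_of_real (sin (c * x $ i)))"
proof -
  have eq: "complex_of_real (sin (c * x $ i))
      = (1 / (2 * \<i>)) * iexp ((c *\<^sub>R axis i 1) \<bullet> x) + (- 1 / (2 * \<i>)) * iexp ((- (c *\<^sub>R axis i 1)) \<bullet> x)"
    for x :: "real ^ 'a"
    by (simp add: sin_of_real[symmetric] sin_exp_eq inner_axis' divide_simps) (simp add: algebra_simps)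
  show ?thesis unfolding eq by (rule trig_poly.add[OF trig_poly.monomial trig_poly.monomial])
qed

lemma trig_poly_compose_sin:
  fixes q :: "real ^ 'd \<Rightarrow> real"
  assumes "real_polynomial_function q"
  shows "trig_poly (\<lambda>x. complex_of_real (q (\<chi> i. sin (c * x $ i))))"
  using assms
proof (induction rule: real_polynomial_function.induct)
  case (linear h)
  interpret bounded_linear h by fact
  have hs: "h y = (\<Sum>i\<in>UNIV. y $ i * h (axis i 1))" for y
  proof -
    have "h y = h (\<Sum>i\<in>UNIV. y $ i *\<^sub>R axis i 1)"
      using basis_expansion[of y] by (simp add: scalar_mult_eq_scaleR)
    then show ?thesis by (simp add: sum scaleR)
  qed
  have "complex_of_real (h (\<chi> i. sin (c * x $ i)))
      = (\<Sum>i\<in>UNIV. complex_of_real (sin (c * x $ i)) * complex_of_real (h (axis i 1)))" for x :: "real ^ 'd"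
    by (subst hs) simp
  then show ?case
    by (simp only:) (intro trig_poly_sum trig_poly_mult trig_poly_sin trig_poly_const finite)
next
  case (const a)
  show ?case by (rule trig_poly_const)
next
  case (add f g)
  then show ?case using trig_poly.add by (simp only: of_real_add)
next
  case (mult f g)
  then show ?case using trig_poly_mult by (simp only: of_real_mult)
qed

text \<open>Stone-Weierstrass on the cube in the variables sin(c x_i). Since sines stay in the cube
  for every x, the approximant is bounded on the whole space and not only where it is close to
  f.\<close>

lemma trig_approximation:
  fixes f :: "real ^ 'd \<Rightarrow> real"
  assumes f: "continuous_on UNIV f" and B: "\<And>x. \<bar>f x\<bar> \<le> B" and e: "0 < e" and R: "0 < R"
  obtains p :: "real ^ 'd \<Rightarrow> real" where "trig_poly (\<lambda>x. complex_of_real (p x))" "\<And>x. \<bar>p x\<bar> \<le> B + e"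
    "\<And>x. (\<And>i. \<bar>x $ i\<bar> \<le> R) \<Longrightarrow> \<bar>p x - f x\<bar> \<le> e"
proof -
  \<comment> \<open>A quarter period: for |x_i| <= R the value sin(c x_i) determines x_i through
    arcsin.\<close>
  define c where "c = pi / (2 * R)"
  have c: "0 < c" using R by (simp add: c_def)
  \<comment> \<open>Clamping to [-1, 1] only makes \<open>F\<close> continuous on the whole space;
    it does nothing to values of the sine.\<close>
  define F where "F y = f (\<chi> i. arcsin (max (- 1) (min 1 (y $ i))) / c)" for y :: "real ^ 'd"
  have "continuous_on UNIV F"
    unfolding F_def
    by (intro continuous_on_compose2[OF f] continuous_on_vec_lambda continuous_on_divide
        continuous_on_arcsin continuous_intros) (use c in auto)
  then have "continuous_on (cbox (- 1) 1) F" by (rule continuous_on_subset) simp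
  then obtain q where q: "real_polynomial_function q" "\<And>y. y \<in> cbox (- 1) 1 \<Longrightarrow> \<bar>F y - q y\<bar> < e"
    using Stone_Weierstrass_real_polynomial_function[OF compact_cbox _ e] by metis
  define s where "s x = (\<chi> i. sin (c * x $ i))" for x :: "real ^ 'd"
  have s: "s x \<in> cbox (- 1) 1" for x by (simp add: s_def mem_box_cart)
  show thesis
  proof (rule that[of "\<lambda>x. q (s x)"])
    show "trig_poly (\<lambda>x. complex_of_real (q (s x)))"
      unfolding s_def by (rule trig_poly_compose_sin[OF q(1)])
    show "\<bar>q (s x)\<bar> \<le> B + e" for x
      using q(2)[OF s, of x] B[of "\<chi> i. arcsin (max (- 1) (min 1 (s x $ i))) / c"]
      unfolding F_def by linarith
    fix x :: "real ^ 'd" assume x: "\<And>i. \<bar>x $ i\<bar> \<le> R"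
    have "arcsin (max (- 1) (min 1 (s x $ i))) / c = x $ i" for i
    proof -
      have "\<bar>c * x $ i\<bar> \<le> c * R" using x[of i] c by (simp add: abs_mult)
      also have "c * R = pi / 2" using R by (simp add: c_def)
      finally have "arcsin (sin (c * x $ i)) = c * x $ i" by (intro arcsin_sin) auto
      moreover have "max (- 1) (min 1 (s x $ i)) = sin (c * x $ i)" by (simp add: s_def)
      ultimately show ?thesis using c by simp
    qed
    then have "F (s x) = f x" by (simp add: F_def)
    then show "\<bar>q (s x) - f x\<bar> \<le> e" using q(2)[OF s, of x] by linarith
  qed
qed

text \<open>Expectations of trigonometric polynomials converge directly by the hypothesis. They
  approximate f only on a cube, so mass far out must be controlled uniformly in n, which is done
  coordinate by coordinate with the one-dimensional theorem.\<close>

theorem levy_continuity_vec: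
  fixes Y :: "nat \<Rightarrow> 'w \<Rightarrow> real ^ 'd"
  assumes M: "prob_space M" and Y: "\<And>n. Y n \<in> borel_measurable M"
    and N: "prob_space N" "sets N = sets borel"
    and lim: "\<And>t. (\<lambda>n. CLINT \<omega>|M. iexp (t \<bullet> Y n \<omega>)) \<longlonglongrightarrow> (CLINT y|N. iexp (t \<bullet> y))"
  shows "conv_in_distr M Y N"
  unfolding conv_in_distr_def
proof (intro allI impI, elim conjE)
  fix f :: "real ^ 'd \<Rightarrow> real" assume f: "continuous_on UNIV f" and "bounded (range f)"
  then obtain B where B: "\<And>x. \<bar>f x\<bar> \<le> B" by (auto simp: bounded_iff)
  interpret M: prob_space M by fact
  interpret N: prob_space N by fact
  have B0: "0 \<le> B" using B[of 0] by linarith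
  have mN: "u \<in> borel_measurable N" if "u \<in> borel_measurable borel" for u :: "real ^ 'd \<Rightarrow> 'z::topological_space"
    using that measurable_cong_sets[OF N(2) refl] by blast
  have mY: "(\<lambda>\<omega>. u (Y n \<omega>)) \<in> borel_measurable M" if "u \<in> borel_measurable borel" for u :: "real ^ 'd \<Rightarrow> 'z::topological_space" and n
    by (rule measurable_compose[OF Y that])
  have trig_lim: "(\<lambda>n. CLINT \<omega>|M. p (Y n \<omega>)) \<longlonglongrightarrow> (CLINT y|N. p y)" if "trig_poly p" for p
    using that
  proof induction
    case (monomial a t)
    then show ?case using tendsto_mult_left[OF lim[of t], of a] by simp
  next
    case (add p q)
    have i: "integrable N r" "integrable M (\<lambda>\<omega>. r (Y n \<omega>))" if r: "trig_poly r" for r n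
    proof -
      obtain A where A: "\<And>x. cmod (r x) \<le> A" and m: "r \<in> borel_measurable borel"
        using trig_poly_bounded[OF r] by blast
      show "integrable N r" "integrable M (\<lambda>\<omega>. r (Y n \<omega>))"
        using A mN[OF m] mY[OF m]
        by (auto intro!: N.integrable_const_bound[of _ A] M.integrable_const_bound[of _ A])
    qed
    show ?case using tendsto_add[OF add.IH] i[OF add.hyps(1)] i[OF add.hyps(2)] by simp
  qed
  \<comment> \<open>A continuous ramp, 0 for |x| <= L and 1 beyond L + 1. Continuity makes its
    expectations converge, which takes the place of a separate tightness argument.\<close>
  define h where "h L x = min 1 (max 0 (\<bar>x\<bar> - real L))" for L :: nat and x :: real
  have h: "0 \<le> h L x" "h L x \<le> 1" for L x by (auto simp: h_def)
  have hc: "isCont (h L) x" for L x unfolding h_def[abs_def] by (intro continuous_intros)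
  have hm: "h L \<in> borel_measurable borel" for L
    by (intro borel_measurable_continuous_onI continuous_at_imp_continuous_on) (simp add: hc)
  have him: "(\<lambda>y. h L (y $ i)) \<in> borel_measurable borel" for L and i :: 'd
    by (rule measurable_compose[OF borel_measurable_continuous_onI hm]) (intro continuous_intros)
  have hint: "integrable N (\<lambda>y. h L (y $ i))" "integrable M (\<lambda>\<omega>. h L (Y n \<omega> $ i))" for L n and i :: 'd
    using mN[OF him] mY[OF him] h
    by (auto intro!: N.integrable_const_bound[of _ 1] M.integrable_const_bound[of _ 1])
  have tail: "(\<lambda>n. LINT \<omega>|M. h L (Y n \<omega> $ i)) \<longlonglongrightarrow> (LINT y|N. h L (y $ i))" for L i
  proof -
    have cm: "(\<lambda>y. y $ i) \<in> borel_measurable (borel :: (real ^ 'd) measure)"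
      by (intro borel_measurable_continuous_onI continuous_intros)
    let ?M = "\<lambda>n. distr M borel (\<lambda>\<omega>. Y n \<omega> $ i)" and ?N = "distr N borel (\<lambda>y. y $ i)"
    have rM: "real_distribution (?M n)" for n by (rule M.real_distribution_distr[OF mY[OF cm]])
    have rN: "real_distribution ?N" by (rule N.real_distribution_distr[OF mN[OF cm]])
    have "(\<lambda>n. char (?M n) s) \<longlonglongrightarrow> char ?N s" for s
    proof -
      have "char (?M n) s = (CLINT \<omega>|M. iexp ((s *\<^sub>R axis i 1) \<bullet> Y n \<omega>))" for n
        unfolding char_def by (subst integral_distr[OF mY[OF cm]]) (auto simp: inner_axis')
      moreover have "char ?N s = (CLINT y|N. iexp ((s *\<^sub>R axis i 1) \<bullet> y))"
        unfolding char_def by (subst integral_distr[OF mN[OF cm]]) (auto simp: inner_axis')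
      ultimately show ?thesis using lim[of "s *\<^sub>R axis i 1"] by simp
    qed
    then have w: "weak_conv_m ?M ?N" by (rule levy_continuity[OF rM rN])
    have "(\<lambda>n. LINT x|?M n. h L x) \<longlonglongrightarrow> (LINT x|?N. h L x)"
      by (rule weak_conv_imp_integral_bdd_continuous_conv[where B=1, OF rM rN w hc]) (use h in auto)
    then show ?thesis
      by (simp add: integral_distr[OF mY[OF cm] hm] integral_distr[OF mN[OF cm] hm])
  qed
  have h_vanish: "(\<lambda>L. LINT y|N. h L (y $ i)) \<longlonglongrightarrow> 0" for i
  proof -
    have "(\<lambda>L. LINT y|N. h L (y $ i)) \<longlonglongrightarrow> (LINT y|N. 0)"
    proof (rule integral_dominated_convergence[where w="\<lambda>_. 1"])
      show "AE y in N. (\<lambda>L. h L (y $ i)) \<longlonglongrightarrow> 0"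
      proof (rule AE_I2)
        fix y :: "real ^ 'd"
        have "\<forall>\<^sub>F L in sequentially. h L (y $ i) = 0"
          using eventually_ge_at_top[of "nat \<lceil>\<bar>y $ i\<bar>\<rceil>"]
          by eventually_elim (auto simp: h_def max_def)
        then show "(\<lambda>L. h L (y $ i)) \<longlonglongrightarrow> 0" by (rule tendsto_eventually)
      qed
    qed (use h mN[OF him] in auto)
    then show ?thesis by simp
  qed
  have fm: "f \<in> borel_measurable borel" by (rule borel_measurable_continuous_onI[OF f])
  have fint: "integrable N f" "integrable M (\<lambda>\<omega>. f (Y n \<omega>))" for n
    using mN[OF fm] mY[OF fm] B
    by (auto intro!: N.integrable_const_bound[of _ B] M.integrable_const_bound[of _ B])
  show "(\<lambda>n. LINT \<omega>|M. f (Y n \<omega>)) \<longlonglongrightarrow> (LINT y|N. f y)"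
  proof (rule LIMSEQ_I)
    fix r :: real assume r: "0 < r"
    \<comment> \<open>Five portions of e are spent: two under each law for replacing f by p, and one
      for the convergence of p.\<close>
    define e where "e = r / 8"
    have e: "0 < e" using r by (simp add: e_def)
    \<comment> \<open>Bounds |p - f| off the cube, where at least one ramp equals 1.\<close>
    define A where "A = 2 * B + e"
    have A: "0 < A" using B0 e by (simp add: A_def)
    have "(\<lambda>L. \<Sum>i\<in>UNIV. LINT y|N. h L (y $ i)) \<longlonglongrightarrow> (\<Sum>i\<in>(UNIV :: 'd set). 0)"
      by (intro tendsto_sum h_vanish)
    then have "\<forall>\<^sub>F L in sequentially. (\<Sum>i\<in>UNIV. LINT y|N. h L (y $ i)) < e / A"
      using e A by (intro order_tendstoD) auto
    then obtain L where L: "(\<Sum>i\<in>UNIV. LINT y|N. h L (y $ i)) < e / A"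
      by (auto simp: eventually_sequentially)
    obtain p where p: "trig_poly (\<lambda>x. complex_of_real (p x))" and pB: "\<And>x. \<bar>p x\<bar> \<le> B + e"
      and pf: "\<And>x. (\<And>i. \<bar>x $ i\<bar> \<le> real L + 1) \<Longrightarrow> \<bar>p x - f x\<bar> \<le> e"
      by (rule trig_approximation[OF f B e, of "real L + 1"]) auto
    have pm: "p \<in> borel_measurable borel"
    proof -
      have "(\<lambda>x. Re (complex_of_real (p x))) \<in> borel_measurable borel"
        using trig_poly_bounded[OF p] by (intro measurable_compose[OF _ borel_measurable_Re]) blast
      then show ?thesis by simp
    qed
    have pint: "integrable N p" "integrable M (\<lambda>\<omega>. p (Y n \<omega>))" for n
      using mN[OF pm] mY[OF pm] pB
      by (auto intro!: N.integrable_const_bound[of _ "B + e"] M.integrable_const_bound[of _ "B + e"])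
    have le: "\<bar>p x - f x\<bar> \<le> e + A * (\<Sum>i\<in>UNIV. h L (x $ i))" for x
    proof (cases "\<forall>i. \<bar>x $ i\<bar> \<le> real L + 1")
      case True
      then have "\<bar>p x - f x\<bar> \<le> e" using pf by blast
      moreover have "0 \<le> A * (\<Sum>i\<in>UNIV. h L (x $ i))" using A h by (intro mult_nonneg_nonneg sum_nonneg) auto
      ultimately show ?thesis by linarith
    next
      case False
      then obtain i where "real L + 1 < \<bar>x $ i\<bar>" by (auto simp: not_le)
      then have "h L (x $ i) = 1" by (simp add: h_def)
      then have "1 \<le> (\<Sum>i\<in>UNIV. h L (x $ i))"
        using member_le_sum[of i UNIV "\<lambda>i. h L (x $ i)"] h by simp
      then have "A * 1 \<le> A * (\<Sum>i\<in>UNIV. h L (x $ i))" using A by (intro mult_left_mono) auto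
      moreover have "\<bar>p x - f x\<bar> \<le> A" unfolding A_def using pB[of x] B[of x] by linarith
      ultimately show ?thesis using e by linarith
    qed
    have errN: "\<bar>(LINT y|N. p y) - (LINT y|N. f y)\<bar> \<le> e + A * (\<Sum>i\<in>UNIV. LINT y|N. h L (y $ i))"
    proof -
      have "\<bar>LINT y|N. p y - f y\<bar> \<le> (LINT y|N. \<bar>p y - f y\<bar>)" by (rule integral_abs_bound)
      also have "\<dots> \<le> (LINT y|N. e + A * (\<Sum>i\<in>UNIV. h L (y $ i)))"
        using pint fint hint by (intro integral_mono le) auto
      also have "\<dots> = e + A * (\<Sum>i\<in>UNIV. LINT y|N. h L (y $ i))"
        using hint by (simp add: N.prob_space)
      finally show ?thesis using pint fint by simp
    qed
    have errM: "\<bar>(LINT \<omega>|M. p (Y n \<omega>)) - (LINT \<omega>|M. f (Y n \<omega>))\<bar> \<le> e + A * (\<Sum>i\<in>UNIV. LINT \<omega>|M. h L (Y n \<omega> $ i))" for n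
    proof -
      have "\<bar>LINT \<omega>|M. p (Y n \<omega>) - f (Y n \<omega>)\<bar> \<le> (LINT \<omega>|M. \<bar>p (Y n \<omega>) - f (Y n \<omega>)\<bar>)" by (rule integral_abs_bound)
      also have "\<dots> \<le> (LINT \<omega>|M. e + A * (\<Sum>i\<in>UNIV. h L (Y n \<omega> $ i)))"
        using pint fint hint by (intro integral_mono le) auto
      also have "\<dots> = e + A * (\<Sum>i\<in>UNIV. LINT \<omega>|M. h L (Y n \<omega> $ i))"
        using hint by (simp add: M.prob_space)
      finally show ?thesis using pint fint by simp
    qed
    have "(\<lambda>n. \<Sum>i\<in>UNIV. LINT \<omega>|M. h L (Y n \<omega> $ i)) \<longlonglongrightarrow> (\<Sum>i\<in>UNIV. LINT y|N. h L (y $ i))"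
      by (intro tendsto_sum tail)
    from order_tendstoD(2)[OF this L]
    have ev1: "\<forall>\<^sub>F n in sequentially. (\<Sum>i\<in>UNIV. LINT \<omega>|M. h L (Y n \<omega> $ i)) < e / A" .
    have "(\<lambda>n. Re (CLINT \<omega>|M. complex_of_real (p (Y n \<omega>)))) \<longlonglongrightarrow> Re (CLINT y|N. complex_of_real (p y))"
      by (intro tendsto_intros trig_lim p)
    then have "(\<lambda>n. LINT \<omega>|M. p (Y n \<omega>)) \<longlonglongrightarrow> (LINT y|N. p y)" by simp
    then have ev2: "\<forall>\<^sub>F n in sequentially. \<bar>(LINT \<omega>|M. p (Y n \<omega>)) - (LINT y|N. p y)\<bar> < e"
      using e by (auto simp: tendsto_iff dist_real_def)
    have "\<forall>\<^sub>F n in sequentially. norm ((LINT \<omega>|M. f (Y n \<omega>)) - (LINT y|N. f y)) < r"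
      using ev1 ev2
    proof eventually_elim
      case (elim n)
      have "A * (\<Sum>i\<in>UNIV. LINT \<omega>|M. h L (Y n \<omega> $ i)) < e" "A * (\<Sum>i\<in>UNIV. LINT y|N. h L (y $ i)) < e"
        using elim(1) L A by (simp_all add: pos_less_divide_eq mult.commute)
      then show ?case using errM[of n] errN elim(2) e e_def unfolding real_norm_def by linarith
    qed
    then show "\<exists>no. \<forall>n\<ge>no. norm ((LINT \<omega>|M. f (Y n \<omega>)) - (LINT y|N. f y)) < r"
      by (simp add: eventually_sequentially)
  qed
qed

section \<open>Asymptotic variances\<close>

locale drift_sweep = projection_sweep \<pi> P K for \<pi> :: "'a::topological_space measure" and P K +
  fixes W :: "nat \<Rightarrow> 'a \<Rightarrow> real" and D :: "nat \<Rightarrow> 'a set" and lam b :: "nat \<Rightarrow> real"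
  assumes drift: "\<And>k. k \<in> {1..K} \<Longrightarrow> drift_kernel (sweep_kernel P K K k) (W k) (D k) (lam k) (b k)"
    and small: "\<And>k. k \<in> {1..K} \<Longrightarrow> small_set (sweep_kernel P K K k) (D k)"
    and W_L2: "\<And>k. k \<in> {1..K} \<Longrightarrow> L2 \<pi> (W k)"
begin

text \<open>The solution is again mean-zero and bounded everywhere by a multiple of W, hence
  admissible as a right-hand side. Against the composed kernel the equation holds at every point; in
  terms of \<open>sweep_iter\<close> only almost everywhere.\<close>

lemma poisson_bounded:
  assumes k: "k \<in> {1..K}" and f: "f \<in> borel_measurable borel" and c: "0 \<le> c"
    and fc: "\<And>x. \<bar>f x\<bar> \<le> c * W k x" and f0: "(LINT x|\<pi>. f x) = 0"
  shows "\<exists>v c'. v \<in> borel_measurable borel \<and> 0 \<le> c' \<and> (\<forall>x. \<bar>v x\<bar> \<le> c' * W k x) \<and> (LINT x|\<pi>. v x) = 0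
    \<and> L2 \<pi> v \<and> (AE x in \<pi>. v x - sweep_iter P K K k v x = f x)"
proof -
  interpret d: drift_kernel "sweep_kernel P K K k" "W k" "D k" "lam k" "b k" by (rule drift[OF k])
  interpret s: invariant_kernel \<pi> "sweep_kernel P K K k" by (rule sweep_kernel_invariant[OF k])
  show ?thesis
  proof (rule d.poisson_equation[OF small[OF k] prob_space_axioms sets_pi s.invariant L2_integrable[OF W_L2[OF k]]])
    fix C assume C: "0 \<le> C"
      and ps: "\<And>f c. f \<in> borel_measurable borel \<Longrightarrow> 0 \<le> c \<Longrightarrow> (\<And>x. \<bar>f x\<bar> \<le> c * W k x) \<Longrightarrow> (LINT x|\<pi>. f x) = 0 \<Longrightarrow>
        \<exists>v\<in>d.dominated. (\<forall>x. \<bar>v x\<bar> \<le> C * c * W k x) \<and> (LINT x|\<pi>. v x) = 0 \<and> (\<forall>x. v x - d.E 1 v x = f x)"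
    obtain v where v: "v \<in> d.dominated" "\<And>x. \<bar>v x\<bar> \<le> C * c * W k x" "(LINT x|\<pi>. v x) = 0" "\<And>x. v x - d.E 1 v x = f x"
      using ps[OF f c fc f0] by blast
    have vm: "v \<in> borel_measurable borel" by (rule d.dominated_meas[OF v(1)])
    have "\<bar>v x\<bar> \<le> \<bar>C * c * W k x\<bar>" for x using v(2)[of x] by linarith
    then have vL: "L2 \<pi> v" by (rule L2_bound[OF vm L2_cmult[OF W_L2[OF k]]])
    have E1: "d.E 1 v x = kernel_int (sweep_kernel P K K k) v x" for x
      unfolding d.E_def kernel_int_def One_nat_def d.kernel_power_1 ..
    have "AE x in \<pi>. v x - sweep_iter P K K k v x = f x"
      using sweep_iter_AE_sweep_kernel[OF k vL, of K]
    proof eventually_elim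
      case (elim x)
      then show ?case using v(4)[of x] unfolding E1 by simp
    qed
    then show ?thesis using vm v(2,3) vL C c by (intro exI[of _ v] exI[of _ "C * c"]) simp
  qed
qed

lemma poisson_family:
  assumes f: "\<And>k. k \<in> {1..K} \<Longrightarrow> f k \<in> borel_measurable borel" and c: "0 \<le> c"
    and fc: "\<And>k x. k \<in> {1..K} \<Longrightarrow> \<bar>f k x\<bar> \<le> c * W k x" and f0: "\<And>k. k \<in> {1..K} \<Longrightarrow> (LINT x|\<pi>. f k x) = 0"
  obtains u v where "\<And>k. k \<in> {1..K} \<Longrightarrow> L2 \<pi> (u k)" "\<And>k. k \<in> {1..K} \<Longrightarrow> L2 \<pi> (v k)"
    "\<And>k. k \<in> {1..K} \<Longrightarrow> AE x in \<pi>. u k x - sweep_iter P K K k (u k) x = f k x"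
    "\<And>k. k \<in> {1..K} \<Longrightarrow> AE x in \<pi>. v k x - sweep_iter P K K k (v k) x = u k x"
proof -
  have "\<exists>p. L2 \<pi> (fst p) \<and> L2 \<pi> (snd p) \<and> (AE x in \<pi>. fst p x - sweep_iter P K K k (fst p) x = f k x)
      \<and> (AE x in \<pi>. snd p x - sweep_iter P K K k (snd p) x = fst p x)" if k: "k \<in> {1..K}" for k
  proof -
    obtain u c' where u: "u \<in> borel_measurable borel" "0 \<le> c'" "\<And>x. \<bar>u x\<bar> \<le> c' * W k x" "(LINT x|\<pi>. u x) = 0"
      "L2 \<pi> u" "AE x in \<pi>. u x - sweep_iter P K K k u x = f k x"
      using poisson_bounded[OF k f[OF k] c fc[OF k] f0[OF k]] by blast
    obtain v where "L2 \<pi> v" "AE x in \<pi>. v x - sweep_iter P K K k v x = u x"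
      using poisson_bounded[OF k u(1-4)] by blast
    with u show ?thesis by (intro exI[of _ "(u, v)"]) simp
  qed
  then have "\<exists>F. \<forall>k\<in>{1..K}. L2 \<pi> (fst (F k)) \<and> L2 \<pi> (snd (F k)) \<and> (AE x in \<pi>. fst (F k) x - sweep_iter P K K k (fst (F k)) x = f k x)
      \<and> (AE x in \<pi>. snd (F k) x - sweep_iter P K K k (snd (F k)) x = fst (F k) x)"
    by (intro bchoice) blast
  then obtain F where "\<forall>k\<in>{1..K}. L2 \<pi> (fst (F k)) \<and> L2 \<pi> (snd (F k)) \<and> (AE x in \<pi>. fst (F k) x - sweep_iter P K K k (fst (F k)) x = f k x)
      \<and> (AE x in \<pi>. snd (F k) x - sweep_iter P K K k (snd (F k)) x = fst (F k) x)" ..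
  then show thesis by (intro that[of "\<lambda>k. fst (F k)" "\<lambda>k. snd (F k)"]) simp_all
qed

lemma W_ge_1: "k \<in> {1..K} \<Longrightarrow> 1 \<le> W k x"
  using drift_kernel.W_ge[OF drift] .

text \<open>The q_k are integrable but need not be bounded by W, so the Poisson equation is solved
  for truncations at a level c, which are bounded by c * W. Each phase has its own mean; constants
  depending on the phase move these means to their average. The error in L1(pi) comes from
  truncation alone.\<close>

lemma corrector_approximation:
  assumes q: "\<And>k. k \<in> {1..K} \<Longrightarrow> q k \<in> borel_measurable borel" "\<And>k. k \<in> {1..K} \<Longrightarrow> integrable \<pi> (q k)"
    and s2: "s2 = (\<Sum>k\<in>{1..K}. LINT x|\<pi>. q k x) / real K" and \<delta>: "0 < \<delta>"
  shows "\<exists>w. (\<forall>k\<in>{1..K}. w k \<in> borel_measurable borel \<and> integrable \<pi> (w k)) \<and>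
      (\<forall>k\<in>{1..K}. (LINT x|\<pi>. \<bar>q k x - s2 - (w k x - kernel_int (P k) (w (cyc K k)) x)\<bar>) \<le> \<delta>)"
proof -
  define t where "t c k x = max (- real c) (min (real c) (q k x))" for c :: nat and k x
  have tm: "t c k \<in> borel_measurable borel" if "k \<in> {1..K}" for c k
    unfolding t_def[abs_def] using q(1)[OF that] by simp
  have tb: "\<bar>t c k x\<bar> \<le> real c" "\<bar>t c k x\<bar> \<le> \<bar>q k x\<bar>" for c k x by (auto simp: t_def)
  have ti: "integrable \<pi> (t c k)" if "k \<in> {1..K}" for c k
    by (rule integrable_const_bound[of _ "real c"]) (use tb(1) meas_pi[OF tm[OF that]] in auto)
  have "(\<lambda>c. LINT x|\<pi>. \<bar>q k x - t c k x\<bar>) \<longlonglongrightarrow> 0" if k: "k \<in> {1..K}" for k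
  proof -
    have "(\<lambda>c. LINT x|\<pi>. \<bar>q k x - t c k x\<bar>) \<longlonglongrightarrow> (LINT x|\<pi>. 0)"
    proof (rule integral_dominated_convergence[where w="\<lambda>x. 2 * \<bar>q k x\<bar>"])
      show "integrable \<pi> (\<lambda>x. 2 * \<bar>q k x\<bar>)" using q(2)[OF k] by simp
      show "(\<lambda>x. \<bar>q k x - t c k x\<bar>) \<in> borel_measurable \<pi>" for c
        using meas_pi[OF q(1)[OF k]] meas_pi[OF tm[OF k]] by simp
      show "AE x in \<pi>. norm \<bar>q k x - t c k x\<bar> \<le> 2 * \<bar>q k x\<bar>" for c
      proof (rule AE_I2)
        fix x show "norm \<bar>q k x - t c k x\<bar> \<le> 2 * \<bar>q k x\<bar>"
          using tb(2)[of c k x] abs_triangle_ineq4[of "q k x" "t c k x"] by simp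
      qed
      show "AE x in \<pi>. (\<lambda>c. \<bar>q k x - t c k x\<bar>) \<longlonglongrightarrow> 0"
      proof (rule AE_I2)
        fix x
        have "\<forall>\<^sub>F c in sequentially. \<bar>q k x - t c k x\<bar> = 0"
          using eventually_ge_at_top[of "nat \<lceil>\<bar>q k x\<bar>\<rceil>"]
        proof eventually_elim
          case (elim c)
          then have "\<bar>q k x\<bar> \<le> real c" by linarith
          then show ?case by (auto simp: t_def abs_le_iff max_def min_def)
        qed
        then show "(\<lambda>c. \<bar>q k x - t c k x\<bar>) \<longlonglongrightarrow> 0" by (rule tendsto_eventually)
      qed
    qed simp
    then show ?thesis by simp
  qed
  then have "\<forall>\<^sub>F c in sequentially. \<forall>k\<in>{1..K}. (LINT x|\<pi>. \<bar>q k x - t c k x\<bar>) < \<delta> / 2"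
    unfolding eventually_ball_finite_distrib[OF finite_atLeastAtMost]
    using \<delta> by (intro ballI order_tendstoD(2)[where a="\<delta> / 2"]) auto
  then obtain c where "\<forall>n\<ge>c. \<forall>k\<in>{1..K}. (LINT x|\<pi>. \<bar>q k x - t n k x\<bar>) < \<delta> / 2"
    unfolding eventually_sequentially by blast
  then have c: "\<And>k. k \<in> {1..K} \<Longrightarrow> (LINT x|\<pi>. \<bar>q k x - t c k x\<bar>) < \<delta> / 2"
    by blast
  define m where "m k = (LINT x|\<pi>. t c k x)" for k
  define mb where "mb = (\<Sum>k\<in>{1..K}. m k) / real K"
  have Kp: "0 < real K" using K by simp
  have mb: "\<bar>mb - s2\<bar> \<le> \<delta> / 2"
  proof -
    have "\<bar>m k - (LINT x|\<pi>. q k x)\<bar> \<le> \<delta> / 2" if k: "k \<in> {1..K}" for k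
    proof -
      have "(LINT x|\<pi>. q k x) - m k = (LINT x|\<pi>. q k x - t c k x)" using q(2)[OF k] ti[OF k] by (simp add: m_def)
      then have "\<bar>(LINT x|\<pi>. q k x) - m k\<bar> \<le> (LINT x|\<pi>. \<bar>q k x - t c k x\<bar>)" by (simp only: integral_abs_bound)
      then show ?thesis using c[OF k] by (simp add: abs_minus_commute)
    qed
    then have "(\<Sum>k\<in>{1..K}. \<bar>m k - (LINT x|\<pi>. q k x)\<bar>) \<le> (\<Sum>k\<in>{1..K}. \<delta> / 2)" by (intro sum_mono)
    then have "\<bar>\<Sum>k\<in>{1..K}. m k - (LINT x|\<pi>. q k x)\<bar> \<le> real K * (\<delta> / 2)"
      by (intro order_trans[OF sum_abs]) simp
    moreover have "mb - s2 = (\<Sum>k\<in>{1..K}. m k - (LINT x|\<pi>. q k x)) / real K"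
      by (simp add: mb_def s2 sum_subtractf diff_divide_distrib)
    ultimately show ?thesis using Kp by (simp add: abs_divide pos_divide_le_eq mult.commute)
  qed
  have mc: "\<bar>m k\<bar> \<le> real c" if k: "k \<in> {1..K}" for k
  proof -
    have "\<bar>m k\<bar> \<le> (LINT x|\<pi>. \<bar>t c k x\<bar>)" unfolding m_def by (rule integral_abs_bound)
    also have "\<dots> \<le> (LINT x|\<pi>. real c)" using ti[OF k] tb(1) by (intro integral_mono) auto
    finally show ?thesis by (simp add: prob_space)
  qed
  show ?thesis
  proof (rule poisson_family[of "\<lambda>k x. t c k x - m k" "2 * real c"])
    fix k assume k: "k \<in> {1..K}"
    show "(\<lambda>x. t c k x - m k) \<in> borel_measurable borel" using tm[OF k] by simp
    show "(LINT x|\<pi>. t c k x - m k) = 0" using ti[OF k] by (simp add: m_def prob_space)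
    fix x
    have "\<bar>t c k x - m k\<bar> \<le> 2 * real c * 1" using tb(1)[of c k x] mc[OF k] by linarith
    also have "\<dots> \<le> 2 * real c * W k x" using W_ge_1[OF k] by (intro mult_left_mono) auto
    finally show "\<bar>t c k x - m k\<bar> \<le> 2 * real c * W k x" .
  next
    fix u v
    assume u: "\<And>k. k \<in> {1..K} \<Longrightarrow> L2 \<pi> (u k)"
      and uf: "\<And>k. k \<in> {1..K} \<Longrightarrow> AE x in \<pi>. u k x - sweep_iter P K K k (u k) x = t c k x - m k"
    \<comment> \<open>A discrete primitive of the deviations of the phase means from their average;
      it closes up around the cycle because the deviations sum to 0.\<close>
    define a where "a k = (\<Sum>j\<in>{1..<k}. mb - m j)" for k
    have a: "a k - a (cyc K k) = m k - mb" if k: "k \<in> {1..K}" for k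
    proof (cases "k < K")
      case True
      then show ?thesis using k by (simp add: a_def cyc_def)
    next
      case False
      then have "k = K" using k by simp
      have "(\<Sum>j\<in>{1..K}. mb - m j) = 0"
        using Kp by (simp add: sum_subtractf mb_def)
      moreover have "(\<Sum>j\<in>{1..K}. mb - m j) = (\<Sum>j\<in>{1..<K}. mb - m j) + (mb - m K)"
        using K by (simp add: sum.last_plus)
      ultimately show ?thesis by (simp add: \<open>k = K\<close> a_def cyc_def)
    qed
    define w where "w k x = cycle_sum u k x + a k" for k x
    have cL: "L2 \<pi> (cycle_sum u k)" if "k \<in> {1..K}" for k by (rule cycle_sum_L2[OF u that])
    have wm: "w k \<in> borel_measurable borel" "integrable \<pi> (w k)" if "k \<in> {1..K}" for k
      unfolding w_def[abs_def] using L2_meas[OF cL[OF that]] L2_integrable[OF cL[OF that]] by auto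
    have "(LINT x|\<pi>. \<bar>q k x - s2 - (w k x - kernel_int (P k) (w (cyc K k)) x)\<bar>) \<le> \<delta>" if k: "k \<in> {1..K}" for k
    proof -
      interpret invariant_kernel \<pi> "P k" by (rule inv_ker[OF k])
      note r = cyc_in_range[OF k]
      have "AE x in \<pi>. cycle_sum u k x - kernel_int (P k) (cycle_sum u (cyc K k)) x = t c k x - m k"
        by (intro cycle_sum_poisson u uf k)
      then have "AE x in \<pi>. w k x - kernel_int (P k) (w (cyc K k)) x = t c k x - mb"
        using kernel_int_AE_lin(1)[OF L2_integrable[OF cL[OF r]] L2_integrable[OF L2_const[of "a (cyc K k)"]]]
      proof eventually_elim
        case (elim x)
        have "kernel_int (P k) (\<lambda>_. a (cyc K k)) x = a (cyc K k)"
          using prob_space.prob_space[OF prob_kernelD(1)[OF ker]] by (simp add: kernel_int_def)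
        then show ?case using elim a[OF k] unfolding w_def[abs_def] by simp
      qed
      then have "AE x in \<pi>. \<bar>q k x - s2 - (w k x - kernel_int (P k) (w (cyc K k)) x)\<bar> \<le> \<bar>q k x - t c k x\<bar> + \<bar>mb - s2\<bar>"
        by eventually_elim linarith
      then have "(LINT x|\<pi>. \<bar>q k x - s2 - (w k x - kernel_int (P k) (w (cyc K k)) x)\<bar>) \<le> (LINT x|\<pi>. \<bar>q k x - t c k x\<bar> + \<bar>mb - s2\<bar>)"
        using q(2)[OF k] wm(2)[OF k] integrable_kernel(2)[OF wm(2)[OF r]] ti[OF k] by (intro integral_mono_AE) auto
      also have "\<dots> = (LINT x|\<pi>. \<bar>q k x - t c k x\<bar>) + \<bar>mb - s2\<bar>"
        using q(2)[OF k] ti[OF k] by (simp add: prob_space)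
      finally show ?thesis using c[OF k] mb by linarith
    qed
    then show ?thesis using wm by (intro exI[of _ w]) blast
  qed simp
qed

text \<open>Reindexing over the cycle turns s2 into the mean over phases of the integrated
  conditional variances, the value for which correctors exist. In this form it is also visibly
  nonnegative.\<close>

lemma sweep_char_limit:
  assumes f: "\<And>k. k \<in> {1..K} \<Longrightarrow> f k \<in> borel_measurable borel"
    and V: "\<And>k. k \<in> {1..K} \<Longrightarrow> L2 \<pi> (V k)"
    and eq: "\<And>k. k \<in> {1..K} \<Longrightarrow> AE x in \<pi>. f k x = V k x - kernel_int (P k) (V (cyc K k)) x"
    and k: "k \<in> {1..K}"
    and s2: "s2 = (\<Sum>k\<in>{1..K}. sq_norm \<pi> (V k) - sq_norm \<pi> (kernel_int (P k) (V (cyc K k)))) / real K"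
  shows "0 \<le> s2" "(\<lambda>M. sweep_char P K (\<lambda>k x. f k x / sqrt (real M)) M k x) \<longlonglongrightarrow> of_real (exp (- s2 / 2))"
proof -
  have cycN: "(\<Sum>k\<in>{1..K}. sq_norm \<pi> (V (cyc K k))) = (\<Sum>k\<in>{1..K}. sq_norm \<pi> (V k))" by (rule sum_cyc)
  have kv: "invariant_kernel.kernel_var (P k) (V (cyc K k)) \<in> borel_measurable borel \<and> integrable \<pi> (invariant_kernel.kernel_var (P k) (V (cyc K k)))
      \<and> (LINT x|\<pi>. invariant_kernel.kernel_var (P k) (V (cyc K k)) x) = sq_norm \<pi> (V (cyc K k)) - sq_norm \<pi> (kernel_int (P k) (V (cyc K k)))
      \<and> sq_norm \<pi> (kernel_int (P k) (V (cyc K k))) \<le> sq_norm \<pi> (V (cyc K k))" if k: "k \<in> {1..K}" for k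
  proof -
    interpret invariant_kernel \<pi> "P k" by (rule inv_ker[OF k])
    note V' = V[OF cyc_in_range[OF k]]
    have "kernel_int (P k) (\<lambda>y. (V (cyc K k) y)\<^sup>2) \<in> borel_measurable borel" "kernel_int (P k) (V (cyc K k)) \<in> borel_measurable borel"
      using L2_meas[OF V'] by (auto intro!: kernel_int_meas)
    then have "kernel_var (V (cyc K k)) \<in> borel_measurable borel" unfolding kernel_var_def[abs_def] by measurable
    then show ?thesis using kernel_var_integrable[OF V'] kernel_int_L2(2)[OF V'] by simp
  qed
  have s2': "s2 = (\<Sum>k\<in>{1..K}. LINT x|\<pi>. invariant_kernel.kernel_var (P k) (V (cyc K k)) x) / real K"
    unfolding s2 using kv cycN by (simp add: sum_subtractf)
  have "0 \<le> (\<Sum>k\<in>{1..K}. LINT x|\<pi>. invariant_kernel.kernel_var (P k) (V (cyc K k)) x)"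
    using kv by (intro sum_nonneg) simp
  then show s0: "0 \<le> s2" unfolding s2' by simp
  interpret d: drift_kernel "sweep_kernel P K K k" "W k" "D k" "lam k" "b k" by (rule drift[OF k])
  interpret s: invariant_kernel \<pi> "sweep_kernel P K K k" by (rule sweep_kernel_invariant[OF k])
  show "(\<lambda>M. sweep_char P K (\<lambda>k x. f k x / sqrt (real M)) M k x) \<longlonglongrightarrow> of_real (exp (- s2 / 2))"
  proof (rule d.ergodic_average[OF small[OF k] prob_space_axioms sets_pi s.invariant L2_integrable[OF W_L2[OF k]]])
    fix C assume erg: "\<And>u c x n. u \<in> borel_measurable borel \<Longrightarrow> 0 \<le> c \<Longrightarrow> (\<And>x. \<bar>u x\<bar> \<le> c) \<Longrightarrow> 0 < n \<Longrightarrow>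
      \<bar>(\<Sum>j<n. LINT y|kernel_power (sweep_kernel P K K k) j x. u y) / real n - (LINT x|\<pi>. u x)\<bar> \<le> C * c * W k x / real n"
    show ?thesis
    proof (rule pointwise_clt[where B="\<lambda>x. C * W k x"])
      show "cmod (of_real (exp (- s2 / 2))) \<le> 1" using s0 by simp
      show "(\<lambda>M. LINT x|\<pi>. cmod (sweep_char P K (\<lambda>k x. f k x / sqrt (real M)) (M - s) k x - of_real (exp (- s2 / 2)))) \<longlonglongrightarrow> 0" for s
      proof (rule stationary_clt[OF f V eq s0 _ k])
        fix \<delta> :: real assume "0 < \<delta>"
        then show "\<exists>w. (\<forall>k\<in>{1..K}. w k \<in> borel_measurable borel \<and> integrable \<pi> (w k)) \<and>
          (\<forall>k\<in>{1..K}. (LINT x|\<pi>. \<bar>invariant_kernel.kernel_var (P k) (V (cyc K k)) x - s2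
            - (w k x - kernel_int (P k) (w (cyc K k)) x)\<bar>) \<le> \<delta>)"
          using kv by (intro corrector_approximation s2') blast+
      qed
      show "\<bar>(\<Sum>j<n. LINT y|kernel_power (sweep_kernel P K K k) j x. u y) / real n - (LINT x|\<pi>. u x)\<bar> \<le> C * W k x * c / real n"
        if "u \<in> borel_measurable borel" "0 \<le> c" "\<And>x. \<bar>u x\<bar> \<le> c" "0 < n" for u c x n
        using erg[OF that] by (simp add: mult_ac)
    qed (use f k in auto)
  qed
qed

text \<open>The limit holds at every starting point, so bounded convergence over X_0 gives it for
  any initial law.\<close>

lemma chain_char_limit:
  assumes f: "\<And>k. k \<in> {1..K} \<Longrightarrow> f k \<in> borel_measurable borel"
    and V: "\<And>k. k \<in> {1..K} \<Longrightarrow> L2 \<pi> (V k)"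
    and eq: "\<And>k. k \<in> {1..K} \<Longrightarrow> AE x in \<pi>. f k x = V k x - kernel_int (P k) (V (cyc K k)) x"
    and s2: "s2 = (\<Sum>k\<in>{1..K}. sq_norm \<pi> (V k) - sq_norm \<pi> (kernel_int (P k) (V (cyc K k)))) / real K"
    and ch: "sweep_chain P K \<nu> M X"
  shows "(\<lambda>n. CLINT \<omega>|M. iexp (\<Sum>t<n. f ((cyc K ^^ t) 1) (X t \<omega>) / sqrt (real n))) \<longlonglongrightarrow> of_real (exp (- s2 / 2))"
proof -
  interpret M: prob_space M using ch by (simp add: sweep_chain_def)
  have X: "X t \<in> M \<rightarrow>\<^sub>M borel" for t using ch by (simp add: sweep_chain_def)
  have one: "1 \<in> {1..K}" using K by simp
  have fm: "(\<lambda>x. f k x / sqrt (real n)) \<in> borel_measurable borel" if "k \<in> {1..K}" for k n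
    using f[OF that] by simp
  let ?F = "\<lambda>n. sweep_char P K (\<lambda>k x. f k x / sqrt (real n)) n 1"
  have "(\<lambda>n. CLINT \<omega>|M. ?F n (X 0 \<omega>)) \<longlonglongrightarrow> (CLINT \<omega>|M. of_real (exp (- s2 / 2)))"
  proof (rule integral_dominated_convergence[where w="\<lambda>_. 1"])
    show "AE \<omega> in M. (\<lambda>n. ?F n (X 0 \<omega>)) \<longlonglongrightarrow> of_real (exp (- s2 / 2))"
      by (intro AE_I2 sweep_char_limit(2)[OF f V eq one s2])
    show "(\<lambda>\<omega>. ?F n (X 0 \<omega>)) \<in> borel_measurable M" for n
      by (rule measurable_compose[OF X]) (rule sweep_char_meas[OF fm one])
    show "AE \<omega> in M. norm (?F n (X 0 \<omega>)) \<le> 1" for n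
      by (intro AE_I2 sweep_char_norm[OF fm one])
  qed simp_all
  moreover have "(CLINT \<omega>|M. iexp (\<Sum>t<n. f ((cyc K ^^ t) 1) (X t \<omega>) / sqrt (real n))) = (CLINT \<omega>|M. ?F n (X 0 \<omega>))" for n
    by (rule sweep_chain_char[where f="\<lambda>k x. f k x / sqrt (real n)", OF K ker fm ch])
  ultimately show ?thesis by (simp add: M.prob_space)
qed

text \<open>Pi_k V_{k+1} = V_k - f_k almost everywhere, and the square is expanded. This links the
  variance in the limit theorem, a drop of norms, to the inner products <f_k, V_k> that the series
  computes.\<close>

lemma variance_formula:
  assumes f: "\<And>k. k \<in> {1..K} \<Longrightarrow> L2 \<pi> (f k)"
    and V: "\<And>k. k \<in> {1..K} \<Longrightarrow> L2 \<pi> (V k)"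
    and eq: "\<And>k. k \<in> {1..K} \<Longrightarrow> AE x in \<pi>. f k x = V k x - kernel_int (P k) (V (cyc K k)) x"
  shows "(\<Sum>k\<in>{1..K}. sq_norm \<pi> (V k) - sq_norm \<pi> (kernel_int (P k) (V (cyc K k))))
    = (\<Sum>k\<in>{1..K}. 2 * (LINT x|\<pi>. f k x * V k x) - sq_norm \<pi> (f k))"
proof (rule sum.cong)
  fix k assume k: "k \<in> {1..K}"
  interpret invariant_kernel \<pi> "P k" by (rule inv_ker[OF k])
  note V' = V[OF cyc_in_range[OF k]]
  have "AE x in \<pi>. kernel_int (P k) (V (cyc K k)) x = V k x - f k x"
    using eq[OF k] by eventually_elim simp
  then have "sq_norm \<pi> (kernel_int (P k) (V (cyc K k))) = sq_norm \<pi> (\<lambda>x. V k x - f k x)"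
    by (intro sq_norm_cong_AE L2_meas kernel_int_L2 V' L2_diff V f k)
  also have "\<dots> = (LINT x|\<pi>. (V k x)\<^sup>2 - 2 * (f k x * V k x) + (f k x)\<^sup>2)"
    unfolding sq_norm_def by (intro Bochner_Integration.integral_cong) (auto simp: power2_diff mult_ac)
  also have "\<dots> = sq_norm \<pi> (V k) - 2 * (LINT x|\<pi>. f k x * V k x) + sq_norm \<pi> (f k)"
    using f[OF k] V[OF k] L2_mult[OF f[OF k] V[OF k]] by (simp add: sq_norm_def L2_def)
  finally show "sq_norm \<pi> (V k) - sq_norm \<pi> (kernel_int (P k) (V (cyc K k))) = 2 * (LINT x|\<pi>. f k x * V k x) - sq_norm \<pi> (f k)"
    by simp
qed simp


lemma sweep_poisson:
  assumes g: "g \<in> borel_measurable borel" and gW: "\<And>k x. k \<in> {1..K} \<Longrightarrow> \<bar>g x\<bar> \<le> W k x"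
    and g0: "(LINT x|\<pi>. g x) = 0"
  obtains V where "\<And>k. k \<in> {1..K} \<Longrightarrow> L2 \<pi> (V k)"
    "\<And>k. k \<in> {1..K} \<Longrightarrow> AE x in \<pi>. V k x - kernel_int (P k) (V (cyc K k)) x = g x"
    "\<And>k h. k \<in> {1..K} \<Longrightarrow> L2 \<pi> h \<Longrightarrow> (\<lambda>t. LINT x|\<pi>. h x * sweep_iter P K t k g x) sums (LINT x|\<pi>. h x * V k x)"
proof (rule poisson_family[of "\<lambda>_. g" 1])
  fix u v
  assume uv: "\<And>k. k \<in> {1..K} \<Longrightarrow> L2 \<pi> (u k)" "\<And>k. k \<in> {1..K} \<Longrightarrow> L2 \<pi> (v k)"
    "\<And>k. k \<in> {1..K} \<Longrightarrow> AE x in \<pi>. u k x - sweep_iter P K K k (u k) x = g x"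
    "\<And>k. k \<in> {1..K} \<Longrightarrow> AE x in \<pi>. v k x - sweep_iter P K K k (v k) x = u k x"
  have gL: "L2 \<pi> g"
  proof (rule L2_bound[OF g W_L2[of 1]])
    show "\<bar>g x\<bar> \<le> \<bar>W 1 x\<bar>" for x using gW[of 1 x] K by simp
  qed (use K in simp)
  show thesis
  proof (rule that[of "cycle_sum u"])
    fix k assume k: "k \<in> {1..K}"
    show "L2 \<pi> (cycle_sum u k)" by (rule cycle_sum_L2[OF uv(1) k])
    show "AE x in \<pi>. cycle_sum u k x - kernel_int (P k) (cycle_sum u (cyc K k)) x = g x"
      by (intro cycle_sum_poisson uv k)
    fix h assume h: "L2 \<pi> h"
    show "(\<lambda>t. LINT x|\<pi>. h x * sweep_iter P K t k g x) sums (LINT x|\<pi>. h x * cycle_sum u k x)"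
      by (rule cycle_sum_sums[where f="\<lambda>_. g", OF gL uv(1,2,3,4) k h])
  qed
qed (use g gW g0 in auto)

end

text \<open>Expansion into matrix units reduces integrability to that of the entries, after which
  taking an entry is a bounded linear map.\<close>

lemma integral_matrix_nth:
  fixes F :: "'a \<Rightarrow> real ^ 'd ^ 'd"
  assumes "\<And>i j. integrable M (\<lambda>x. F x $ i $ j)"
  shows "integrable M F" "(LINT x|M. F x) $ i $ j = (LINT x|M. F x $ i $ j)"
proof -
  have row: "(\<Sum>j\<in>UNIV. ((F x $ i $ j) *\<^sub>R axis i (axis j 1)) $ a $ b) = (if i = a then F x $ i $ b else 0)"
    for x and i a b :: 'd
    by (cases "i = a") (simp_all add: axis_def if_distrib[where f="\<lambda>c. _ * c"] cong: if_cong)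
  have F: "F x = (\<Sum>i\<in>UNIV. \<Sum>j\<in>UNIV. (F x $ i $ j) *\<^sub>R axis i (axis j 1))" for x
  proof -
    have "(\<Sum>i\<in>UNIV. \<Sum>j\<in>UNIV. (F x $ i $ j) *\<^sub>R axis i (axis j 1)) $ a $ b = F x $ a $ b" for a b
      by (simp only: sum_component[of _ UNIV] row sum.delta finite UNIV_I if_True)
    then show ?thesis by (simp add: vec_eq_iff)
  qed
  have "F = (\<lambda>x. \<Sum>i\<in>UNIV. \<Sum>j\<in>UNIV. (F x $ i $ j) *\<^sub>R axis i (axis j 1))" using F by (rule ext)
  then show i: "integrable M F"
    by (rule ssubst) (intro Bochner_Integration.integrable_sum integrable_scaleR_left assms)
  have bl: "bounded_linear (\<lambda>A :: real ^ 'd ^ 'd. A $ i $ j)"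
    using bounded_linear_compose[OF bounded_linear_vec_nth bounded_linear_vec_nth] .
  show "(LINT x|M. F x) $ i $ j = (LINT x|M. F x $ i $ j)"
    by (rule integral_bounded_linear[OF bl i, symmetric])
qed

lemma integral_vec_nth:
  fixes F :: "'a \<Rightarrow> real ^ 'd"
  assumes "\<And>i. integrable M (\<lambda>x. F x $ i)"
  shows "(LINT x|M. F x) $ i = (LINT x|M. F x $ i)"
proof -
  have F: "F x = (\<Sum>i\<in>UNIV. (F x $ i) *\<^sub>R axis i 1)" for x
    by (simp add: vec_eq_iff axis_def if_distrib[where f="\<lambda>c. _ * c"] cong: if_cong)
  have "F = (\<lambda>x. \<Sum>i\<in>UNIV. (F x $ i) *\<^sub>R axis i 1)" using F by (rule ext)
  then have "integrable M F"
    by (rule ssubst) (intro Bochner_Integration.integrable_sum integrable_scaleR_left assms)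
  then show ?thesis by (rule integral_bounded_linear[OF bounded_linear_vec_nth, symmetric])
qed

lemma sums_matrix_nth:
  fixes F :: "nat \<Rightarrow> real ^ 'd ^ 'd"
  assumes "\<And>i j. (\<lambda>t. F t $ i $ j) sums (S $ i $ j)" shows "F sums S"
  using assms unfolding sums_def by (intro vec_tendstoI) simp

lemma quadratic_form: "v \<bullet> (A *v v) = (\<Sum>i\<in>UNIV. \<Sum>j\<in>UNIV. v $ i * v $ j * A $ i $ j)"
  for A :: "real ^ 'd ^ 'd"
  by (simp add: inner_vec_def matrix_vector_mult_def sum_distrib_left mult_ac)

lemma asymptotic_varianceI:
  fixes S :: "nat \<Rightarrow> 'w \<Rightarrow> real ^ 'd"
  assumes M: "prob_space M" and S: "\<And>n. S n \<in> borel_measurable M" and psd: "psd \<Sigma>"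
    and lim: "\<And>v. (\<lambda>n. CLINT \<omega>|M. iexp (v \<bullet> ((1 / sqrt (real n)) *\<^sub>R S n \<omega>)))
      \<longlonglongrightarrow> complex_of_real (exp (- (v \<bullet> (\<Sigma> *v v)) / 2))"
  shows "asymptotic_variance M S \<Sigma>"
proof -
  obtain N where N: "prob_space N" "sets N = sets borel"
    "\<And>v. (CLINT y|N. iexp (v \<bullet> y)) = complex_of_real (exp (- (v \<bullet> (\<Sigma> *v v)) / 2))"
    using gaussian_exists[OF psd] by blast
  have "conv_in_distr M (\<lambda>n \<omega>. (1 / sqrt (real n)) *\<^sub>R S n \<omega>) N"
    by (rule levy_continuity_vec[OF M _ N(1,2)]) (use S lim N(3) in auto)
  then show ?thesis using psd N unfolding asymptotic_variance_def by blast
qed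

context borel_prob begin

lemma integral_quadratic:
  fixes a b :: "'d::finite \<Rightarrow> 'a \<Rightarrow> real"
  assumes "\<And>i. L2 \<pi> (a i)" "\<And>i. L2 \<pi> (b i)"
  shows "(\<Sum>i\<in>UNIV. \<Sum>j\<in>UNIV. v $ i * v $ j * (LINT x|\<pi>. a i x * b j x))
    = (LINT x|\<pi>. (\<Sum>i\<in>UNIV. v $ i * a i x) * (\<Sum>j\<in>UNIV. v $ j * b j x))"
proof -
  have "(LINT x|\<pi>. (\<Sum>i\<in>UNIV. v $ i * a i x) * (\<Sum>j\<in>UNIV. v $ j * b j x))
      = (LINT x|\<pi>. (\<Sum>i\<in>UNIV. \<Sum>j\<in>UNIV. v $ i * v $ j * (a i x * b j x)))"
    by (intro Bochner_Integration.integral_cong) (simp_all add: sum_product mult_ac)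
  also have "\<dots> = (\<Sum>i\<in>UNIV. \<Sum>j\<in>UNIV. v $ i * v $ j * (LINT x|\<pi>. a i x * b j x))"
    using assms by (simp add: L2_mult)
  finally show ?thesis ..
qed

end

text \<open>Everything is read off in a direction v, where v . g takes the place of g. The Poisson
  solutions are chosen once per coordinate, so that \<open>U v\<close> is linear in v and the
  limiting variances are quadratic forms of fixed matrices.\<close>

theorem (in drift_sweep) sweep_asymptotic_variances:
  fixes g :: "'a \<Rightarrow> real ^ 'd"
  assumes g: "g \<in> borel_measurable borel" and gW: "\<And>k x i. k \<in> {1..K} \<Longrightarrow> \<bar>g x $ i\<bar> \<le> W k x"
    and g0: "(LINT x|\<pi>. g x) = 0" and ch: "sweep_chain P K \<nu> M X"
  defines "G \<equiv> (LINT x|\<pi>. outer_prod (g x) (g x))"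
    and "C \<equiv> \<lambda>k t. LINT x|\<pi>. outer_prod (g x) (sweep_op P K (Suc t) k g x) + outer_prod (sweep_op P K (Suc t) k g x) (g x)"
    and "H \<equiv> \<lambda>k. LINT x|\<pi>. outer_prod (kernel_op (P k) g x) (kernel_op (P k) g x)"
  defines "\<Sigma>0 \<equiv> (1 / real K) *\<^sub>R (\<Sum>k=1..K. G + (\<Sum>t. C k t))"
  defines "\<Sigma>1 \<equiv> \<Sigma>0 - G - (1 / real K) *\<^sub>R (\<Sum>k=1..K. H k)"
  shows "asymptotic_variance M (\<lambda>n \<omega>. \<Sum>t<n. g (X t \<omega>)) \<Sigma>0"
    and "asymptotic_variance M (\<lambda>n \<omega>. \<Sum>t<n. kernel_op (P ((cyc K ^^ t) 1)) g (X t \<omega>)) \<Sigma>1"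
    and "\<And>k. k \<in> {1..K} \<Longrightarrow> summable (C k)"
    and "loewner_le \<Sigma>1 \<Sigma>0"
proof -
  interpret M: prob_space M using ch by (simp add: sweep_chain_def)
  have X: "X t \<in> M \<rightarrow>\<^sub>M borel" for t using ch by (simp add: sweep_chain_def)
  have one: "1 \<in> {1..K}" using K by simp
  have Kp: "0 < real K" using K by simp
  define gi where "gi i x = g x $ i" for i x
  have gim: "gi i \<in> borel_measurable borel" for i
    unfolding gi_def[abs_def]
    by (rule measurable_compose[OF g borel_measurable_continuous_onI]) (intro continuous_intros)
  have gL: "L2 \<pi> (gi i)" for i
  proof (rule L2_bound[OF gim W_L2[OF one]])
    show "\<bar>gi i x\<bar> \<le> \<bar>W 1 x\<bar>" for x using gW[OF one, of x i] by (simp add: gi_def)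
  qed
  have gi0: "(LINT x|\<pi>. gi i x) = 0" for i
    using integral_vec_nth[of \<pi> g i] L2_integrable[OF gL] g0 by (simp add: gi_def[abs_def])
  define sol where "sol i V \<longleftrightarrow> (\<forall>k\<in>{1..K}. L2 \<pi> (V k)) \<and>
      (\<forall>k\<in>{1..K}. AE x in \<pi>. V k x - kernel_int (P k) (V (cyc K k)) x = gi i x) \<and>
      (\<forall>k\<in>{1..K}. \<forall>h. L2 \<pi> h \<longrightarrow> (\<lambda>t. LINT x|\<pi>. h x * sweep_iter P K t k (gi i) x) sums (LINT x|\<pi>. h x * V k x))" for i V
  have "\<forall>i. \<exists>V. sol i V"
  proof
    fix i
    show "\<exists>V. sol i V"
      by (rule sweep_poisson[OF gim _ gi0, of i]) (use gW in \<open>simp add: gi_def\<close>, unfold sol_def, blast)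
  qed
  from choice[OF this] obtain V where V: "\<And>i. sol i (V i)" by blast
  have VL: "L2 \<pi> (V i k)" if "k \<in> {1..K}" for i k
    using V[of i] that unfolding sol_def by blast
  have Veq: "AE x in \<pi>. V i k x - kernel_int (P k) (V i (cyc K k)) x = gi i x" if "k \<in> {1..K}" for i k
    using V[of i] that unfolding sol_def by blast
  have Vsum: "(\<lambda>t. LINT x|\<pi>. h x * sweep_iter P K t k (gi i) x) sums (LINT x|\<pi>. h x * V i k x)"
    if "k \<in> {1..K}" "L2 \<pi> h" for i k h
    using V[of i] that unfolding sol_def by blast
  have sw: "sweep_op P K t k g x $ i = sweep_iter P K t k (gi i) x" for t k x i
    unfolding sweep_op_nth gi_def[abs_def] ..
  have ko: "kernel_op (P k) g x $ i = kernel_int (P k) (gi i) x" for k x i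
    by (simp add: kernel_op_def kernel_int_def gi_def)
  have kL: "L2 \<pi> (kernel_int (P k) (gi i))" if "k \<in> {1..K}" for k i
    using invariant_kernel.kernel_int_L2(1)[OF inv_ker[OF that] gL] .
  have G: "G $ i $ j = (LINT x|\<pi>. gi i x * gi j x)" for i j
    unfolding G_def using L2_mult[OF gL gL]
    by (subst integral_matrix_nth(2)) (auto simp: outer_prod_def gi_def[symmetric])
  have H: "H k $ i $ j = (LINT x|\<pi>. kernel_int (P k) (gi i) x * kernel_int (P k) (gi j) x)" if "k \<in> {1..K}" for k i j
    unfolding H_def using L2_mult[OF kL[OF that] kL[OF that]]
    by (subst integral_matrix_nth(2)) (auto simp: outer_prod_def ko)
  have C: "C k t $ i $ j = (LINT x|\<pi>. gi i x * sweep_iter P K (Suc t) k (gi j) x) + (LINT x|\<pi>. gi j x * sweep_iter P K (Suc t) k (gi i) x)"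
    if k: "k \<in> {1..K}" for k t i j
  proof -
    have e: "(outer_prod (g x) (sweep_op P K (Suc t) k g x) + outer_prod (sweep_op P K (Suc t) k g x) (g x)) $ i $ j
        = gi i x * sweep_iter P K (Suc t) k (gi j) x + gi j x * sweep_iter P K (Suc t) k (gi i) x" for x i j
      by (simp add: outer_prod_def sw gi_def[symmetric] mult.commute del: sweep_op.simps sweep_iter.simps)
    have i: "integrable \<pi> (\<lambda>x. gi i x * sweep_iter P K (Suc t) k (gi j) x)" for i j
      by (intro L2_mult gL sweep_iter_L2(1) k)
    show ?thesis unfolding C_def
      by (subst integral_matrix_nth(2)) (simp_all only: e i Bochner_Integration.integrable_add Bochner_Integration.integral_add)
  qed
  \<comment> \<open>The two products with V contain the term t = 0 twice; subtracting g_i g_j leaves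
    it once.\<close>
  define A where "A k = (\<chi> i j. (LINT x|\<pi>. gi i x * V j k x) + (LINT x|\<pi>. gi j x * V i k x) - (LINT x|\<pi>. gi i x * gi j x))" for k
  have Csums: "C k sums (A k - G)" if k: "k \<in> {1..K}" for k
  proof (rule sums_matrix_nth)
    fix i j
    have s: "(\<lambda>t. LINT x|\<pi>. gi i x * sweep_iter P K (Suc t) k (gi j) x) sums ((LINT x|\<pi>. gi i x * V j k x) - (LINT x|\<pi>. gi i x * gi j x))" for i j
      using Vsum[OF k gL, of i j] sums_Suc_iff[of "\<lambda>t. LINT x|\<pi>. gi i x * sweep_iter P K t k (gi j) x"]
      by (simp del: sweep_iter.simps(2))
    have "(\<lambda>t. C k t $ i $ j) sums (((LINT x|\<pi>. gi i x * V j k x) - (LINT x|\<pi>. gi i x * gi j x))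
        + ((LINT x|\<pi>. gi j x * V i k x) - (LINT x|\<pi>. gi j x * gi i x)))"
      unfolding C[OF k] by (intro sums_add s)
    then show "(\<lambda>t. C k t $ i $ j) sums ((A k - G) $ i $ j)"
      by (simp add: A_def G mult.commute algebra_simps)
  qed
  show "summable (C k)" if "k \<in> {1..K}" for k using Csums[OF that] by (rule sums_summable)
  have \<Sigma>0: "\<Sigma>0 = (1 / real K) *\<^sub>R (\<Sum>k\<in>{1..K}. A k)"
  proof -
    have "G + (\<Sum>t. C k t) = A k" if "k \<in> {1..K}" for k
      using sums_unique[OF Csums[OF that], symmetric] by simp
    then have "(\<Sum>k\<in>{1..K}. G + (\<Sum>t. C k t)) = (\<Sum>k\<in>{1..K}. A k)" by (intro sum.cong refl)
    then show ?thesis unfolding \<Sigma>0_def by (simp only:)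
  qed
  have symA: "A k $ i $ j = A k $ j $ i" for k i j by (simp add: A_def mult.commute)
  have symG: "G $ i $ j = G $ j $ i" for i j by (simp add: G mult.commute)
  have symH: "H k $ i $ j = H k $ j $ i" if "k \<in> {1..K}" for k i j by (simp add: H[OF that] mult.commute)
  have sym0: "transpose \<Sigma>0 = \<Sigma>0"
    by (simp add: \<Sigma>0 transpose_def vec_eq_iff symA)
  have symR: "transpose (\<Sigma>0 - \<Sigma>1) = \<Sigma>0 - \<Sigma>1"
    using symG symH by (simp add: \<Sigma>1_def transpose_def vec_eq_iff)
  have sym1: "transpose \<Sigma>1 = \<Sigma>1"
  proof -
    have "\<Sigma>0 $ i $ j = \<Sigma>0 $ j $ i" "(\<Sigma>0 - \<Sigma>1) $ i $ j = (\<Sigma>0 - \<Sigma>1) $ j $ i" for i j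
      using sym0 symR by (simp_all add: transpose_def vec_eq_iff)
    then show ?thesis by (simp add: transpose_def vec_eq_iff)
  qed

  define f where "f v x = (\<Sum>i\<in>UNIV. v $ i * gi i x)" for v x
  define U where "U v k x = (\<Sum>i\<in>UNIV. v $ i * V i k x)" for v k x
  have fL: "L2 \<pi> (f v)" for v unfolding f_def[abs_def] by (intro L2_sum L2_cmult gL)
  have UL: "L2 \<pi> (U v k)" if "k \<in> {1..K}" for v k unfolding U_def[abs_def] by (intro L2_sum L2_cmult VL that)
  have fm: "f v \<in> borel_measurable borel" for v by (rule L2_meas[OF fL])
  have f_inner: "f v x = v \<bullet> g x" for v x by (simp add: f_def inner_vec_def gi_def)
  have kernel_int_sum: "AE x in \<pi>. kernel_int (P k) (\<lambda>y. \<Sum>i\<in>UNIV. v $ i * a i y) x = (\<Sum>i\<in>UNIV. v $ i * kernel_int (P k) (a i) x)"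
    if k: "k \<in> {1..K}" and a: "\<And>i. L2 \<pi> (a i)" for k v a
  proof -
    interpret invariant_kernel \<pi> "P k" by (rule inv_ker[OF k])
    have "AE x in \<pi>. kernel_int (P k) (\<lambda>y. \<Sum>i\<in>UNIV. v $ i * a i y) x = (\<Sum>i\<in>UNIV. kernel_int (P k) (\<lambda>y. v $ i * a i y) x)"
      by (intro kernel_int_AE_sum L2_integrable L2_cmult a) simp
    then show ?thesis by (simp add: kernel_int_cmult)
  qed
  have Ueq: "AE x in \<pi>. f v x = U v k x - kernel_int (P k) (U v (cyc K k)) x" if k: "k \<in> {1..K}" for v k
  proof -
    have "AE x in \<pi>. \<forall>i\<in>UNIV. V i k x - kernel_int (P k) (V i (cyc K k)) x = gi i x"
      by (intro AE_finite_allI Veq k) simp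
    then show ?thesis using kernel_int_sum[OF k, of "\<lambda>i. V i (cyc K k)" v, OF VL[OF cyc_in_range[OF k]]]
    proof eventually_elim
      case (elim x)
      have "f v x = (\<Sum>i\<in>UNIV. v $ i * (V i k x - kernel_int (P k) (V i (cyc K k)) x))"
        unfolding f_def using elim(1) by simp
      also have "\<dots> = U v k x - kernel_int (P k) (U v (cyc K k)) x"
        unfolding U_def[abs_def] elim(2) by (simp add: right_diff_distrib sum_subtractf)
      finally show ?case .
    qed
  qed
  have qA: "v \<bullet> (A k *v v) = 2 * (LINT x|\<pi>. f v x * U v k x) - sq_norm \<pi> (f v)" if k: "k \<in> {1..K}" for v k
  proof -
    have a: "(\<Sum>i\<in>UNIV. \<Sum>j\<in>UNIV. v $ i * v $ j * (LINT x|\<pi>. gi i x * V j k x)) = (LINT x|\<pi>. f v x * U v k x)"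
      unfolding f_def U_def by (rule integral_quadratic[OF gL VL[OF k]])
    have "(\<Sum>i\<in>UNIV. \<Sum>j\<in>UNIV. v $ i * v $ j * (LINT x|\<pi>. gi j x * V i k x))
        = (\<Sum>j\<in>UNIV. \<Sum>i\<in>UNIV. v $ i * v $ j * (LINT x|\<pi>. gi j x * V i k x))" by (rule sum.swap)
    also have "\<dots> = (\<Sum>j\<in>UNIV. \<Sum>i\<in>UNIV. v $ j * v $ i * (LINT x|\<pi>. gi j x * V i k x))"
      by (simp add: mult.commute)
    finally have b: "(\<Sum>i\<in>UNIV. \<Sum>j\<in>UNIV. v $ i * v $ j * (LINT x|\<pi>. gi j x * V i k x)) = (LINT x|\<pi>. f v x * U v k x)"
      using a by simp
    have c: "(\<Sum>i\<in>UNIV. \<Sum>j\<in>UNIV. v $ i * v $ j * (LINT x|\<pi>. gi i x * gi j x)) = sq_norm \<pi> (f v)"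
      unfolding f_def sq_norm_def power2_eq_square by (rule integral_quadratic[OF gL gL])
    show ?thesis
      unfolding quadratic_form A_def vec_lambda_beta
      by (simp only: right_diff_distrib distrib_left sum.distrib sum_subtractf a b c)
  qed
  have qG: "v \<bullet> (G *v v) = sq_norm \<pi> (f v)" for v
    unfolding quadratic_form G f_def sq_norm_def power2_eq_square by (rule integral_quadratic[OF gL gL])
  have Hk: "AE x in \<pi>. kernel_int (P k) (f v) x = v \<bullet> kernel_op (P k) g x" if "k \<in> {1..K}" for v k
    using kernel_int_sum[OF that, of gi v, OF gL] by eventually_elim (simp add: f_def[abs_def] inner_vec_def ko)
  have qH: "v \<bullet> (H k *v v) = sq_norm \<pi> (kernel_int (P k) (f v))" if k: "k \<in> {1..K}" for v k
  proof -
    have "v \<bullet> (H k *v v) = sq_norm \<pi> (\<lambda>x. \<Sum>i\<in>UNIV. v $ i * kernel_int (P k) (gi i) x)"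
      unfolding quadratic_form H[OF k] sq_norm_def power2_eq_square by (rule integral_quadratic[OF kL[OF k] kL[OF k]])
    also have "\<dots> = sq_norm \<pi> (kernel_int (P k) (f v))"
    proof (rule sq_norm_cong_AE)
      show "AE x in \<pi>. (\<Sum>i\<in>UNIV. v $ i * kernel_int (P k) (gi i) x) = kernel_int (P k) (f v) x"
        using kernel_int_sum[OF k, of gi v, OF gL] by eventually_elim (simp add: f_def[abs_def])
    qed (intro L2_meas L2_sum L2_cmult kL[OF k] invariant_kernel.kernel_int_L2(1)[OF inv_ker[OF k] fL])+
    finally show ?thesis .
  qed
  have q_scale: "v \<bullet> (((1 / real K) *\<^sub>R (\<Sum>k\<in>{1..K}. B k)) *v v) = (\<Sum>k\<in>{1..K}. v \<bullet> (B k *v v)) / real K" for v and B :: "nat \<Rightarrow> real ^ 'd ^ 'd"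
  proof -
    have "(\<Sum>k\<in>I. B k) *v v = (\<Sum>k\<in>I. B k *v v)" for I
      by (induction I rule: infinite_finite_induct) (simp_all add: matrix_vector_mult_add_rdistrib)
    then show ?thesis by (simp add: scaleR_matrix_vector_assoc[symmetric] inner_sum_right)
  qed
  have q0: "v \<bullet> (\<Sigma>0 *v v) = (\<Sum>k\<in>{1..K}. sq_norm \<pi> (U v k) - sq_norm \<pi> (kernel_int (P k) (U v (cyc K k)))) / real K" for v
  proof -
    have "v \<bullet> (\<Sigma>0 *v v) = (\<Sum>k\<in>{1..K}. 2 * (LINT x|\<pi>. f v x * U v k x) - sq_norm \<pi> (f v)) / real K"
      unfolding \<Sigma>0 q_scale by (simp only: qA cong: sum.cong)
    moreover have "(\<Sum>k\<in>{1..K}. sq_norm \<pi> (U v k) - sq_norm \<pi> (kernel_int (P k) (U v (cyc K k))))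
        = (\<Sum>k\<in>{1..K}. 2 * (LINT x|\<pi>. f v x * U v k x) - sq_norm \<pi> (f v))"
      by (intro variance_formula[where f="\<lambda>_. f v" and V="U v"] fL UL Ueq)
    ultimately show ?thesis by (simp only:)
  qed
  \<comment> \<open>With g subtracted, \<open>U1\<close> equals Pi_k U_{k+1} almost everywhere, so
    subtracting Pi_k (U_{k+1} - g) from it leaves Pi_k g, the Rao-Blackwellized summand.\<close>
  define U1 where "U1 v k x = U v k x - f v x" for v k x
  \<comment> \<open>Because of the default values in single coordinates this agrees with Pi_k (v .
    g) only almost everywhere, but it is the function that occurs in the sums.\<close>
  define f1 where "f1 v k x = v \<bullet> kernel_op (P k) g x" for v k x
  have U1L: "L2 \<pi> (U1 v k)" if "k \<in> {1..K}" for v k unfolding U1_def[abs_def] by (intro L2_diff UL fL that)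
  have f1m: "f1 v k \<in> borel_measurable borel" if "k \<in> {1..K}" for v k
    unfolding f1_def[abs_def] inner_vec_def ko using L2_meas[OF kL[OF that]] by measurable
  have f1L: "L2 \<pi> (f1 v k)" if "k \<in> {1..K}" for v k
    unfolding f1_def[abs_def] inner_vec_def ko inner_real_def by (intro L2_sum L2_cmult kL that)
  have U1k: "AE x in \<pi>. U1 v k x = kernel_int (P k) (U v (cyc K k)) x" if "k \<in> {1..K}" for v k
    using Ueq[OF that, of v] by eventually_elim (simp add: U1_def)
  have U1eq: "AE x in \<pi>. f1 v k x = U1 v k x - kernel_int (P k) (U1 v (cyc K k)) x" if k: "k \<in> {1..K}" for v k
  proof -
    interpret invariant_kernel \<pi> "P k" by (rule inv_ker[OF k])
    show ?thesis
      using U1k[OF k, of v] Hk[OF k, of v] kernel_int_AE_lin(2)[OF L2_integrable[OF UL[OF cyc_in_range[OF k]]] L2_integrable[OF fL], of v v]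
      by eventually_elim (simp add: f1_def U1_def[abs_def])
  qed
  have q1: "v \<bullet> (\<Sigma>1 *v v) = (\<Sum>k\<in>{1..K}. sq_norm \<pi> (U1 v k) - sq_norm \<pi> (kernel_int (P k) (U1 v (cyc K k)))) / real K" for v
  proof -
    \<comment> \<open>The projection property turns <Pi_k f, Pi_k U_{k+1}> into <f, Pi_k U_{k+1}> =
      <f, U_k - f>. Compared with the summand for g, one squared norm of f and one of Pi_k f are
      lost.\<close>
    have summand: "2 * (LINT x|\<pi>. f1 v k x * U1 v k x) - sq_norm \<pi> (f1 v k)
        = (2 * (LINT x|\<pi>. f v x * U v k x) - sq_norm \<pi> (f v)) - sq_norm \<pi> (f v) - sq_norm \<pi> (kernel_int (P k) (f v))" if k: "k \<in> {1..K}" for k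
    proof -
      interpret projection_kernel \<pi> "P k" by (rule proj[OF k])
      have m: "f1 v k \<in> borel_measurable \<pi>" "U1 v k \<in> borel_measurable \<pi>" "f v \<in> borel_measurable \<pi>"
        "kernel_int (P k) (f v) \<in> borel_measurable \<pi>" "kernel_int (P k) (U v (cyc K k)) \<in> borel_measurable \<pi>"
        by (intro meas_pi L2_meas f1L U1L fL kernel_int_L2 UL cyc_in_range k)+
      have "(LINT x|\<pi>. f1 v k x * U1 v k x) = (LINT x|\<pi>. kernel_int (P k) (f v) x * kernel_int (P k) (U v (cyc K k)) x)"
      proof (rule integral_cong_AE)
        show "AE x in \<pi>. f1 v k x * U1 v k x = kernel_int (P k) (f v) x * kernel_int (P k) (U v (cyc K k)) x"
          using Hk[OF k, of v] U1k[OF k, of v] by eventually_elim (simp add: f1_def)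
      qed (use m in simp_all)
      also have "\<dots> = (LINT x|\<pi>. f v x * kernel_int (P k) (U v (cyc K k)) x)"
        by (rule projection[OF fL UL[OF cyc_in_range[OF k]]])
      also have "\<dots> = (LINT x|\<pi>. f v x * U1 v k x)"
      proof (rule integral_cong_AE)
        show "AE x in \<pi>. f v x * kernel_int (P k) (U v (cyc K k)) x = f v x * U1 v k x"
          using U1k[OF k, of v] by eventually_elim simp
      qed (use m in simp_all)
      also have "\<dots> = (LINT x|\<pi>. f v x * U v k x) - sq_norm \<pi> (f v)"
        unfolding U1_def right_diff_distrib sq_norm_def power2_eq_square
        by (intro Bochner_Integration.integral_diff L2_mult fL UL k)
      finally have e: "(LINT x|\<pi>. f1 v k x * U1 v k x) = (LINT x|\<pi>. f v x * U v k x) - sq_norm \<pi> (f v)" .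
      have "sq_norm \<pi> (f1 v k) = sq_norm \<pi> (kernel_int (P k) (f v))"
      proof (rule sq_norm_cong_AE)
        show "AE x in \<pi>. f1 v k x = kernel_int (P k) (f v) x"
          using Hk[OF k, of v] by eventually_elim (simp add: f1_def)
      qed (intro L2_meas f1L kernel_int_L2 fL k)+
      then show ?thesis using e by simp
    qed
    have "v \<bullet> (\<Sigma>1 *v v) = v \<bullet> (\<Sigma>0 *v v) - sq_norm \<pi> (f v) - (\<Sum>k\<in>{1..K}. sq_norm \<pi> (kernel_int (P k) (f v))) / real K"
      unfolding \<Sigma>1_def matrix_vector_mult_diff_rdistrib inner_diff_right q_scale qG using qH by simp
    also have "\<dots> = (\<Sum>k\<in>{1..K}. 2 * (LINT x|\<pi>. f1 v k x * U1 v k x) - sq_norm \<pi> (f1 v k)) / real K"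
      unfolding \<Sigma>0 q_scale using Kp
      by (simp add: summand qA sum_subtractf diff_divide_distrib)
    also have "\<dots> = (\<Sum>k\<in>{1..K}. sq_norm \<pi> (U1 v k) - sq_norm \<pi> (kernel_int (P k) (U1 v (cyc K k)))) / real K"
    proof -
      have "(\<Sum>k\<in>{1..K}. sq_norm \<pi> (U1 v k) - sq_norm \<pi> (kernel_int (P k) (U1 v (cyc K k))))
          = (\<Sum>k\<in>{1..K}. 2 * (LINT x|\<pi>. f1 v k x * U1 v k x) - sq_norm \<pi> (f1 v k))"
        by (intro variance_formula[where f="f1 v" and V="U1 v"] f1L U1L U1eq)
      then show ?thesis by (simp only:)
    qed
    finally show ?thesis .
  qed
  have psd0: "psd \<Sigma>0"
    unfolding psd_def using sym0 sweep_char_limit(1)[where f="\<lambda>_. f v" and V="U v" for v, OF fm UL Ueq one q0] by blast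
  have psd1: "psd \<Sigma>1"
    unfolding psd_def using sym1 sweep_char_limit(1)[where f="f1 v" and V="U1 v" for v, OF f1m U1L U1eq one q1] by blast
  show "loewner_le \<Sigma>1 \<Sigma>0"
    unfolding loewner_le_def psd_def
  proof (intro conjI allI)
    show "transpose (\<Sigma>0 - \<Sigma>1) = \<Sigma>0 - \<Sigma>1" by (rule symR)
    fix v
    have e: "\<Sigma>0 - \<Sigma>1 = G + (1 / real K) *\<^sub>R (\<Sum>k=1..K. H k)" by (simp add: \<Sigma>1_def)
    have "v \<bullet> ((\<Sigma>0 - \<Sigma>1) *v v) = sq_norm \<pi> (f v) + (\<Sum>k\<in>{1..K}. sq_norm \<pi> (kernel_int (P k) (f v))) / real K"
      unfolding e matrix_vector_mult_add_rdistrib inner_add_right q_scale qG using qH by simp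
    then show "0 \<le> v \<bullet> ((\<Sigma>0 - \<Sigma>1) *v v)"
      by (simp add: sq_norm_nonneg sum_nonneg)
  qed
  have gX: "(\<lambda>\<omega>. g (X t \<omega>)) \<in> borel_measurable M" for t by (rule measurable_compose[OF X g])
  show "asymptotic_variance M (\<lambda>n \<omega>. \<Sum>t<n. g (X t \<omega>)) \<Sigma>0"
  proof (rule asymptotic_varianceI[OF M.prob_space_axioms _ psd0])
    show "(\<lambda>\<omega>. \<Sum>t<n. g (X t \<omega>)) \<in> borel_measurable M" for n by (intro borel_measurable_sum gX)
    fix v
    have "v \<bullet> ((1 / sqrt (real n)) *\<^sub>R (\<Sum>t<n. g (X t \<omega>))) = (\<Sum>t<n. f v (X t \<omega>) / sqrt (real n))" for n \<omega>
      by (simp add: inner_sum_right f_inner sum_divide_distrib)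
    then show "(\<lambda>n. CLINT \<omega>|M. iexp (v \<bullet> ((1 / sqrt (real n)) *\<^sub>R (\<Sum>t<n. g (X t \<omega>)))))
      \<longlonglongrightarrow> complex_of_real (exp (- (v \<bullet> (\<Sigma>0 *v v)) / 2))"
      using chain_char_limit[where f="\<lambda>_. f v" and V="U v", OF fm UL Ueq q0 ch] by (simp only:)
  qed
  have kX: "(\<lambda>\<omega>. kernel_op (P ((cyc K ^^ t) 1)) g (X t \<omega>)) \<in> borel_measurable M" for t
  proof -
    let ?k = "(cyc K ^^ t) 1"
    have "kernel_op (P ?k) g = (\<lambda>x. \<Sum>i\<in>UNIV. kernel_int (P ?k) (gi i) x *\<^sub>R axis i 1)"
      by (simp add: fun_eq_iff vec_eq_iff ko axis_def if_distrib[where f="\<lambda>c. _ * c"] cong: if_cong)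
    also have "\<dots> \<in> borel_measurable borel"
      using L2_meas[OF kL[OF cyc_iter_in_range[OF one]]]
      by (intro borel_measurable_sum borel_measurable_scaleR borel_measurable_const)
    finally show ?thesis by (rule measurable_compose[OF X])
  qed
  show "asymptotic_variance M (\<lambda>n \<omega>. \<Sum>t<n. kernel_op (P ((cyc K ^^ t) 1)) g (X t \<omega>)) \<Sigma>1"
  proof (rule asymptotic_varianceI[OF M.prob_space_axioms _ psd1])
    show "(\<lambda>\<omega>. \<Sum>t<n. kernel_op (P ((cyc K ^^ t) 1)) g (X t \<omega>)) \<in> borel_measurable M" for n
      by (intro borel_measurable_sum kX)
    fix v
    have "v \<bullet> ((1 / sqrt (real n)) *\<^sub>R (\<Sum>t<n. kernel_op (P ((cyc K ^^ t) 1)) g (X t \<omega>)))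
        = (\<Sum>t<n. f1 v ((cyc K ^^ t) 1) (X t \<omega>) / sqrt (real n))" for n \<omega>
      by (simp add: inner_sum_right f1_def sum_divide_distrib)
    then show "(\<lambda>n. CLINT \<omega>|M. iexp (v \<bullet> ((1 / sqrt (real n)) *\<^sub>R (\<Sum>t<n. kernel_op (P ((cyc K ^^ t) 1)) g (X t \<omega>)))))
      \<longlonglongrightarrow> complex_of_real (exp (- (v \<bullet> (\<Sigma>1 *v v)) / 2))"
      using chain_char_limit[where f="f1 v" and V="U1 v", OF f1m U1L U1eq q1 ch] by (simp only:)
  qed
qed

theorem corollary2:
  fixes \<pi> \<psi> \<nu> :: "'a::polish_space measure"
    and K :: nat
    and P :: "nat \<Rightarrow> 'a \<Rightarrow> 'a measure"
    and m :: "nat \<Rightarrow> nat"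
    and h :: "nat \<Rightarrow> 'a \<Rightarrow> nat \<Rightarrow> real"
    and D :: "nat \<Rightarrow> 'a set"
    and W :: "nat \<Rightarrow> 'a \<Rightarrow> real"
    and lam b :: "nat \<Rightarrow> real"
    and g :: "'a \<Rightarrow> real ^ 'd"
    and M :: "'w measure"
    and X :: "nat \<Rightarrow> 'w \<Rightarrow> 'a"
  assumes "prob_space \<pi>" and "sets \<pi> = sets borel"
    and "K \<ge> 1"
    and "\<And>k. k \<in> {1..K} \<Longrightarrow> prob_kernel (P k)"
    and "g \<in> borel_measurable borel"
    and gibbs: "\<And>k. k \<in> {1..K} \<Longrightarrow>
          m k \<ge> 1 \<and> h k \<in> borel \<rightarrow>\<^sub>M PiM {..<m k} (\<lambda>_. borel) \<and> gibbs_kernel (P k) (m k) (h k) \<pi>"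
    and irreducible: "prob_space \<psi>" "sets \<psi> = sets borel"
          "\<And>k A x. k \<in> {1..K} \<Longrightarrow> A \<in> sets borel \<Longrightarrow> measure \<psi> A > 0 \<Longrightarrow>
             \<exists>t>0. measure (sweep_kernel P K (K * t) k x) A > 0"
    and drift: "\<And>k. k \<in> {1..K} \<Longrightarrow> small_set (sweep_kernel P K K k) (D k)"
          "\<And>k. k \<in> {1..K} \<Longrightarrow> lam k < 1"
          "\<And>k. k \<in> {1..K} \<Longrightarrow> W k \<in> borel_measurable borel"
          "\<And>k x. k \<in> {1..K} \<Longrightarrow> W k x \<ge> 1"
          "\<And>k x. k \<in> {1..K} \<Longrightarrow>
             (\<integral>\<^sup>+y. ennreal (W k y) \<partial>sweep_kernel P K K k x)
               \<le> ennreal (lam k * W k x + b k * indicator (D k) x)"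
    and "\<And>k. k \<in> {1..K} \<Longrightarrow> integrable \<pi> (\<lambda>x. (W k x)\<^sup>2)"
    and "\<And>k x a. k \<in> {1..K} \<Longrightarrow> norm a \<le> 1 \<Longrightarrow> \<bar>a \<bullet> g x\<bar> \<le> W k x"
    and "(LINT x|\<pi>. g x) = 0"
    and chain: "sweep_chain P K \<nu> M X"
  shows "\<exists>\<Sigma>\<^sub>0 \<Sigma>\<^sub>1 :: real ^ 'd ^ 'd.
      asymptotic_variance M (\<lambda>n \<omega>. \<Sum>t<n. g (X t \<omega>)) \<Sigma>\<^sub>0 \<and>
      asymptotic_variance M (\<lambda>n \<omega>. \<Sum>t<n. kernel_op (P ((cyc K ^^ t) 1)) g (X t \<omega>)) \<Sigma>\<^sub>1 \<and>
      (\<forall>k\<in>{1..K}. summable (\<lambda>t. LINT x|\<pi>.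
         outer_prod (g x) (sweep_op P K (Suc t) k g x)
         + outer_prod (sweep_op P K (Suc t) k g x) (g x))) \<and>
      \<Sigma>\<^sub>0 = (1 / real K) *\<^sub>R (\<Sum>k=1..K.
         (LINT x|\<pi>. outer_prod (g x) (g x)) +
         (\<Sum>t. LINT x|\<pi>.
            outer_prod (g x) (sweep_op P K (Suc t) k g x)
            + outer_prod (sweep_op P K (Suc t) k g x) (g x))) \<and>
      \<Sigma>\<^sub>1 = \<Sigma>\<^sub>0 - (LINT x|\<pi>. outer_prod (g x) (g x))
         - (1 / real K) *\<^sub>R (\<Sum>k=1..K.
             LINT x|\<pi>. outer_prod (kernel_op (P k) g x) (kernel_op (P k) g x)) \<and>
      loewner_le \<Sigma>\<^sub>1 \<Sigma>\<^sub>0"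
proof -
  interpret borel_prob \<pi> using assms(1,2) by (simp add: borel_prob_def borel_prob_axioms_def)
  have proj: "projection_kernel \<pi> (P k)" if "k \<in> {1..K}" for k
    using gibbs[OF that] assms(1,2) gibbs_projection_kernel[of \<pi> "h k" "m k" "P k"] by blast
  interpret projection_sweep \<pi> P K
    by (intro projection_sweep.intro projection_sweep_axioms.intro borel_prob_axioms assms(3) proj)
  \<comment> \<open>Raising \<open>lam k\<close> to at least 1/2 and \<open>b k\<close> to at least
    1 supplies the strict positivity that \<open>drift_kernel\<close> asks for, keeps the first
    constant below 1 and preserves the drift inequality.\<close>
  have dk: "drift_kernel (sweep_kernel P K K k) (W k) (D k) (max (lam k) (1 / 2)) (max (b k) 1)"
    if k: "k \<in> {1..K}" for k
  proof
    show "prob_kernel (sweep_kernel P K K k)" by (rule sweep_kernel_prob[OF k])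
    show "W k \<in> borel_measurable borel" by (rule drift(3)[OF k])
    show "1 \<le> W k x" for x by (rule drift(4)[OF k])
    show "0 < max (lam k) (1 / 2)" "max (lam k) (1 / 2) < 1" "0 < max (b k) 1"
      using drift(2)[OF k] by auto
    show "D k \<in> sets borel" using drift(1)[OF k] by (simp add: small_set_def)
    fix x
    have "lam k * W k x + b k * indicator (D k) x
        \<le> max (lam k) (1 / 2) * W k x + max (b k) 1 * indicator (D k) x"
      using drift(4)[OF k, of x] by (intro add_mono mult_right_mono) auto
    then show "(\<integral>\<^sup>+y. ennreal (W k y) \<partial>sweep_kernel P K K k x)
        \<le> ennreal (max (lam k) (1 / 2) * W k x + max (b k) 1 * indicator (D k) x)"
      using order_trans[OF drift(5)[OF k] ennreal_leI] by blast
  qed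
  have WL: "L2 \<pi> (W k)" if "k \<in> {1..K}" for k
    using drift(3)[OF that] assms(15)[OF that] by (simp add: L2_def)
  interpret drift_sweep \<pi> P K W D "\<lambda>k. max (lam k) (1 / 2)" "\<lambda>k. max (b k) 1"
    by (intro drift_sweep.intro drift_sweep_axioms.intro projection_sweep_axioms dk drift(1) WL)
  \<comment> \<open>The coordinate vectors are admissible directions.\<close>
  have gW: "\<bar>g x $ i\<bar> \<le> W k x" if "k \<in> {1..K}" for k x i
    using assms(16)[OF that, of "axis i 1" x] by (simp add: inner_axis')
  note res = sweep_asymptotic_variances[OF assms(5) gW assms(17) chain]
  \<comment> \<open>The two matrices stay schematic and are determined by unification with the facts
    in \<open>res\<close>.\<close>
  show ?thesis
    by (rule exI, rule exI, intro conjI ballI) (rule res refl | assumption)+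
qed

end
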